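(* Let $m\ge 2$ be an integer. When $L=K_{q_1,q_2}$ with $q_1,q_2\ge 2$, the group $H=\pi_1(X_{2m,L})$ is an amalgam of $(q_1-1)(q_2-1)$ many genus $(m-1)$ surface groups over rank $(m-1)$ free groups.
   Context: $K_{q_1,q_2}$ is the complete bipartite graph with vertex set $\{x_1,\dots,x_{q_1}\}\sqcup\{y_1,\dots,y_{q_2}\}$ and an edge $(x_i,y_j)$ for every $1\le i\le q_1$, $1\le j\le q_2$. The polygonal complex $X=X_{2m,L}$ is constructed as follows. For each edge $(x_i,y_j)$ of $L$ take a $2m$-gon $P_{ij}$, orient its boundary edges cyclically, and label them in cyclic order by the word $x_i^1y_j^1x_i^2y_j^2\cdots x_i^my_j^m$ (superscripts are indices, not powers). Then $X$ is obtained by gluing all the polygons $P_{ij}$ together along edges with the same label, respecting orientation. The group $H$ is the topological fundamental group of $X$. Terminology: "amalgam" of groups over other groups is used in the sense of the direct limit (colimit) of a diagram of groups whose maps are embeddings of the latter groups (here, the free groups) into the former groups (here, the surface groups). *)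

theory Defs
  imports "HOL-Analysis.Analysis" "HOL-Algebra.Group"
begin

section \<open>Fundamental group of an abstract topological space\<close>

text \<open>Loops are functions on \<open>real\<close>, but only their values on \<open>[0,1]\<close> matter: loops agreeing there
  are related by \<open>loop_homotopic\<close>.\<close>

definition loops :: "'a topology \<Rightarrow> 'a \<Rightarrow> (real \<Rightarrow> 'a) set" where
  "loops X a = {p. pathin X p \<and> p 0 = a \<and> p 1 = a}"

definition loop_homotopic :: "'a topology \<Rightarrow> 'a \<Rightarrow> ((real \<Rightarrow> 'a) \<times> (real \<Rightarrow> 'a)) set" where
  "loop_homotopic X a = {(p, q). p \<in> loops X a \<and> q \<in> loops X a \<and>
     homotopic_with (\<lambda>r. r 0 = a \<and> r 1 = a) (top_of_set {0..1}) X p q}"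

text \<open>The library's \<open>joinpaths\<close> requires a point type of class \<open>topological_space\<close>, which the
  points of a quotient space are not.\<close>

definition loop_concat :: "(real \<Rightarrow> 'a) \<Rightarrow> (real \<Rightarrow> 'a) \<Rightarrow> real \<Rightarrow> 'a" where
  "loop_concat p q = (\<lambda>t. if t \<le> 1/2 then p (2 * t) else q (2 * t - 1))"

definition fundamental_group :: "'a topology \<Rightarrow> 'a \<Rightarrow> (real \<Rightarrow> 'a) set monoid" where
  "fundamental_group X a =
    \<lparr> carrier = loops X a // loop_homotopic X a,
      mult = (\<lambda>A B. \<Union>p\<in>A. \<Union>q\<in>B. loop_homotopic X a `` {loop_concat p q}),
      one = loop_homotopic X a `` {\<lambda>_. a} \<rparr>"


section \<open>Words and group presentations\<close>

text \<open>\<open>(s, True)\<close> stands for the letter \<open>s\<close> and \<open>(s, False)\<close> for its formal inverse.\<close>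

type_synonym 'l word = "('l \<times> bool) list"

definition words :: "'l set \<Rightarrow> 'l word set" where
  "words S = lists (S \<times> UNIV)"

definition insertions :: "'l set \<Rightarrow> 'l word set \<Rightarrow> ('l word \<times> 'l word) set" where
  "insertions S R = {(u @ v, u @ r @ v) | u v r. u \<in> words S \<and> v \<in> words S \<and>
     r \<in> R \<union> {[(s, b), (s, \<not> b)] | s b. s \<in> S}}"

definition word_equiv :: "'l set \<Rightarrow> 'l word set \<Rightarrow> ('l word \<times> 'l word) set" where
  "word_equiv S R = {(u, v). u \<in> words S \<and> v \<in> words S \<and>
     (u, v) \<in> (insertions S R \<union> (insertions S R)\<inverse>)\<^sup>*}"

definition presented_group :: "'l set \<Rightarrow> 'l word set \<Rightarrow> 'l word set monoid" where
  "presented_group S R =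
    \<lparr> carrier = words S // word_equiv S R,
      mult = (\<lambda>A B. \<Union>u\<in>A. \<Union>v\<in>B. word_equiv S R `` {u @ v}),
      one = word_equiv S R `` {[]} \<rparr>"

definition generator :: "'l set \<Rightarrow> 'l word set \<Rightarrow> 'l \<Rightarrow> 'l word set" where
  "generator S R s = word_equiv S R `` {[(s, True)]}"

definition free_group :: "nat \<Rightarrow> nat word set monoid" where
  "free_group n = presented_group {..<n} {}"


section \<open>Amalgams as direct limits\<close>

text \<open>A diagram of embeddings: \<open>A\<close> is the set of arrows, the arrow \<open>(j, i)\<close> being the embedding
  \<open>\<phi> j i\<close> of \<open>F j\<close> into \<open>G i\<close>. The same \<open>F j\<close> may be embedded into several \<open>G i\<close>; an
  \<open>F j\<close> without any arrow, which would contribute a mere free factor, is excluded.\<close>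

definition embedding_diagram ::
  "'i set \<Rightarrow> ('i \<Rightarrow> 'a monoid) \<Rightarrow> 'j set \<Rightarrow> ('j \<Rightarrow> 'b monoid) \<Rightarrow> ('j \<times> 'i) set
     \<Rightarrow> ('j \<Rightarrow> 'i \<Rightarrow> 'b \<Rightarrow> 'a) \<Rightarrow> bool" where
  "embedding_diagram I G J F A \<phi> \<longleftrightarrow>
     (\<forall>i\<in>I. group (G i)) \<and> (\<forall>j\<in>J. group (F j)) \<and>
     A \<subseteq> J \<times> I \<and> (\<forall>j\<in>J. \<exists>i. (j, i) \<in> A) \<and>
     (\<forall>(j, i)\<in>A. \<phi> j i \<in> mon (F j) (G i))"

definition colimit_generators ::
  "'i set \<Rightarrow> ('i \<Rightarrow> 'a monoid) \<Rightarrow> 'j set \<Rightarrow> ('j \<Rightarrow> 'b monoid) \<Rightarrow> ('i \<times> 'a + 'j \<times> 'b) set" where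
  "colimit_generators I G J F =
     (SIGMA i:I. carrier (G i)) <+> (SIGMA j:J. carrier (F j))"

definition colimit_relators ::
  "'i set \<Rightarrow> ('i \<Rightarrow> 'a monoid) \<Rightarrow> 'j set \<Rightarrow> ('j \<Rightarrow> 'b monoid) \<Rightarrow> ('j \<times> 'i) set
     \<Rightarrow> ('j \<Rightarrow> 'i \<Rightarrow> 'b \<Rightarrow> 'a) \<Rightarrow> ('i \<times> 'a + 'j \<times> 'b) word set" where
  "colimit_relators I G J F A \<phi> =
     {[(Inl (i, a), True), (Inl (i, b), True), (Inl (i, a \<otimes>\<^bsub>G i\<^esub> b), False)] | i a b.
        i \<in> I \<and> a \<in> carrier (G i) \<and> b \<in> carrier (G i)} \<union>
     {[(Inr (j, a), True), (Inr (j, b), True), (Inr (j, a \<otimes>\<^bsub>F j\<^esub> b), False)] | j a b.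
        j \<in> J \<and> a \<in> carrier (F j) \<and> b \<in> carrier (F j)} \<union>
     {[(Inr (j, b), True), (Inl (i, \<phi> j i b), False)] | j i b.
        (j, i) \<in> A \<and> b \<in> carrier (F j)}"

text \<open>The direct limit in the category of groups, constructed as the free product of all groups of
  the diagram modulo the identifications \<open>b = \<phi> j i b\<close>. That it has the universal property is
  \<open>colimit_group_cocone\<close> and \<open>colimit_group_universal\<close> below.\<close>

definition colimit_group ::
  "'i set \<Rightarrow> ('i \<Rightarrow> 'a monoid) \<Rightarrow> 'j set \<Rightarrow> ('j \<Rightarrow> 'b monoid) \<Rightarrow> ('j \<times> 'i) set
     \<Rightarrow> ('j \<Rightarrow> 'i \<Rightarrow> 'b \<Rightarrow> 'a) \<Rightarrow> ('i \<times> 'a + 'j \<times> 'b) word set monoid" where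
  "colimit_group I G J F A \<phi> =
     presented_group (colimit_generators I G J F) (colimit_relators I G J F A \<phi>)"

definition colimit_inl where
  "colimit_inl I G J F A \<phi> i a =
     generator (colimit_generators I G J F) (colimit_relators I G J F A \<phi>) (Inl (i, a))"

definition colimit_inr where
  "colimit_inr I G J F A \<phi> j b =
     generator (colimit_generators I G J F) (colimit_relators I G J F A \<phi>) (Inr (j, b))"


subsection \<open>Presented groups\<close>

lemma words_simps [simp]:
  "[] \<in> words S" "x # u \<in> words S \<longleftrightarrow> fst x \<in> S \<and> u \<in> words S"
  "u @ v \<in> words S \<longleftrightarrow> u \<in> words S \<and> v \<in> words S"
  by (auto simp: words_def mem_Times_iff)

lemma equiv_word_equiv: "equiv (words S) (word_equiv S R)"
proof (rule equivI)
  have "sym ((insertions S R \<union> (insertions S R)\<inverse>)\<^sup>*)"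
    by (intro sym_rtrancl) (auto simp: sym_def)
  then show "sym (word_equiv S R)"
    by (auto simp: word_equiv_def sym_def)
qed (auto simp: word_equiv_def refl_on_def trans_def)

lemma word_equivD: "(u, v) \<in> word_equiv S R \<Longrightarrow> u \<in> words S \<and> v \<in> words S"
  by (auto simp: word_equiv_def)

lemma insertionsE:
  assumes "(x, y) \<in> insertions S R"
  obtains u v r where "x = u @ v" "y = u @ r @ v" "u \<in> words S" "v \<in> words S"
    "r \<in> R \<union> {[(s, b), (s, \<not> b)] | s b. s \<in> S}"
proof -
  from assms have "\<exists>u v r. (x, y) = (u @ v, u @ r @ v) \<and> u \<in> words S \<and> v \<in> words S \<and>
      r \<in> R \<union> {[(s, b), (s, \<not> b)] | s b. s \<in> S}"
    unfolding insertions_def mem_Collect_eq .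
  then show thesis
    by (elim exE conjE Pair_inject) (rule that)
qed

lemma insertions_context:
  assumes "(u, v) \<in> insertions S R" "x \<in> words S" "y \<in> words S"
  shows "(x @ u @ y, x @ v @ y) \<in> insertions S R"
proof -
  obtain p q r where "u = p @ q" "v = p @ r @ q" "p \<in> words S" "q \<in> words S"
    "r \<in> R \<union> {[(s, b), (s, \<not> b)] | s b. s \<in> S}"
    using assms(1) by (rule insertionsE)
  then show ?thesis
    using assms(2,3) unfolding insertions_def
    by (intro CollectI exI[of _ "x @ p"] exI[of _ "q @ y"] exI[of _ r]) auto
qed

lemma word_equiv_context:
  assumes "(u, v) \<in> word_equiv S R" "x \<in> words S" "y \<in> words S"
  shows "(x @ u @ y, x @ v @ y) \<in> word_equiv S R"
proof -
  have "(u, v) \<in> (insertions S R \<union> (insertions S R)\<inverse>)\<^sup>*"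
    using assms(1) by (auto simp: word_equiv_def)
  then have "(x @ u @ y, x @ v @ y) \<in> (insertions S R \<union> (insertions S R)\<inverse>)\<^sup>*"
  proof (induction rule: rtrancl_induct)
    case (step v w)
    then have "(x @ v @ y, x @ w @ y) \<in> insertions S R \<union> (insertions S R)\<inverse>"
      using assms(2,3) insertions_context by blast
    with step.IH show ?case by (rule rtrancl_into_rtrancl)
  qed simp
  then show ?thesis
    using assms by (auto simp: word_equiv_def)
qed

lemma word_equiv_append:
  assumes "(u, u') \<in> word_equiv S R" "(v, v') \<in> word_equiv S R"
  shows "(u @ v, u' @ v') \<in> word_equiv S R"
proof -
  have "(u @ v, u' @ v) \<in> word_equiv S R" "(u' @ v, u' @ v') \<in> word_equiv S R"
    using word_equiv_context[OF assms(1), of "[]" v] word_equiv_context[OF assms(2), of u' "[]"]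
      word_equivD[OF assms(1)] word_equivD[OF assms(2)] by auto
  then show ?thesis
    using equiv_word_equiv by (meson equivE transE)
qed

lemma presented_mult:
  assumes "u \<in> words S" "v \<in> words S"
  shows "word_equiv S R `` {u} \<otimes>\<^bsub>presented_group S R\<^esub> word_equiv S R `` {v}
         = word_equiv S R `` {u @ v}"
proof -
  have "congruent2 (word_equiv S R) (word_equiv S R) (\<lambda>u v. word_equiv S R `` {u @ v})"
    by (intro congruent2I' equiv_class_eq[OF equiv_word_equiv] word_equiv_append)
  from UN_equiv_class2[OF equiv_word_equiv equiv_word_equiv this assms]
  show ?thesis by (simp add: presented_group_def)
qed

lemma presented_carrierE:
  assumes "x \<in> carrier (presented_group S R)"
  obtains u where "u \<in> words S" "x = word_equiv S R `` {u}"
  using assms by (auto simp: presented_group_def elim: quotientE)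

lemma presented_carrierI:
  "u \<in> words S \<Longrightarrow> word_equiv S R `` {u} \<in> carrier (presented_group S R)"
  by (auto simp: presented_group_def intro: quotientI)

definition inverse_word :: "'l word \<Rightarrow> 'l word" where
  "inverse_word u = rev (map (\<lambda>(s, b). (s, \<not> b)) u)"

lemma inverse_word_words [simp]: "u \<in> words S \<Longrightarrow> inverse_word u \<in> words S"
  by (induction u) (auto simp: inverse_word_def)

lemma inverse_word_left: "u \<in> words S \<Longrightarrow> (inverse_word u @ u, []) \<in> word_equiv S R"
proof (induction u)
  case Nil
  then show ?case
    by (simp add: inverse_word_def word_equiv_def)
next
  case (Cons x u)
  obtain s b where x: "x = (s, b)" by (cases x)
  have u: "s \<in> S" "u \<in> words S" using Cons.prems x by auto
  have iw: "inverse_word (x # u) @ x # u = inverse_word u @ [(s, \<not> b), (s, b)] @ u"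
    by (simp add: inverse_word_def x)
  have "(inverse_word u @ u, inverse_word u @ [(s, \<not> b), (s, \<not> \<not> b)] @ u) \<in> insertions S R"
    unfolding insertions_def using u
    by (intro CollectI exI[of _ "inverse_word u"] exI[of _ u] exI[of _ "[(s, \<not> b), (s, \<not> \<not> b)]"])
      auto
  then have "(inverse_word u @ [(s, \<not> b), (s, b)] @ u, inverse_word u @ u) \<in> word_equiv S R"
    using u by (auto simp: word_equiv_def)
  then show ?case
    using Cons.IH[OF u(2)] equiv_word_equiv[of S R] unfolding iw by (meson equivE transE)
qed

lemma group_presented_group: "group (presented_group S R)"
proof (rule groupI)
  show "\<one>\<^bsub>presented_group S R\<^esub> \<in> carrier (presented_group S R)"
    by (simp add: presented_group_def quotientI)
next
  fix x assume "x \<in> carrier (presented_group S R)"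
  then obtain u where u: "u \<in> words S" "x = word_equiv S R `` {u}" by (rule presented_carrierE)
  have 1: "\<one>\<^bsub>presented_group S R\<^esub> = word_equiv S R `` {[]}" by (simp add: presented_group_def)
  show "\<one>\<^bsub>presented_group S R\<^esub> \<otimes>\<^bsub>presented_group S R\<^esub> x = x"
    unfolding 1 u(2) using u(1) by (simp add: presented_mult)
  show "\<exists>y\<in>carrier (presented_group S R). y \<otimes>\<^bsub>presented_group S R\<^esub> x = \<one>\<^bsub>presented_group S R\<^esub>"
  proof (rule bexI)
    show "word_equiv S R `` {inverse_word u} \<otimes>\<^bsub>presented_group S R\<^esub> x
        = \<one>\<^bsub>presented_group S R\<^esub>"
      unfolding 1 u(2) using u(1)
      by (simp add: presented_mult equiv_class_eq[OF equiv_word_equiv inverse_word_left])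
    show "word_equiv S R `` {inverse_word u} \<in> carrier (presented_group S R)"
      using u(1) by (simp add: presented_carrierI)
  qed
qed (auto elim!: presented_carrierE simp: presented_mult intro!: presented_carrierI)

lemma generator_closed: "s \<in> S \<Longrightarrow> generator S R s \<in> carrier (presented_group S R)"
  by (auto simp: generator_def intro!: presented_carrierI)

lemma generator_left_inverse:
  assumes "s \<in> S"
  shows "word_equiv S R `` {[(s, False)]} \<otimes>\<^bsub>presented_group S R\<^esub> generator S R s
         = \<one>\<^bsub>presented_group S R\<^esub>"
proof -
  have "([(s, False), (s, True)], []) \<in> word_equiv S R"
    using assms inverse_word_left[of "[(s, True)]" S R] by (simp add: inverse_word_def)
  then have "word_equiv S R `` {[(s, False), (s, True)]} = word_equiv S R `` {[]}"
    by (rule equiv_class_eq[OF equiv_word_equiv])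
  moreover have "\<one>\<^bsub>presented_group S R\<^esub> = word_equiv S R `` {[]}"
    by (simp add: presented_group_def)
  ultimately show ?thesis
    using assms by (simp add: generator_def presented_mult)
qed

definition eval_word :: "('k, 'm) monoid_scheme \<Rightarrow> ('l \<Rightarrow> 'k) \<Rightarrow> 'l word \<Rightarrow> 'k" where
  "eval_word K f u =
     foldr (\<lambda>(s, b) x. (if b then f s else inv\<^bsub>K\<^esub> f s) \<otimes>\<^bsub>K\<^esub> x) u \<one>\<^bsub>K\<^esub>"

context
  fixes K (structure) and f S
  assumes K: "group K" and f: "\<And>s. s \<in> S \<Longrightarrow> f s \<in> carrier K"
begin

interpretation group K by (rule K)

lemma eval_word_closed: "u \<in> words S \<Longrightarrow> eval_word K f u \<in> carrier K"
  by (induction u) (auto simp: eval_word_def f)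

lemma eval_word_append:
  "u \<in> words S \<Longrightarrow> v \<in> words S \<Longrightarrow> eval_word K f (u @ v) = eval_word K f u \<otimes> eval_word K f v"
proof (induction u)
  case Nil
  then show ?case using eval_word_closed by (simp add: eval_word_def)
next
  case (Cons x u)
  have "eval_word K f u \<in> carrier K" "eval_word K f v \<in> carrier K"
    using Cons.prems eval_word_closed by auto
  then show ?case
    using Cons f by (cases x) (auto simp: eval_word_def m_assoc)
qed

lemma eval_word_equiv:
  assumes R: "\<And>r. r \<in> R \<Longrightarrow> r \<in> words S \<and> eval_word K f r = \<one>"
    and uv: "(u, v) \<in> word_equiv S R"
  shows "eval_word K f u = eval_word K f v"
proof -
  have ins: "eval_word K f u = eval_word K f v" if ins: "(u, v) \<in> insertions S R" for u v
  proof -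
    obtain p q r where pqr: "u = p @ q" "v = p @ r @ q" "p \<in> words S" "q \<in> words S"
      "r \<in> R \<union> {[(s, b), (s, \<not> b)] | s b. s \<in> S}"
      using ins by (rule insertionsE)
    have cancel: "eval_word K f [(s, b), (s, \<not> b)] = \<one>" if "s \<in> S" for s b
      using f[OF that] by (cases b) (simp_all add: eval_word_def)
    have "r \<in> words S \<and> eval_word K f r = \<one>"
      using pqr(5)
    proof
      assume "r \<in> {[(s, b), (s, \<not> b)] | s b. s \<in> S}"
      then obtain s b where "r = [(s, b), (s, \<not> b)]" "s \<in> S" by blast
      then show ?thesis using cancel by simp
    qed (rule R)
    then show ?thesis
      using pqr eval_word_closed by (simp add: eval_word_append)
  qed
  have "(u, v) \<in> (insertions S R \<union> (insertions S R)\<inverse>)\<^sup>*"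
    using uv by (simp add: word_equiv_def)
  then show ?thesis
    by (induction rule: rtrancl_induct) (use ins in auto)
qed

lemma presented_group_universal:
  assumes R: "\<And>r. r \<in> R \<Longrightarrow> r \<in> words S \<and> eval_word K f r = \<one>"
  shows "\<exists>h \<in> hom (presented_group S R) K. \<forall>s\<in>S. h (generator S R s) = f s"
proof -
  define h where "h = (\<lambda>x. eval_word K f (SOME u. u \<in> x))"
  have h: "h (word_equiv S R `` {u}) = eval_word K f u" if "u \<in> words S" for u
  proof -
    have "u \<in> word_equiv S R `` {u}"
      using that equiv_class_self[OF equiv_word_equiv] by blast
    then have "(SOME v. v \<in> word_equiv S R `` {u}) \<in> word_equiv S R `` {u}"
      by (rule someI)
    then show ?thesis
      unfolding h_def using eval_word_equiv[OF R] by force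
  qed
  have "h \<in> hom (presented_group S R) K"
    by (rule homI)
      (auto elim!: presented_carrierE simp: h presented_mult eval_word_append eval_word_closed)
  moreover have "h (generator S R s) = f s" if "s \<in> S" for s
    unfolding generator_def using that f by (subst h) (auto simp: eval_word_def)
  ultimately show ?thesis by blast
qed

lemma presented_group_hom_unique:
  assumes "h \<in> hom (presented_group S R) K" "h' \<in> hom (presented_group S R) K"
    and "\<And>s. s \<in> S \<Longrightarrow> h (generator S R s) = h' (generator S R s)"
    and x: "x \<in> carrier (presented_group S R)"
  shows "h x = h' x"
proof -
  let ?P = "presented_group S R"
  interpret P: group ?P by (rule group_presented_group)
  interpret h: group_hom ?P K h using assms(1) by unfold_locales
  interpret h': group_hom ?P K h' using assms(2) by unfold_locales
  have letter: "h (word_equiv S R `` {[(s, b)]}) = h' (word_equiv S R `` {[(s, b)]})"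
    if "s \<in> S" for s b
  proof (cases b)
    case False
    have "word_equiv S R `` {[(s, False)]} \<otimes>\<^bsub>?P\<^esub> generator S R s = \<one>\<^bsub>?P\<^esub>"
      using that by (rule generator_left_inverse)
    moreover have "generator S R s \<in> carrier ?P" "word_equiv S R `` {[(s, False)]} \<in> carrier ?P"
      using that by (auto simp: generator_def intro!: presented_carrierI)
    ultimately have "word_equiv S R `` {[(s, False)]} = inv\<^bsub>?P\<^esub> generator S R s"
      "generator S R s \<in> carrier ?P"
      by (auto simp: P.inv_equality)
    then show ?thesis using assms(3)[OF that] False by simp
  qed (use assms(3)[OF that] in \<open>simp add: generator_def\<close>)
  have "h (word_equiv S R `` {u}) = h' (word_equiv S R `` {u})" if "u \<in> words S" for u
    using that
  proof (induction u)
    case Nil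
    have "word_equiv S R `` {[]} = \<one>\<^bsub>?P\<^esub>" by (simp add: presented_group_def)
    then show ?case by simp
  next
    case (Cons y u)
    obtain s b where y: "y = (s, b)" by (cases y)
    have su: "s \<in> S" "u \<in> words S" using Cons.prems y by auto
    have "word_equiv S R `` {y # u}
        = word_equiv S R `` {[(s, b)]} \<otimes>\<^bsub>?P\<^esub> word_equiv S R `` {u}"
      using su by (subst presented_mult) (auto simp: y)
    moreover have "word_equiv S R `` {[(s, b)]} \<in> carrier ?P" "word_equiv S R `` {u} \<in> carrier ?P"
      using su by (auto intro!: presented_carrierI)
    ultimately show ?case using letter[OF su(1)] Cons.IH[OF su(2)] by simp
  qed
  then show ?thesis using x by (auto elim!: presented_carrierE)
qed

end


subsection \<open>Universal property of the direct limit\<close>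

lemma relator_trivial:
  assumes "r \<in> R" "r \<in> words S"
  shows "word_equiv S R `` {r} = \<one>\<^bsub>presented_group S R\<^esub>"
proof -
  have "([], r) \<in> insertions S R"
    unfolding insertions_def using assms
    by (intro CollectI exI[of _ "[]"] exI[of _ r]) auto
  then have "(r, []) \<in> word_equiv S R"
    using assms by (auto simp: word_equiv_def)
  then show ?thesis
    by (simp add: presented_group_def equiv_class_eq[OF equiv_word_equiv])
qed

lemma generator_eqI:
  assumes r: "u @ [(s, False)] \<in> R" and u: "u \<in> words S" and s: "s \<in> S"
  shows "word_equiv S R `` {u} = generator S R s"
proof -
  let ?P = "presented_group S R"
  interpret P: group ?P by (rule group_presented_group)
  have cl: "word_equiv S R `` {u} \<in> carrier ?P" "generator S R s \<in> carrier ?P"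
    "word_equiv S R `` {[(s, False)]} \<in> carrier ?P"
    using u s by (auto simp: generator_closed intro!: presented_carrierI)
  have 1: "word_equiv S R `` {u} \<otimes>\<^bsub>?P\<^esub> word_equiv S R `` {[(s, False)]} = \<one>\<^bsub>?P\<^esub>"
    using relator_trivial[OF r] u s by (simp add: presented_mult)
  have "word_equiv S R `` {[(s, False)]} \<otimes>\<^bsub>?P\<^esub> generator S R s = \<one>\<^bsub>?P\<^esub>"
    using s by (rule generator_left_inverse)
  then have "inv\<^bsub>?P\<^esub> (word_equiv S R `` {[(s, False)]}) = generator S R s"
    using cl P.inv_equality P.inv_inv by metis
  with 1 cl show ?thesis by (metis P.inv_equality)
qed

lemma colimit_relators_words:
  assumes "embedding_diagram I G J F A \<phi>" "r \<in> colimit_relators I G J F A \<phi>"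
  shows "r \<in> words (colimit_generators I G J F)"
proof -
  have 1: "\<And>i a b. i \<in> I \<Longrightarrow> a \<in> carrier (G i) \<Longrightarrow> b \<in> carrier (G i)
      \<Longrightarrow> a \<otimes>\<^bsub>G i\<^esub> b \<in> carrier (G i)"
    and 2: "\<And>i a b. i \<in> J \<Longrightarrow> a \<in> carrier (F i) \<Longrightarrow> b \<in> carrier (F i)
      \<Longrightarrow> a \<otimes>\<^bsub>F i\<^esub> b \<in> carrier (F i)"
    using assms(1) unfolding embedding_diagram_def
    by (meson group.is_monoid monoid.m_closed)+
  have 3: "\<And>j i b. (j, i) \<in> A \<Longrightarrow> b \<in> carrier (F j) \<Longrightarrow>
      j \<in> J \<and> i \<in> I \<and> \<phi> j i b \<in> carrier (G i)"
    using assms(1) unfolding embedding_diagram_def mon_def hom_def by fastforce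
  show ?thesis
    using assms(2) unfolding colimit_relators_def colimit_generators_def
    by (auto simp: 1 2 3)
qed

lemma colimit_group_cocone:
  assumes "embedding_diagram I G J F A \<phi>"
  shows "i \<in> I \<Longrightarrow> colimit_inl I G J F A \<phi> i \<in> hom (G i) (colimit_group I G J F A \<phi>)"
    and "j \<in> J \<Longrightarrow> colimit_inr I G J F A \<phi> j \<in> hom (F j) (colimit_group I G J F A \<phi>)"
    and "(j, i) \<in> A \<Longrightarrow> b \<in> carrier (F j) \<Longrightarrow>
      colimit_inl I G J F A \<phi> i (\<phi> j i b) = colimit_inr I G J F A \<phi> j b"
proof -
  let ?S = "colimit_generators I G J F" and ?R = "colimit_relators I G J F A \<phi>"
  note w = colimit_relators_words[OF assms]
  have mult: "generator ?S ?R s \<otimes>\<^bsub>presented_group ?S ?R\<^esub> generator ?S ?R t = generator ?S ?R st"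
    if "[(s, True), (t, True), (st, False)] \<in> ?R" for s t st
  proof -
    have "s \<in> ?S" "t \<in> ?S" "st \<in> ?S" using w[OF that] by auto
    then show ?thesis
      using generator_eqI[of "[(s, True), (t, True)]" st ?R ?S] that
      by (simp add: generator_def presented_mult)
  qed
  show "i \<in> I \<Longrightarrow> colimit_inl I G J F A \<phi> i \<in> hom (G i) (colimit_group I G J F A \<phi>)"
    unfolding colimit_inl_def colimit_group_def
    by (intro homI generator_closed mult[symmetric])
      (auto simp: colimit_generators_def colimit_relators_def)
  show "j \<in> J \<Longrightarrow> colimit_inr I G J F A \<phi> j \<in> hom (F j) (colimit_group I G J F A \<phi>)"
    unfolding colimit_inr_def colimit_group_def
    by (intro homI generator_closed mult[symmetric])
      (auto simp: colimit_generators_def colimit_relators_def)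
  show "colimit_inl I G J F A \<phi> i (\<phi> j i b) = colimit_inr I G J F A \<phi> j b"
    if "(j, i) \<in> A" "b \<in> carrier (F j)"
  proof -
    have r: "[(Inr (j, b), True)] @ [(Inl (i, \<phi> j i b), False)] \<in> ?R"
      using that unfolding colimit_relators_def by auto
    from w[OF this] have "Inr (j, b) \<in> ?S" "Inl (i, \<phi> j i b) \<in> ?S" by auto
    then have "word_equiv ?S ?R `` {[(Inr (j, b), True)]} = generator ?S ?R (Inl (i, \<phi> j i b))"
      by (intro generator_eqI[OF r]) auto
    then show ?thesis
      unfolding colimit_inl_def colimit_inr_def by (simp add: generator_def)
  qed
qed

theorem colimit_group_universal:
  fixes K :: "'k monoid"
  assumes D: "embedding_diagram I G J F A \<phi>" and K: "group K"
    and f: "\<And>i. i \<in> I \<Longrightarrow> f i \<in> hom (G i) K" and g: "\<And>j. j \<in> J \<Longrightarrow> g j \<in> hom (F j) K"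
    and fg: "\<And>j i b. (j, i) \<in> A \<Longrightarrow> b \<in> carrier (F j) \<Longrightarrow> f i (\<phi> j i b) = g j b"
  shows "\<exists>h \<in> hom (colimit_group I G J F A \<phi>) K.
      (\<forall>i\<in>I. \<forall>a\<in>carrier (G i). h (colimit_inl I G J F A \<phi> i a) = f i a) \<and>
      (\<forall>j\<in>J. \<forall>b\<in>carrier (F j). h (colimit_inr I G J F A \<phi> j b) = g j b)"
    and "\<lbrakk>h \<in> hom (colimit_group I G J F A \<phi>) K; h' \<in> hom (colimit_group I G J F A \<phi>) K;
       \<And>i a. i \<in> I \<Longrightarrow> a \<in> carrier (G i) \<Longrightarrow>
         h (colimit_inl I G J F A \<phi> i a) = h' (colimit_inl I G J F A \<phi> i a);
       \<And>j b. j \<in> J \<Longrightarrow> b \<in> carrier (F j) \<Longrightarrow>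
         h (colimit_inr I G J F A \<phi> j b) = h' (colimit_inr I G J F A \<phi> j b);
       x \<in> carrier (colimit_group I G J F A \<phi>)\<rbrakk> \<Longrightarrow> h x = h' x"
proof -
  let ?S = "colimit_generators I G J F" and ?R = "colimit_relators I G J F A \<phi>"
  interpret K: group K by (rule K)
  define k where "k = case_sum (\<lambda>(i, a). f i a) (\<lambda>(j, b). g j b)"
  have fc: "f i a \<in> carrier K" if "i \<in> I" "a \<in> carrier (G i)" for i a
    using f[OF that(1)] that(2) by (auto simp: hom_def)
  have gc: "g j a \<in> carrier K" if "j \<in> J" "a \<in> carrier (F j)" for j a
    using g[OF that(1)] that(2) by (auto simp: hom_def)
  have k: "k s \<in> carrier K" if "s \<in> ?S" for s
    using that unfolding k_def colimit_generators_def by (auto simp: fc gc)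
  have R: "eval_word K k r = \<one>\<^bsub>K\<^esub>" if "r \<in> ?R" for r
  proof -
    have A: "j \<in> J" if "(j, i) \<in> A" for j i
      using D that unfolding embedding_diagram_def by auto
    have mm: "y \<otimes>\<^bsub>K\<^esub> (z \<otimes>\<^bsub>K\<^esub> inv\<^bsub>K\<^esub> (y \<otimes>\<^bsub>K\<^esub> z)) = \<one>\<^bsub>K\<^esub>"
      if "y \<in> carrier K" "z \<in> carrier K" for y z
      using that by (simp flip: K.m_assoc)
    show ?thesis
      using that unfolding colimit_relators_def
      by (auto simp: eval_word_def k_def fc gc hom_mult[OF f] hom_mult[OF g] mm fg A)
  qed
  have "\<exists>h\<in>hom (presented_group ?S ?R) K. \<forall>s\<in>?S. h (generator ?S ?R s) = k s"
    by (rule presented_group_universal[OF K]) (simp_all add: k R colimit_relators_words[OF D])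
  then obtain h where h: "h \<in> hom (presented_group ?S ?R) K"
      "\<forall>s\<in>?S. h (generator ?S ?R s) = k s"
    by blast
  have "h (generator ?S ?R (Inl (i, a))) = f i a" if "i \<in> I" "a \<in> carrier (G i)" for i a
    using h(2)[rule_format, of "Inl (i, a)"] that by (simp add: colimit_generators_def k_def InlI)
  moreover
  have "h (generator ?S ?R (Inr (j, b))) = g j b" if "j \<in> J" "b \<in> carrier (F j)" for j b
    using h(2)[rule_format, of "Inr (j, b)"] that by (simp add: colimit_generators_def k_def InrI)
  ultimately show "\<exists>h \<in> hom (colimit_group I G J F A \<phi>) K.
      (\<forall>i\<in>I. \<forall>a\<in>carrier (G i). h (colimit_inl I G J F A \<phi> i a) = f i a) \<and>
      (\<forall>j\<in>J. \<forall>b\<in>carrier (F j). h (colimit_inr I G J F A \<phi> j b) = g j b)"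
    unfolding colimit_group_def colimit_inl_def colimit_inr_def
    using h(1) by blast
  show "h x = h' x"
    if hh': "h \<in> hom (colimit_group I G J F A \<phi>) K" "h' \<in> hom (colimit_group I G J F A \<phi>) K"
       "\<And>i a. i \<in> I \<Longrightarrow> a \<in> carrier (G i) \<Longrightarrow>
         h (colimit_inl I G J F A \<phi> i a) = h' (colimit_inl I G J F A \<phi> i a)"
       "\<And>j b. j \<in> J \<Longrightarrow> b \<in> carrier (F j) \<Longrightarrow>
         h (colimit_inr I G J F A \<phi> j b) = h' (colimit_inr I G J F A \<phi> j b)"
       "x \<in> carrier (colimit_group I G J F A \<phi>)" for h h'
  proof (rule presented_group_hom_unique[OF K, where f = k and S = ?S and R = ?R])
    show "h (generator ?S ?R s) = h' (generator ?S ?R s)" if "s \<in> ?S" for s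
      using that hh' unfolding colimit_inl_def colimit_inr_def
      by (auto simp: colimit_generators_def)
  qed (use hh' k in \<open>auto simp: colimit_group_def\<close>)
qed


section \<open>Polygonal complexes\<close>

definition quotient_topology :: "'a topology \<Rightarrow> ('a \<times> 'a) set \<Rightarrow> 'a set topology" where
  "quotient_topology X r = topology (\<lambda>U. U \<subseteq> topspace X // r \<and> openin X (topspace X \<inter> \<Union>U))"

text \<open>For \<open>n \<ge> 3\<close> the regular \<open>n\<close>-gon with its interior, inscribed in the unit circle; \<open>side n k\<close>
  parametrises its \<open>k\<close>-th side, \<open>k < n\<close>, counterclockwise.\<close>

definition ngon :: "nat \<Rightarrow> complex set" where
  "ngon n = convex hull ((\<lambda>k. cis (2 * pi * real k / real n)) ` {..<n})"

definition side :: "nat \<Rightarrow> nat \<Rightarrow> real \<Rightarrow> complex" where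
  "side n k = linepath (cis (2 * pi * real k / real n)) (cis (2 * pi * real (Suc k) / real n))"

text \<open>A family of polygons indexed by \<open>P\<close>; the sides of the polygon \<open>p\<close> are labelled,
  counterclockwise, by the letters of the word \<open>W p\<close>. A letter \<open>(l, False)\<close> means that the side
  labelled \<open>l\<close> is oriented clockwise.\<close>

definition labelled_edge :: "('p \<Rightarrow> 'l word) \<Rightarrow> 'p \<Rightarrow> nat \<Rightarrow> real \<Rightarrow> 'p \<times> complex" where
  "labelled_edge W p k t =
     (p, side (length (W p)) k (if snd (W p ! k) then t else 1 - t))"

definition polygons :: "'p set \<Rightarrow> ('p \<Rightarrow> 'l word) \<Rightarrow> ('p \<times> complex) topology" where
  "polygons P W = sum_topology (\<lambda>p. top_of_set (ngon (length (W p)))) P"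

definition edge_identifications ::
  "'p set \<Rightarrow> ('p \<Rightarrow> 'l word) \<Rightarrow> (('p \<times> complex) \<times> ('p \<times> complex)) set" where
  "edge_identifications P W =
     {(labelled_edge W p k t, labelled_edge W p' k' t) | p k p' k' t.
        p \<in> P \<and> p' \<in> P \<and> k < length (W p) \<and> k' < length (W p') \<and>
        fst (W p ! k) = fst (W p' ! k') \<and> t \<in> {0..1}}"

text \<open>\<open>edge_identifications P W\<close> is symmetric, so this is the equivalence relation it generates.\<close>

definition gluing ::
  "'p set \<Rightarrow> ('p \<Rightarrow> 'l word) \<Rightarrow> (('p \<times> complex) \<times> ('p \<times> complex)) set" where
  "gluing P W = {(x, y). x \<in> topspace (polygons P W) \<and> y \<in> topspace (polygons P W) \<and>
     (x, y) \<in> (edge_identifications P W)\<^sup>*}"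

definition polygonal_complex ::
  "'p set \<Rightarrow> ('p \<Rightarrow> 'l word) \<Rightarrow> ('p \<times> complex) set topology" where
  "polygonal_complex P W = quotient_topology (polygons P W) (gluing P W)"

lemma equiv_gluing: "equiv (topspace (polygons P W)) (gluing P W)"
proof (rule equivI)
  have "sym ((edge_identifications P W)\<^sup>*)"
    by (intro sym_rtrancl symI) (fastforce simp: edge_identifications_def)
  then show "sym (gluing P W)"
    by (auto simp: gluing_def sym_def)
qed (auto simp: gluing_def refl_on_def trans_def)

lemma openin_quotient_topology:
  assumes "equiv (topspace X) r"
  shows "openin (quotient_topology X r) U \<longleftrightarrow>
    U \<subseteq> topspace X // r \<and> openin X (topspace X \<inter> \<Union>U)"
proof -
  have disj: "A = B" if "A \<in> topspace X // r" "B \<in> topspace X // r" "x \<in> A" "x \<in> B" for A B x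
    using quotient_disj[OF assms that(1,2)] that(3,4) by blast
  have "istopology (\<lambda>U. U \<subseteq> topspace X // r \<and> openin X (topspace X \<inter> \<Union>U))"
    unfolding istopology_def
  proof (intro conjI allI impI; (elim conjE)?)
    fix S T
    assume S: "S \<subseteq> topspace X // r" "openin X (topspace X \<inter> \<Union>S)"
      and T: "T \<subseteq> topspace X // r" "openin X (topspace X \<inter> \<Union>T)"
    have "topspace X \<inter> \<Union>(S \<inter> T) = (topspace X \<inter> \<Union>S) \<inter> (topspace X \<inter> \<Union>T)"
      using S(1) T(1) disj by blast
    then show "openin X (topspace X \<inter> \<Union>(S \<inter> T))" using S T by auto
    show "S \<inter> T \<subseteq> topspace X // r" using S by blast
  next
    fix \<K> assume \<K>: "\<forall>K\<in>\<K>. K \<subseteq> topspace X // r \<and> openin X (topspace X \<inter> \<Union>K)"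
    have "topspace X \<inter> \<Union>(\<Union>\<K>) = (\<Union>K\<in>\<K>. topspace X \<inter> \<Union>K)" by blast
    moreover have "openin X (\<Union>K\<in>\<K>. topspace X \<inter> \<Union>K)" using \<K> by (intro openin_Union) blast
    ultimately show "openin X (topspace X \<inter> \<Union>(\<Union>\<K>))" by (simp only:)
    show "\<Union>\<K> \<subseteq> topspace X // r" using \<K> by blast
  qed
  then show ?thesis by (simp add: quotient_topology_def)
qed

lemma quotient_map_quotient_topology:
  assumes "equiv (topspace X) r"
  shows "quotient_map X (quotient_topology X r) (\<lambda>x. r `` {x})"
proof -
  have Un: "\<Union>(topspace X // r) = topspace X" by (rule Union_quotient[OF assms])
  have top: "topspace (quotient_topology X r) = topspace X // r"
  proof (rule antisym)
    have "openin (quotient_topology X r) (topspace X // r)"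
      by (simp add: openin_quotient_topology[OF assms] Un)
    then show "topspace X // r \<subseteq> topspace (quotient_topology X r)" by (rule openin_subset)
    show "topspace (quotient_topology X r) \<subseteq> topspace X // r"
      using openin_quotient_topology[OF assms] openin_topspace by blast
  qed
  have "{x \<in> topspace X. r `` {x} \<in> U} = topspace X \<inter> \<Union>U" if U: "U \<subseteq> topspace X // r" for U
  proof (intro equalityI subsetI)
    fix x assume "x \<in> {x \<in> topspace X. r `` {x} \<in> U}"
    then show "x \<in> topspace X \<inter> \<Union>U" using equiv_class_self[OF assms] by blast
  next
    fix x assume x: "x \<in> topspace X \<inter> \<Union>U"
    then obtain C where C: "C \<in> U" "x \<in> C" by blast
    then obtain y where "C = r `` {y}" using U by (meson quotientE subsetD)
    then have "r `` {x} = C" using C equiv_class_eq[OF assms] by blast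
    then show "x \<in> {x \<in> topspace X. r `` {x} \<in> U}" using x C by simp
  qed
  then show ?thesis
    by (auto simp: quotient_map_def top openin_quotient_topology[OF assms] quotient_def)
qed


section \<open>Surface groups\<close>

text \<open>The closed orientable surface of genus \<open>g \<ge> 1\<close> as the \<open>4g\<close>-gon with sides identified
  according to the word \<open>\<Prod> a\<^sub>k b\<^sub>k a\<^sub>k\<^sup>-\<^sup>1 b\<^sub>k\<^sup>-\<^sup>1\<close>, where \<open>a\<^sub>k\<close> is \<open>Inl k\<close> and
  \<open>b\<^sub>k\<close> is \<open>Inr k\<close>. (For \<open>g = 0\<close> the word is empty and this does not give the sphere.)\<close>

definition surface_word :: "nat \<Rightarrow> (nat + nat) word" where
  "surface_word g =
     concat (map (\<lambda>k. [(Inl k, True), (Inr k, True), (Inl k, False), (Inr k, False)]) [1..<Suc g])"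

definition closed_surface :: "nat \<Rightarrow> (unit \<times> complex) set topology" where
  "closed_surface g = polygonal_complex {()} (\<lambda>_. surface_word g)"

text \<open>The base point is the image of the vertices of the polygon, one of which is \<open>1\<close>.\<close>

definition surface_group :: "nat \<Rightarrow> (real \<Rightarrow> (unit \<times> complex) set) set monoid" where
  "surface_group g = fundamental_group (closed_surface g)
     (gluing {()} (\<lambda>_. surface_word g) `` {((), 1)})"


section \<open>The complex of a bipartite graph\<close>

text \<open>A bipartite graph is given by its set \<open>L\<close> of edges, \<open>(i, j) \<in> L\<close> standing for
  \<open>(x\<^sub>i, y\<^sub>j)\<close>. The constructor terms \<open>Edge_x i k\<close> and \<open>Edge_y j k\<close> are the labels
  \<open>x\<^sub>i\<^sup>k\<close> and \<open>y\<^sub>j\<^sup>k\<close>.\<close>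

datatype edge_label = Edge_x nat nat | Edge_y nat nat

definition complete_bipartite :: "nat \<Rightarrow> nat \<Rightarrow> (nat \<times> nat) set" where
  "complete_bipartite q1 q2 = {1..q1} \<times> {1..q2}"

definition edge_word :: "nat \<Rightarrow> nat \<times> nat \<Rightarrow> edge_label word" where
  "edge_word m = (\<lambda>(i, j).
     concat (map (\<lambda>k. [(Edge_x i k, True), (Edge_y j k, True)]) [1..<Suc m]))"

text \<open>The complex \<open>X\<^sub>2\<^sub>m\<^sub>,\<^sub>L\<close>; note that the argument is \<open>m\<close>, not \<open>2m\<close>.\<close>

definition bipartite_complex ::
  "nat \<Rightarrow> (nat \<times> nat) set \<Rightarrow> ((nat \<times> nat) \<times> complex) set topology" where
  "bipartite_complex m L = polygonal_complex L (edge_word m)"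

end

theory Submission
  imports Defs
begin

text \<open>The fundamental group of a polygonal complex is presented by its edges, with the words of the
  polygons as relators; here the role of a spanning tree is played by one polygon \<open>p0\<close> that
  contains all vertices. An assignment of elements of a group \<open>K\<close> to the
  edges that satisfies the relators defines a flat \<open>K\<close>-bundle over the complex, and its holonomy
  is a homomorphism to \<open>K\<close>. With the presented group for \<open>K\<close>, composing the holonomy with the
  map that realises letters by loops is a conjugation in either order: following a path through
  the stars of its points, each of which contracts radially to its centre, the holonomy and the
  homotopy class change by the same straight segment of a polygon.

  For the complex of \<open>K\<^bsub>q1,q2\<^esub>\<close> let \<open>p0\<close> be the polygon \<open>P\<^sub>1\<^sub>1\<close>. Then the letters with index \<open>1\<close> become
  trivial, the polygons \<open>P\<^sub>i\<^sub>1\<close> and \<open>P\<^sub>1\<^sub>j\<close> express the letters with superscript \<open>m\<close> by the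
  others, which leaves free groups of rank \<open>m - 1\<close>, and every \<open>P\<^sub>i\<^sub>j\<close> with \<open>i, j \<ge> 2\<close> imposes on two
  of these the relator \<open>x\<^sub>1y\<^sub>1 \<dots> x\<^sub>ny\<^sub>n (y\<^sub>1 \<dots> y\<^sub>n x\<^sub>1 \<dots> x\<^sub>n)\<^sup>-\<^sup>1\<close>, \<open>n = m - 1\<close>. A change of basis turns
  this relator into the product of \<open>n\<close> commutators. Killing one of the two families of letters
  retracts the surface group onto the free group of the other family, which is therefore
  embedded.\<close>

section \<open>Paths up to homotopy\<close>

text \<open>Geometrically, for \<open>i, j \<ge> 2\<close> the polygons
  \<open>P\<^sub>1\<^sub>1\<close>, \<open>P\<^sub>i\<^sub>1\<close>,
  \<open>P\<^sub>1\<^sub>j\<close>, \<open>P\<^sub>i\<^sub>j\<close> form a closed surface with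
  \<open>2m\<close> vertices, \<open>4m\<close> edges and 4 faces, hence of genus
  \<open>m - 1\<close>. Two such surfaces with the same \<open>i\<close> meet in
  \<open>P\<^sub>1\<^sub>1\<close> and \<open>P\<^sub>i\<^sub>1\<close>, two discs sharing
  \<open>m\<close> sides, of Euler characteristic \<open>2m - 3m + 2 = 2 - m\<close>; this is where
  free groups of rank \<open>m - 1\<close> come from. It explains the shape of the diagram: one free
  group for each vertex of index at least 2, and two arrows into every surface group. The proof
  compares presentations and does not glue these pieces. The obstacle is that a loop in a quotient
  space has no combinatorial form, so relations among loops are hard to bound by cutting up
  homotopies. Local systems replace this by local constancy arguments on intervals and squares.
  Stars are manageable because all polygons are regular with the same number of sides: gluings are
  isometric and affine along sides, so balls and radial contractions in different polygons fit
  together. The base point need not be a vertex, whence conjugations in place of identities.\<close>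

definition path_homotopic :: "'a topology \<Rightarrow> (real \<Rightarrow> 'a) \<Rightarrow> (real \<Rightarrow> 'a) \<Rightarrow> bool" where
  "path_homotopic X p q \<longleftrightarrow>
     homotopic_with (\<lambda>r. r 0 = p 0 \<and> r 1 = p 1) (top_of_set {0..1}) X p q"

definition reverse_path :: "(real \<Rightarrow> 'a) \<Rightarrow> real \<Rightarrow> 'a" where
  "reverse_path p = (\<lambda>t. p (1 - t))"

lemma path_homotopic_ends:
  assumes "path_homotopic X p q"
  shows "q 0 = p 0" "q 1 = p 1" "pathin X p" "pathin X q"
  using homotopic_with_imp_property[OF assms[unfolded path_homotopic_def]]
    homotopic_with_imp_continuous_maps[OF assms[unfolded path_homotopic_def]]
  by (auto simp: pathin_def)

lemma path_homotopic_refl: "pathin X p \<Longrightarrow> path_homotopic X p p"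
  by (simp add: path_homotopic_def pathin_def)

lemma path_homotopic_sym: "path_homotopic X p q \<Longrightarrow> path_homotopic X q p"
  using path_homotopic_ends[of X p q] by (simp add: path_homotopic_def homotopic_with_sym)

lemma path_homotopic_trans [trans]:
  "path_homotopic X p q \<Longrightarrow> path_homotopic X q r \<Longrightarrow> path_homotopic X p r"
  using path_homotopic_ends[of X p q]
  by (simp add: path_homotopic_def) (metis (mono_tags) homotopic_with_trans)

text \<open>Paths are functions on all of \<real> whose values outside the unit interval carry no
  meaning; this lemma absorbs such differences.\<close>

lemma path_homotopic_eq:
  assumes "pathin X p" "\<And>t. t \<in> {0..1} \<Longrightarrow> q t = p t"
  shows "path_homotopic X p q"
  unfolding path_homotopic_def
  by (rule homotopic_with_equal) (use assms in \<open>auto simp: pathin_def\<close>)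

text \<open>In a convex set any two paths with the same end points are homotopic; applied to maps from
  intervals, polygons and squares, this yields all homotopies between explicitly given paths.\<close>

lemma path_homotopic_convex:
  fixes C :: "'c::real_normed_vector set"
  assumes C: "convex C" and c: "continuous_map (top_of_set C) X c"
    and u: "continuous_on {0..1} u" "u \<in> {0..1} \<rightarrow> C"
    and v: "continuous_on {0..1} v" "v \<in> {0..1} \<rightarrow> C"
    and ends: "u 0 = v 0" "u 1 = v 1"
    and p: "\<And>t. t \<in> {0..1} \<Longrightarrow> p t = c (u t)" and q: "\<And>t. t \<in> {0..1} \<Longrightarrow> q t = c (v t)"
  shows "path_homotopic X p q"
proof -
  have cu: "pathin X (c \<circ> u)" and cv: "pathin X (c \<circ> v)"
    unfolding pathin_def using u v
    by (auto intro!: continuous_map_compose[OF _ c] simp: Pi_iff)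
  have 1: "homotopic_with_canon (\<lambda>r. r 0 = u 0 \<and> r 1 = u 1) {0..1} C u v"
    unfolding homotopic_with_def
  proof (intro exI conjI allI ballI)
    let ?h = "\<lambda>(t, s). (1 - t) *\<^sub>R u s + t *\<^sub>R v s"
    have "continuous_on ({0..1} \<times> {0..1}) (\<lambda>z. u (snd z))"
      "continuous_on ({0..1} \<times> {0..1}) (\<lambda>z. v (snd z))"
      by (auto intro!: continuous_on_compose2[OF u(1)] continuous_on_compose2[OF v(1)]
          continuous_intros)
    then have "continuous_on ({0..1} \<times> {0..1}) ?h"
      by (auto simp: case_prod_beta intro!: continuous_intros)
    moreover have "?h \<in> {0..1} \<times> {0..1} \<rightarrow> C"
      using u(2) v(2) convexD_alt[OF C] by (fastforce simp: Pi_iff)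
    ultimately show "continuous_map (prod_topology (top_of_set {0..1}) (top_of_set {0..1}))
        (top_of_set C) ?h"
      by simp
  qed (auto simp: algebra_simps ends)
  have "homotopic_with (\<lambda>r. r 0 = c (u 0) \<and> r 1 = c (u 1)) (top_of_set {0..1}) X (c \<circ> u) (c \<circ> v)"
    by (rule homotopic_with_compose_continuous_map_left[OF 1 c]) auto
  then have "path_homotopic X (c \<circ> u) (c \<circ> v)"
    by (simp add: path_homotopic_def)
  moreover have "path_homotopic X p (c \<circ> u)"
    by (rule path_homotopic_sym[OF path_homotopic_eq[OF cu]]) (simp add: p)
  moreover have "path_homotopic X (c \<circ> v) q"
    by (rule path_homotopic_eq[OF cv]) (simp add: q)
  ultimately show ?thesis by (meson path_homotopic_trans)
qed

lemma path_homotopic_concat: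
  assumes p: "path_homotopic X p p'" and q: "path_homotopic X q q'" and pq: "p 1 = q 0"
  shows "path_homotopic X (loop_concat p q) (loop_concat p' q')"
proof -
  let ?I = "top_of_set {0..1::real}"
  obtain h where h: "continuous_map (prod_topology ?I ?I) X h"
      "\<And>x. h (0, x) = p x" "\<And>x. h (1, x) = p' x"
      "\<And>t. t \<in> {0..1} \<Longrightarrow> h (t, 0) = p 0 \<and> h (t, 1) = p 1"
    using p unfolding path_homotopic_def homotopic_with_def by blast
  obtain k where k: "continuous_map (prod_topology ?I ?I) X k"
      "\<And>x. k (0, x) = q x" "\<And>x. k (1, x) = q' x"
      "\<And>t. t \<in> {0..1} \<Longrightarrow> k (t, 0) = q 0 \<and> k (t, 1) = q 1"
    using q unfolding path_homotopic_def homotopic_with_def by blast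
  \<comment> \<open>The homotopies run side by side in the second coordinate. They agree on the seam
    because both keep their end points fixed.\<close>
  define H where "H = (\<lambda>z. if snd z \<le> 1/2 then h (fst z, 2 * snd z) else k (fst z, 2 * snd z - 1))"
  have "continuous_map (top_of_set ({0..1} \<times> {0..1::real})) X H"
    unfolding H_def
  proof (rule continuous_map_cases_le)
    show "continuous_map (subtopology (top_of_set ({0..1} \<times> {0..1}))
       {x \<in> topspace (top_of_set ({0..1} \<times> {0..1})). snd x \<le> (1/2::real)}) X
       (\<lambda>x. h (fst x, 2 * snd x))"
    proof -
      have "continuous_map (top_of_set ({0..1} \<times> {0..1})) X h" using h(1) by simp
      moreover have "continuous_map (subtopology (top_of_set ({0..1} \<times> {0..1}))
          {x \<in> topspace (top_of_set ({0..1} \<times> {0..1})). snd x \<le> (1/2::real)})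
          (top_of_set ({0..1} \<times> {0..1})) (\<lambda>x. (fst x, 2 * snd x))"
        by (auto simp: subtopology_subtopology intro!: continuous_intros)
      ultimately have "continuous_map (subtopology (top_of_set ({0..1} \<times> {0..1}))
          {x \<in> topspace (top_of_set ({0..1} \<times> {0..1})). snd x \<le> (1/2::real)}) X (h \<circ> (\<lambda>x. (fst x, 2 * snd x)))"
        by (rule continuous_map_compose[rotated])
      then show ?thesis by (simp only: o_def)
    qed
    show "continuous_map (subtopology (top_of_set ({0..1} \<times> {0..1}))
       {x \<in> topspace (top_of_set ({0..1} \<times> {0..1})). (1/2::real) \<le> snd x}) X
       (\<lambda>x. k (fst x, 2 * snd x - 1))"
    proof -
      have "continuous_map (top_of_set ({0..1} \<times> {0..1})) X k" using k(1) by simp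
      moreover have "continuous_map (subtopology (top_of_set ({0..1} \<times> {0..1}))
          {x \<in> topspace (top_of_set ({0..1} \<times> {0..1})). (1/2::real) \<le> snd x})
          (top_of_set ({0..1} \<times> {0..1})) (\<lambda>x. (fst x, 2 * snd x - 1))"
        by (auto simp: subtopology_subtopology intro!: continuous_intros)
      ultimately have "continuous_map (subtopology (top_of_set ({0..1} \<times> {0..1}))
          {x \<in> topspace (top_of_set ({0..1} \<times> {0..1})). (1/2::real) \<le> snd x}) X (k \<circ> (\<lambda>x. (fst x, 2 * snd x - 1)))"
        by (rule continuous_map_compose[rotated])
      then show ?thesis by (simp only: o_def)
    qed
    fix z :: "real \<times> real" assume z: "z \<in> topspace (top_of_set ({0..1} \<times> {0..1}))" "snd z = 1/2"
    then have "fst z \<in> {0..1}" by (auto simp: mem_Times_iff)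
    moreover have "2 * snd z = 1" "2 * snd z - 1 = 0" using z by auto
    ultimately show "h (fst z, 2 * snd z) = k (fst z, 2 * snd z - 1)"
      using h(4)[of "fst z"] k(4)[of "fst z"] pq by (simp only:)
  qed (auto intro: continuous_on_snd)
  then show ?thesis
    unfolding path_homotopic_def homotopic_with_def loop_concat_def
    by (intro exI[of _ H]) (auto simp: H_def h k)
qed

lemma pathin_concat: "pathin X p \<Longrightarrow> pathin X q \<Longrightarrow> p 1 = q 0 \<Longrightarrow> pathin X (loop_concat p q)"
  using path_homotopic_concat[of X p p q q] path_homotopic_refl path_homotopic_ends by metis

lemma pathin_reverse:
  assumes "pathin X p" shows "pathin X (reverse_path p)"
proof -
  have "continuous_map (top_of_set {0..1}) X (p \<circ> (\<lambda>t. 1 - t))"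
    using assms unfolding pathin_def
    by (rule continuous_map_compose[rotated]) (auto intro!: continuous_intros)
  then show ?thesis by (simp add: pathin_def reverse_path_def o_def)
qed

lemma concat_ends [simp]: "loop_concat p q 0 = p 0" "loop_concat p q 1 = q 1"
  "reverse_path p 0 = p 1" "reverse_path p 1 = p 0"
  by (auto simp: loop_concat_def reverse_path_def)

text \<open>The unit interval is convex, so the parameter changes \<open>u\<close> and
  \<open>v\<close> are homotopic inside it. The groupoid laws below are instances with explicit
  piecewise linear functions.\<close>

lemma path_homotopic_reparam:
  assumes p: "pathin X p" and u: "continuous_on {0..1} u" "u \<in> {0..1} \<rightarrow> {0..1}"
    and v: "continuous_on {0..1} v" "v \<in> {0..1} \<rightarrow> {0..1}"
    and "u 0 = v 0" "u 1 = v 1"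
    and "\<And>t. t \<in> {0..1} \<Longrightarrow> q t = p (u t)" "\<And>t. t \<in> {0..1} \<Longrightarrow> r t = p (v t)"
  shows "path_homotopic X q r"
  by (rule path_homotopic_convex[where c = p and C = "{0..1}"]) (use assms in \<open>auto simp: pathin_def\<close>)

lemma continuous_on_if_le:
  fixes f g :: "real \<Rightarrow> 'b::topological_space"
  assumes "continuous_on {a..b} f" "continuous_on {a..b} g" "f c = g c"
  shows "continuous_on {a..b} (\<lambda>t. if t \<le> c then f t else g t)"
proof -
  have "{t \<in> {a..b}. t \<le> c} = {a..b} \<inter> {..c}" "{t \<in> {a..b}. c \<le> t} = {a..b} \<inter> {c..}" by auto
  then show ?thesis
    by (intro continuous_on_cases_le[where h = "\<lambda>t. t"])
      (use assms in \<open>auto intro: continuous_on_subset\<close>)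
qed

lemma path_homotopic_unit_left:
  assumes "pathin X p"
  shows "path_homotopic X (loop_concat (\<lambda>_. p 0) p) p"
proof -
  have "continuous_on {0..1} (\<lambda>t::real. if t \<le> 1/2 then 0 else 2 * t - 1)"
    by (intro continuous_on_if_le continuous_intros) auto
  then show ?thesis
    by (rule path_homotopic_reparam[OF assms, where v = "\<lambda>t. t"])
      (auto simp: loop_concat_def intro!: continuous_intros)
qed

lemma path_homotopic_unit_right:
  assumes "pathin X p"
  shows "path_homotopic X (loop_concat p (\<lambda>_. p 1)) p"
proof -
  have "continuous_on {0..1} (\<lambda>t::real. if t \<le> 1/2 then 2 * t else 1)"
    by (intro continuous_on_if_le continuous_intros) auto
  then show ?thesis
    by (rule path_homotopic_reparam[OF assms, where v = "\<lambda>t. t"])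
      (auto simp: loop_concat_def intro!: continuous_intros)
qed

lemma path_homotopic_inverse:
  assumes "pathin X p"
  shows "path_homotopic X (loop_concat p (reverse_path p)) (\<lambda>_. p 0)"
proof -
  have "continuous_on {0..1} (\<lambda>t::real. if t \<le> 1/2 then 2 * t else 2 - 2 * t)"
    by (intro continuous_on_if_le continuous_intros) auto
  then show ?thesis
    by (rule path_homotopic_reparam[OF assms, where v = "\<lambda>t. 0"])
      (auto simp: loop_concat_def reverse_path_def algebra_simps)
qed

lemma path_homotopic_inverse':
  "pathin X p \<Longrightarrow> path_homotopic X (loop_concat (reverse_path p) p) (\<lambda>_. p 1)"
  using path_homotopic_inverse[OF pathin_reverse, of X p] by (simp add: reverse_path_def)

lemma path_homotopic_assoc:
  assumes "pathin X p" "pathin X q" "pathin X r" and pq: "p 1 = q 0" "q 1 = r 0"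
  shows "path_homotopic X (loop_concat (loop_concat p q) r) (loop_concat p (loop_concat q r))"
proof -
  have p: "pathin X (loop_concat (loop_concat p q) r)"
    using assms by (auto intro!: pathin_concat)
  \<comment> \<open>This parameter change sends the break points 1/2 and 3/4 of one bracketing to
    the break points 1/4 and 1/2 of the other.\<close>
  have v: "continuous_on {0..1}
      (\<lambda>t::real. if t \<le> 1/2 then t / 2 else if t \<le> 3/4 then t - 1/4 else 2 * t - 1)"
    by (intro continuous_on_if_le continuous_intros) auto
  show ?thesis
    by (rule path_homotopic_reparam[OF p _ _ v, where u = "\<lambda>t. t"])
      (auto simp: loop_concat_def pq right_diff_distrib intro!: continuous_intros)
qed

subsection \<open>The fundamental group\<close>

abbreviation loop_class :: "'a topology \<Rightarrow> 'a \<Rightarrow> (real \<Rightarrow> 'a) \<Rightarrow> (real \<Rightarrow> 'a) set" where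
  "loop_class X a p \<equiv> loop_homotopic X a `` {p}"

lemma loop_homotopic_iff:
  "(p, q) \<in> loop_homotopic X a \<longleftrightarrow> p \<in> loops X a \<and> path_homotopic X p q"
  using path_homotopic_ends[of X p q]
  by (auto simp: loop_homotopic_def loops_def path_homotopic_def)

lemma equiv_loop_homotopic: "equiv (loops X a) (loop_homotopic X a)"
proof (rule equivI)
  show "loop_homotopic X a \<subseteq> loops X a \<times> loops X a"
    by (auto simp: loop_homotopic_def)
  show "refl_on (loops X a) (loop_homotopic X a)"
    by (auto simp: refl_on_def loop_homotopic_iff loops_def path_homotopic_refl)
  show "sym (loop_homotopic X a)"
    by (auto simp: sym_def loop_homotopic_def homotopic_with_sym)
  show "trans (loop_homotopic X a)"
    unfolding trans_def loop_homotopic_iff by (blast intro: path_homotopic_trans)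
qed

lemma loop_class_eq:
  assumes "p \<in> loops X a" "path_homotopic X p q"
  shows "loop_class X a p = loop_class X a q"
  using assms by (intro equiv_class_eq[OF equiv_loop_homotopic]) (simp add: loop_homotopic_iff)

lemma loop_class_closed: "p \<in> loops X a \<Longrightarrow> loop_class X a p \<in> carrier (fundamental_group X a)"
  by (simp add: fundamental_group_def quotientI)

lemma fundamental_group_carrierE:
  assumes "x \<in> carrier (fundamental_group X a)"
  obtains p where "p \<in> loops X a" "x = loop_class X a p"
  using assms by (auto simp: fundamental_group_def elim: quotientE)

lemma concat_loops: "p \<in> loops X a \<Longrightarrow> q \<in> loops X a \<Longrightarrow> loop_concat p q \<in> loops X a"
  by (simp add: loops_def pathin_concat)

lemma loop_class_mult:
  assumes "p \<in> loops X a" "q \<in> loops X a"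
  shows "loop_class X a p \<otimes>\<^bsub>fundamental_group X a\<^esub> loop_class X a q
    = loop_class X a (loop_concat p q)"
proof -
  have "congruent2 (loop_homotopic X a) (loop_homotopic X a)
      (\<lambda>p q. loop_class X a (loop_concat p q))"
    by (rule congruent2I')
      (auto simp: loop_homotopic_iff intro!: loop_class_eq concat_loops path_homotopic_concat,
        auto simp: loops_def)
  from UN_equiv_class2[OF equiv_loop_homotopic equiv_loop_homotopic this assms]
  show ?thesis by (simp add: fundamental_group_def)
qed

lemma fundamental_group_one: "\<one>\<^bsub>fundamental_group X a\<^esub> = loop_class X a (\<lambda>_. a)"
  by (simp add: fundamental_group_def)

lemma group_fundamental_group:
  assumes "a \<in> topspace X"
  shows "group (fundamental_group X a)"
proof (rule groupI)
  have c: "(\<lambda>_. a) \<in> loops X a" using assms by (simp add: loops_def)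
  show "\<one>\<^bsub>fundamental_group X a\<^esub> \<in> carrier (fundamental_group X a)"
    unfolding fundamental_group_one by (rule loop_class_closed[OF c])
  fix x assume "x \<in> carrier (fundamental_group X a)"
  then obtain p where p: "p \<in> loops X a" "x = loop_class X a p" by (rule fundamental_group_carrierE)
  show "\<one>\<^bsub>fundamental_group X a\<^esub> \<otimes>\<^bsub>fundamental_group X a\<^esub> x = x"
    unfolding fundamental_group_one p(2) loop_class_mult[OF c p(1)]
    using path_homotopic_unit_left[of X p] p(1)
    by (intro loop_class_eq concat_loops[OF c p(1)]) (auto simp: loops_def)
  show "\<exists>y\<in>carrier (fundamental_group X a). y \<otimes>\<^bsub>fundamental_group X a\<^esub> x = \<one>\<^bsub>fundamental_group X a\<^esub>"
  proof (rule bexI)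
    have r: "reverse_path p \<in> loops X a" using p(1) by (simp add: loops_def pathin_reverse)
    show "loop_class X a (reverse_path p) \<in> carrier (fundamental_group X a)"
      by (rule loop_class_closed[OF r])
    show "loop_class X a (reverse_path p) \<otimes>\<^bsub>fundamental_group X a\<^esub> x = \<one>\<^bsub>fundamental_group X a\<^esub>"
      unfolding fundamental_group_one p(2) loop_class_mult[OF r p(1)]
      using path_homotopic_inverse'[of X p] p(1)
      by (intro loop_class_eq concat_loops[OF r p(1)]) (auto simp: loops_def)
  qed
next
  fix x y z
  assume "x \<in> carrier (fundamental_group X a)" "y \<in> carrier (fundamental_group X a)"
    "z \<in> carrier (fundamental_group X a)"
  then obtain p q r where *: "p \<in> loops X a" "x = loop_class X a p" "q \<in> loops X a"
      "y = loop_class X a q" "r \<in> loops X a" "z = loop_class X a r"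
    by (elim fundamental_group_carrierE)
  then have "loop_class X a (loop_concat (loop_concat p q) r)
      = loop_class X a (loop_concat p (loop_concat q r))"
    by (intro loop_class_eq concat_loops path_homotopic_assoc) (auto simp: loops_def)
  then show "x \<otimes>\<^bsub>fundamental_group X a\<^esub> y \<otimes>\<^bsub>fundamental_group X a\<^esub> z
      = x \<otimes>\<^bsub>fundamental_group X a\<^esub> (y \<otimes>\<^bsub>fundamental_group X a\<^esub> z)"
    using * by (simp add: loop_class_mult concat_loops)
qed (auto elim!: fundamental_group_carrierE simp: loop_class_mult concat_loops
      simp del: Image_singleton_iff intro!: loop_class_closed)

text \<open>The paths \<open>\<theta> y\<close> are arbitrary and need not depend continuously on
  \<open>y\<close>. Only the one at the base point is normalised, so that \<open>pclass\<close> of a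
  loop is its class.\<close>

locale based_paths =
  fixes X :: "'a topology" and a \<theta>
  assumes \<theta>: "\<And>y. y \<in> topspace X \<Longrightarrow> pathin X (\<theta> y) \<and> \<theta> y 0 = a \<and> \<theta> y 1 = y"
    and a: "a \<in> topspace X" and \<theta>_base: "\<theta> a = (\<lambda>_. a)"
begin

text \<open>A functor from the fundamental groupoid to the fundamental group: paths become group
  elements, so that calculations need not keep track of end points.\<close>

definition pclass :: "(real \<Rightarrow> 'a) \<Rightarrow> (real \<Rightarrow> 'a) set" where
  "pclass q = loop_class X a (loop_concat (loop_concat (\<theta> (q 0)) q) (reverse_path (\<theta> (q 1))))"

abbreviation "\<pi> \<equiv> fundamental_group X a"

sublocale \<pi>: group \<pi> by (rule group_fundamental_group[OF a])

lemma path_ends: "pathin X q \<Longrightarrow> q 0 \<in> topspace X \<and> q 1 \<in> topspace X"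
  by (simp add: path_finish_in_topspace path_start_in_topspace)

lemma pclass_loop: 
  assumes "pathin X q"
  shows "loop_concat (loop_concat (\<theta> (q 0)) q) (reverse_path (\<theta> (q 1))) \<in> loops X a"
  using assms \<theta> path_ends[of q] by (simp add: loops_def pathin_concat pathin_reverse)

lemma pclass_closed: "pathin X q \<Longrightarrow> pclass q \<in> carrier \<pi>"
  unfolding pclass_def by (intro loop_class_closed pclass_loop)

lemma pclass_cong:
  assumes "path_homotopic X p q"
  shows "pclass p = pclass q"
proof -
  note e = path_homotopic_ends[OF assms]
  show ?thesis unfolding pclass_def e(1,2)
    by (rule loop_class_eq[OF pclass_loop[OF e(3)]])
      (use e \<theta> path_ends[of p] in \<open>auto intro!: path_homotopic_concat path_homotopic_refl assms pathin_reverse\<close>)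
qed

text \<open>Between \<open>p\<close> and \<open>q\<close> the product runs along
  \<open>\<theta>\<close> back to the base point and out again; this detour cancels up to
  homotopy.\<close>

lemma pclass_concat:
  assumes p: "pathin X p" and q: "pathin X q" and pq: "p 1 = q 0"
  shows "pclass (loop_concat p q) = pclass p \<otimes>\<^bsub>\<pi>\<^esub> pclass q"
proof -
  define s where "s = \<theta> (p 0)"
  define t where "t = \<theta> (q 0)"
  define r where "r = reverse_path (\<theta> (q 1))"
  have s: "pathin X s" "s 1 = p 0" "s 0 = a" and t: "pathin X t" "t 0 = a" "t 1 = q 0"
    and r: "pathin X r" "r 0 = q 1" "r 1 = a"
    using \<theta> path_ends[OF p] path_ends[OF q] by (auto simp: s_def t_def r_def pathin_reverse)
  note rules = pathin_concat pathin_reverse s t r p q pq path_homotopic_refl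
  let ?c = loop_concat
  let ?t = "reverse_path t"
  have "path_homotopic X (?c (?c (?c s p) ?t) (?c (?c t q) r))
         (?c (?c s p) (?c ?t (?c (?c t q) r)))"
    by (rule path_homotopic_assoc) (auto simp: rules)
  also have "path_homotopic X \<dots> (?c (?c s p) (?c (?c ?t (?c t q)) r))"
    by (intro path_homotopic_concat path_homotopic_sym[OF path_homotopic_assoc]) (auto simp: rules)
  also have "path_homotopic X \<dots> (?c (?c s p) (?c (?c (?c ?t t) q) r))"
    by (intro path_homotopic_concat path_homotopic_sym[OF path_homotopic_assoc]) (auto simp: rules)
  also have "path_homotopic X \<dots> (?c (?c s p) (?c (?c (\<lambda>_. q 0) q) r))"
    using path_homotopic_inverse'[OF t(1)]
    by (intro path_homotopic_concat) (auto simp: rules)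
  also have "path_homotopic X \<dots> (?c (?c s p) (?c q r))"
    by (intro path_homotopic_concat path_homotopic_unit_left) (auto simp: rules)
  also have "path_homotopic X \<dots> (?c (?c (?c s p) q) r)"
    by (intro path_homotopic_sym[OF path_homotopic_assoc]) (auto simp: rules)
  also have "path_homotopic X \<dots> (?c (?c s (?c p q)) r)"
    by (intro path_homotopic_concat path_homotopic_assoc) (auto simp: rules)
  finally have *: "path_homotopic X (?c (?c (?c s p) ?t) (?c (?c t q) r)) (?c (?c s (?c p q)) r)" .
  have l: "?c (?c s p) ?t \<in> loops X a" "?c (?c t q) r \<in> loops X a"
    by (auto simp: loops_def rules)
  have "pclass p \<otimes>\<^bsub>\<pi>\<^esub> pclass q = loop_class X a (?c (?c (?c s p) ?t) (?c (?c t q) r))"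
    using loop_class_mult[OF l] by (simp add: pclass_def s_def t_def r_def pq)
  also have "\<dots> = loop_class X a (?c (?c s (?c p q)) r)"
    by (rule loop_class_eq[OF concat_loops[OF l] *])
  finally show ?thesis by (simp add: pclass_def s_def r_def)
qed

lemma pclass_of_loop:
  assumes "q \<in> loops X a"
  shows "pclass q = loop_class X a q"
proof -
  have q: "pathin X q" "q 0 = a" "q 1 = a" using assms by (auto simp: loops_def)
  have r: "reverse_path (\<lambda>_. a) = (\<lambda>_. a)" by (simp add: reverse_path_def)
  have "path_homotopic X (loop_concat (loop_concat (\<lambda>_. a) q) (\<lambda>_. a)) (loop_concat (\<lambda>_. a) q)"
    using path_homotopic_unit_right[of X "loop_concat (\<lambda>_. a) q"] q a by (simp add: pathin_concat)
  also have "path_homotopic X \<dots> q"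
    using path_homotopic_unit_left[of X q] q by simp
  finally show ?thesis
    using q \<theta>_base pclass_loop[OF q(1)] by (auto simp: pclass_def r intro!: loop_class_eq)
qed

lemma pclass_const: "y \<in> topspace X \<Longrightarrow> pclass (\<lambda>_. y) = \<one>\<^bsub>\<pi>\<^esub>"
proof -
  assume y: "y \<in> topspace X"
  \<comment> \<open>The class of a constant path is idempotent, and the unit is the only idempotent
    of a group.\<close>
  have "loop_concat (\<lambda>_. y) (\<lambda>_. y) = (\<lambda>_. y)" by (simp add: loop_concat_def)
  then have "pclass (\<lambda>_. y) \<otimes>\<^bsub>\<pi>\<^esub> pclass (\<lambda>_. y) = pclass (\<lambda>_. y)"
    using pclass_concat[of "\<lambda>_. y" "\<lambda>_. y"] y by simp
  then show ?thesis using pclass_closed[of "\<lambda>_. y"] y by simp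
qed

text \<open>A triangle in a convex set bounds, and so does its image. This is applied with
  \<open>C\<close> a polygon, the square of a radial contraction, and the interval on which a path
  is cut at intermediate times.\<close>

lemma pclass_linepath:
  fixes C :: "'c::real_normed_vector set"
  assumes C: "convex C" and c: "continuous_map (top_of_set C) X c"
    and uvw: "u \<in> C" "v \<in> C" "w \<in> C"
  shows "pclass (c \<circ> linepath u v) \<otimes>\<^bsub>\<pi>\<^esub> pclass (c \<circ> linepath v w) = pclass (c \<circ> linepath u w)"
    and "pclass (c \<circ> linepath u u) = \<one>\<^bsub>\<pi>\<^esub>"
    and "pathin X (c \<circ> linepath u v)"
    and "pclass (c \<circ> linepath v u) = inv\<^bsub>\<pi>\<^esub> pclass (c \<circ> linepath u v)"
proof -
  have seg: "linepath x y \<in> {0..1} \<rightarrow> C" if "x \<in> C" "y \<in> C" for x y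
    using that C by (auto simp: linepath_def convexD_alt)
  have path: "pathin X (c \<circ> linepath x y)" if "x \<in> C" "y \<in> C" for x y
    unfolding pathin_def using seg[OF that]
    by (auto intro!: continuous_map_compose[OF _ c] continuous_intros simp: continuous_on_linepath)
  have mult: "pclass (c \<circ> linepath x y) \<otimes>\<^bsub>\<pi>\<^esub> pclass (c \<circ> linepath y z) = pclass (c \<circ> linepath x z)"
    if x: "x \<in> C" and y: "y \<in> C" and z: "z \<in> C" for x y z
  proof -
    have "path_homotopic X (loop_concat (c \<circ> linepath x y) (c \<circ> linepath y z)) (c \<circ> linepath x z)"
    proof (rule path_homotopic_convex[OF C c, where
          u = "\<lambda>t. if t \<le> 1/2 then linepath x y (2 * t) else linepath y z (2 * t - 1)"
          and v = "linepath x z"])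
      show "continuous_on {0..1} (\<lambda>t. if t \<le> 1/2 then linepath x y (2 * t) else linepath y z (2 * t - 1))"
        by (intro continuous_on_if_le) (auto simp: linepath_def intro!: continuous_intros)
      show "(\<lambda>t. if t \<le> 1/2 then linepath x y (2 * t) else linepath y z (2 * t - 1)) \<in> {0..1} \<rightarrow> C"
        using seg[OF x y] seg[OF y z] by (auto simp: Pi_iff)
    qed (use seg[OF x z] in \<open>auto simp: loop_concat_def linepath_def intro!: continuous_intros\<close>)
    then show ?thesis
      using pclass_cong pclass_concat[OF path[OF x y] path[OF y z]]
      by (fastforce simp: linepath_def)
  qed
  have one: "pclass (c \<circ> linepath x x) = \<one>\<^bsub>\<pi>\<^esub>" if "x \<in> C" for x
    using mult[OF that that that] pclass_closed[OF path[OF that that]] by simp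
  show "pclass (c \<circ> linepath u v) \<otimes>\<^bsub>\<pi>\<^esub> pclass (c \<circ> linepath v w) = pclass (c \<circ> linepath u w)"
    "pclass (c \<circ> linepath u u) = \<one>\<^bsub>\<pi>\<^esub>" "pathin X (c \<circ> linepath u v)"
    using mult one path uvw by auto
  show "pclass (c \<circ> linepath v u) = inv\<^bsub>\<pi>\<^esub> pclass (c \<circ> linepath u v)"
    using mult[of v u v] one[of v] uvw pclass_closed path \<pi>.inv_equality by metis
qed

end

section \<open>Holonomy of local systems\<close>

context group begin

lemma mult_inv_cancel [simp]:
  assumes "x \<in> carrier G" "y \<in> carrier G"
  shows "x \<otimes> (inv x \<otimes> y) = y" "inv x \<otimes> (x \<otimes> y) = y"
  using assms by (simp_all flip: m_assoc)

lemma inv_quotient_mult: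
  assumes "x \<in> carrier G" "y \<in> carrier G" "z \<in> carrier G"
  shows "(inv x \<otimes> y) \<otimes> (inv y \<otimes> z) = inv x \<otimes> z"
  using assms by (simp add: m_assoc)

text \<open>On a convex set the local cocycle \<open>D\<close> is integrated along the segments from a base point, cut
  into pieces shorter than a Lebesgue number.\<close>

lemma developing_map:
  fixes S :: "'s::euclidean_space set"
  assumes S: "compact S" "convex S"
    and r: "\<And>s. s \<in> S \<Longrightarrow> r s > 0"
    and D_closed: "\<And>s t. s \<in> S \<Longrightarrow> t \<in> S \<Longrightarrow> dist s t < r s \<Longrightarrow> D s t \<in> carrier G"
    and D_self: "\<And>s. s \<in> S \<Longrightarrow> D s s = \<one>"
    and D_local: "\<And>s t. s \<in> S \<Longrightarrow> t \<in> S \<Longrightarrow> dist s t < r s \<Longrightarrow>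
      \<exists>e>0. \<forall>u\<in>S. dist t u < e \<longrightarrow> dist t u < r t \<and> D s u = D s t \<otimes> D t u"
  shows "\<exists>g. (\<forall>s\<in>S. g s \<in> carrier G) \<and>
    (\<forall>s\<in>S. \<exists>e>0. \<forall>u\<in>S. dist s u < e \<longrightarrow> dist s u < r s \<and> g u = g s \<otimes> D s u)"
proof (cases "S = {}")
  case False
  then obtain o' where o: "o' \<in> S" by blast
  \<comment> \<open>On the intersection of the two balls with \<open>S\<close>, which is convex, the
    transports from \<open>s\<close> and from \<open>s'\<close> differ by a locally constant left
    factor. Hence the transport from \<open>t\<close> to \<open>u\<close> through a centre does not
    depend on the centre.\<close>
  have ratio: "inv (D s t) \<otimes> D s u = inv (D s' t) \<otimes> D s' u"
    if s: "s \<in> S" "s' \<in> S" "t \<in> S" "u \<in> S" and dt: "dist s t < r s" "dist s' t < r s'"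
      and du: "dist s u < r s" "dist s' u < r s'" for s s' t u
  proof -
    define B where "B = ball s (r s) \<inter> ball s' (r s') \<inter> S"
    define f where "f = (\<lambda>u. D s u \<otimes> inv (D s' u))"
    have "connected B"
      unfolding B_def by (intro convex_connected convex_Int S convex_ball)
    moreover have "\<forall>a\<in>B. eventually (\<lambda>b. f a = f b) (at a within B)"
    proof
      fix a assume "a \<in> B"
      then have a: "a \<in> S" "dist s a < r s" "dist s' a < r s'" by (auto simp: B_def)
      obtain e1 where e1: "e1 > 0"
        "\<And>u. u \<in> S \<Longrightarrow> dist a u < e1 \<Longrightarrow> dist a u < r a \<and> D s u = D s a \<otimes> D a u"
        using D_local[OF s(1) a(1,2)] by blast
      obtain e2 where e2: "e2 > 0"
        "\<And>u. u \<in> S \<Longrightarrow> dist a u < e2 \<Longrightarrow> D s' u = D s' a \<otimes> D a u"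
        using D_local[OF s(2) a(1,3)] by blast
      have "f a = f b" if b: "b \<in> B" "dist b a < min e1 e2" for b
      proof -
        have b': "b \<in> S" "dist a b < e1" "dist a b < e2" using b by (auto simp: B_def dist_commute)
        have cl: "D s a \<in> carrier G" "D s' a \<in> carrier G" "D a b \<in> carrier G"
          using D_closed e1(2)[OF b'(1,2)] s a b' by auto
        have "f b = (D s a \<otimes> D a b) \<otimes> (inv (D a b) \<otimes> inv (D s' a))"
          using cl e1(2)[OF b'(1,2)] e2(2)[OF b'(1,3)] by (simp add: f_def inv_mult_group)
        also have "\<dots> = D s a \<otimes> (D a b \<otimes> inv (D a b)) \<otimes> inv (D s' a)"
          using cl by (simp add: m_assoc)
        finally show ?thesis using cl by (simp add: f_def)
      qed
      then show "eventually (\<lambda>b. f a = f b) (at a within B)"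
        unfolding eventually_at using e1(1) e2(1) by (intro exI[of _ "min e1 e2"]) auto
    qed
    ultimately have f: "f t = f u"
      using that by - (rule connected_local_const[of B t u f], auto simp: B_def)
    have cl: "D s t \<in> carrier G" "D s' t \<in> carrier G" "D s u \<in> carrier G" "D s' u \<in> carrier G"
      using that D_closed by auto
    have "inv (D s t) \<otimes> D s u = inv (D s t) \<otimes> (f u \<otimes> D s' u)"
      using cl by (simp add: f_def m_assoc)
    also have "\<dots> = inv (D s t) \<otimes> (f t \<otimes> D s' u)" by (simp add: f)
    also have "\<dots> = inv (D s' t) \<otimes> D s' u"
      unfolding f_def using cl by (simp add: m_assoc[symmetric])
    finally show ?thesis .
  qed
  obtain e where e: "e > 0" "\<And>t. t \<in> S \<Longrightarrow> \<exists>b\<in>(\<lambda>s. ball s (r s)) ` S. ball t e \<subseteq> b"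
  proof (rule Heine_Borel_lemma[OF S(1), of "(\<lambda>s. ball s (r s)) ` S"])
    show "S \<subseteq> \<Union> ((\<lambda>s. ball s (r s)) ` S)" using r by auto
  qed auto
  then have "\<forall>t\<in>S. \<exists>s. s \<in> S \<and> ball t e \<subseteq> ball s (r s)"
    by blast
  from bchoice[OF this] obtain c where
    c: "\<And>t. t \<in> S \<Longrightarrow> c t \<in> S \<and> ball t e \<subseteq> ball (c t) (r (c t))"
    by blast
  \<comment> \<open>Transport between any two points closer than the Lebesgue number
    \<open>e\<close>, computed through a centre \<open>c t\<close> whose ball contains both.\<close>
  define E where "E = (\<lambda>t u. inv (D (c t) t) \<otimes> D (c t) u)"
  have cD: "dist (c t) u < r (c t)" if "t \<in> S" "dist t u < e" for t u
    using c[OF that(1)] that(2) by auto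
  have E: "E t u = inv (D s t) \<otimes> D s u"
    if "s \<in> S" "t \<in> S" "u \<in> S" "dist s t < r s" "dist s u < r s" "dist t u < e" for s t u
    unfolding E_def using that c e(1) by (intro ratio cD) auto
  have E_closed: "E t u \<in> carrier G" if "t \<in> S" "u \<in> S" "dist t u < e" for t u
    unfolding E_def using that c e(1) cD D_closed by simp
  have E_trans: "E t u \<otimes> E u v = E t v"
    if "t \<in> S" "u \<in> S" "v \<in> S" "dist t u < e" "dist t v < e" "dist u v < e" for t u v
  proof -
    let ?s = "c t"
    have s: "?s \<in> S" "dist ?s t < r ?s" "dist ?s u < r ?s" "dist ?s v < r ?s"
      using that c cD e(1) by auto
    then have "E t u = inv (D ?s t) \<otimes> D ?s u" "E u v = inv (D ?s u) \<otimes> D ?s v"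
      "E t v = inv (D ?s t) \<otimes> D ?s v"
      using that by (auto intro!: E)
    moreover have "D ?s t \<in> carrier G" "D ?s u \<in> carrier G" "D ?s v \<in> carrier G"
      using s that D_closed by auto
    ultimately show ?thesis by (simp add: inv_quotient_mult)
  qed
  obtain M where M: "\<And>s. s \<in> S \<Longrightarrow> dist o' s \<le> M"
    using compact_imp_bounded[OF S(1)] bounded_any_center by metis
  \<comment> \<open>With \<open>N\<close> pieces each step is shorter than \<open>e / 2\<close>, so
    that the diagonals in \<open>g_ladder\<close> stay shorter than \<open>e\<close>.\<close>
  obtain N :: nat where N: "real N > 2 * M / e" using reals_Archimedean2 by blast
  have "M \<ge> 0" using M[OF o] by simp
  then have "0 \<le> 2 * M / e" using e(1) by simp
  then have N0: "real N > 0" using N by linarith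
  define pt where "pt = (\<lambda>s i. o' + (real i / real N) *\<^sub>R (s - o'))"
  have pt_S: "pt s i \<in> S" if "s \<in> S" "i \<le> N" for s i
  proof -
    have "pt s i = (1 - real i / real N) *\<^sub>R o' + (real i / real N) *\<^sub>R s"
      by (simp add: pt_def algebra_simps)
    then show ?thesis
      using convexD_alt[OF S(2) o that(1), of "real i / real N"] that(2) N0 by auto
  qed
  have pt_step: "dist (pt s i) (pt s (Suc i)) < e / 2" if "s \<in> S" for s i
  proof -
    have "pt s (Suc i) - pt s i = (1 / real N) *\<^sub>R (s - o')"
      by (simp add: pt_def add_divide_distrib scaleR_left_distrib)
    then have "dist (pt s i) (pt s (Suc i)) = dist o' s / real N"
      using N0 by (simp add: dist_norm norm_minus_commute[of "pt s i" "pt s (Suc i)"]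
          norm_minus_commute[of o' s])
    also have "\<dots> \<le> M / real N" using M[OF that] N0 by (simp add: divide_right_mono)
    also have "\<dots> < e / 2" using N N0 e(1) by (simp add: field_simps)
    finally show ?thesis .
  qed
  have pt_dist: "dist (pt s i) (pt t i) \<le> dist s t" if "i \<le> N" for s t i
  proof -
    have "pt s i - pt t i = (real i / real N) *\<^sub>R (s - t)"
      by (simp add: pt_def algebra_simps)
    then have "dist (pt s i) (pt t i) = (real i / real N) * dist s t"
      by (simp add: dist_norm)
    also have "\<dots> \<le> 1 * dist s t" using that N0 by (intro mult_right_mono) auto
    finally show ?thesis by simp
  qed
  define g where "g = (\<lambda>s. rec_nat \<one> (\<lambda>i x. x \<otimes> E (pt s i) (pt s (Suc i))))"
  have g_simps: "g s 0 = \<one>" "g s (Suc i) = g s i \<otimes> E (pt s i) (pt s (Suc i))" for s i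
    by (simp_all add: g_def)
  have g_closed: "i \<le> N \<Longrightarrow> g s i \<in> carrier G" if "s \<in> S" for s i
    by (induction i) (use that pt_S pt_step[of s] e(1) in \<open>auto simp: g_simps intro!: E_closed less_trans[OF pt_step]\<close>)
  \<comment> \<open>The segments to \<open>s\<close> and to \<open>t\<close> are the rails of a
    ladder; each of its quadrilaterals is cut by a diagonal, and \<open>E_trans\<close> applies to
    both triangles.\<close>
  have g_ladder: "i \<le> N \<Longrightarrow> g t i = g s i \<otimes> E (pt s i) (pt t i)"
    if st: "s \<in> S" "t \<in> S" "dist s t < e / 2" for s t i
  proof (induction i)
    case 0
    have "E o' o' = \<one>" using E[of o' o' o'] o r D_self e(1) by simp
    then show ?case by (simp add: g_simps pt_def)
  next
    case (Suc i)
    let ?s = "pt s i" and ?t = "pt t i" and ?s' = "pt s (Suc i)" and ?t' = "pt t (Suc i)"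
    have in_S: "?s \<in> S" "?t \<in> S" "?s' \<in> S" "?t' \<in> S" using st pt_S Suc.prems by auto
    have d: "dist ?s ?t < e / 2" "dist ?s' ?t' < e / 2"
      using pt_dist[of i s t] pt_dist[of "Suc i" s t] Suc.prems st(3) by auto
    have d': "dist ?s ?s' < e / 2" "dist ?t ?t' < e / 2" using pt_step st by auto
    have "dist ?s ?t' < e" using d(1) d'(2) dist_triangle[of ?s ?t' ?t] by linarith
    then have 1: "E ?s ?t \<otimes> E ?t ?t' = E ?s ?t'" "E ?s ?s' \<otimes> E ?s' ?t' = E ?s ?t'"
      using d d' e(1) in_S by (auto intro!: E_trans)
    have cl: "g s i \<in> carrier G" "E ?s ?t \<in> carrier G" "E ?t ?t' \<in> carrier G"
      "E ?s ?s' \<in> carrier G" "E ?s' ?t' \<in> carrier G"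
      using g_closed[OF st(1)] Suc.prems in_S d d' e(1) by (auto intro!: E_closed)
    then show ?case using Suc 1 by (simp add: g_simps m_assoc)
  qed
  show ?thesis
  proof (intro exI[of _ "\<lambda>s. g s N"] conjI ballI)
    fix s assume s: "s \<in> S"
    show "g s N \<in> carrier G" using g_closed[OF s] by simp
    show "\<exists>e>0. \<forall>u\<in>S. dist s u < e \<longrightarrow> dist s u < r s \<and> g u N = g s N \<otimes> D s u"
    proof (intro exI[of _ "min (e / 2) (r s)"] conjI ballI impI)
      fix u assume u: "u \<in> S" "dist s u < min (e / 2) (r s)"
      have "pt s N = s" "pt u N = u" using N0 by (simp_all add: pt_def)
      moreover have "E s u = D s u"
        using E[of s s u] s u r e(1) D_self D_closed[OF s u(1)] by simp
      ultimately show "g u N = g s N \<otimes> D s u"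
        using g_ladder[OF s u(1), of N] u(2) by simp
    qed (use e(1) r[OF s] in auto)
  qed
qed auto

end

text \<open>A flat bundle with fibre \<open>K\<close> is given by its parallel transport \<open>d x y\<close> from \<open>x\<close> to the
  points \<open>y\<close> of a neighbourhood \<open>U x\<close>; \<open>is_lift S h g\<close> says that \<open>s \<mapsto> (h s, g s)\<close> is a flat
  section along \<open>h\<close>.\<close>

locale local_system = group K for K (structure) +
  fixes X :: "'x topology" and U :: "'x \<Rightarrow> 'x set" and d :: "'x \<Rightarrow> 'x \<Rightarrow> 'a"
  assumes U_open: "x \<in> topspace X \<Longrightarrow> openin X (U x)"
    and U_self: "x \<in> topspace X \<Longrightarrow> x \<in> U x"
    and d_closed: "x \<in> topspace X \<Longrightarrow> y \<in> U x \<Longrightarrow> d x y \<in> carrier K"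
    and d_self: "x \<in> topspace X \<Longrightarrow> d x x = \<one>"
    and d_local: "x \<in> topspace X \<Longrightarrow> y \<in> U x \<Longrightarrow>
      \<exists>V. openin X V \<and> y \<in> V \<and> V \<subseteq> U y \<and> (\<forall>v\<in>V. d x v = d x y \<otimes> d y v)"
begin

definition is_lift :: "'s::metric_space set \<Rightarrow> ('s \<Rightarrow> 'x) \<Rightarrow> ('s \<Rightarrow> 'a) \<Rightarrow> bool" where
  "is_lift S h g \<longleftrightarrow> (\<forall>s\<in>S. g s \<in> carrier K \<and>
     (\<exists>e>0. \<forall>u\<in>S. dist s u < e \<longrightarrow> h u \<in> U (h s) \<and> g u = g s \<otimes> d (h s) (h u)))"

lemma preimage_ball:
  assumes "continuous_map (top_of_set S) X h" "openin X V" "s \<in> S" "h s \<in> V"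
  obtains e where "e > 0" "\<And>u. u \<in> S \<Longrightarrow> dist s u < e \<Longrightarrow> h u \<in> V"
proof -
  have "openin (top_of_set S) {u \<in> S. h u \<in> V}"
    using openin_continuous_map_preimage[OF assms(1,2)] by simp
  then obtain e where "e > 0" "\<forall>u\<in>S. dist u s < e \<longrightarrow> u \<in> {u \<in> S. h u \<in> V}"
    using assms(3,4) unfolding openin_euclidean_subtopology_iff by blast
  then show thesis
    by (intro that[of e]) (auto simp: dist_commute)
qed

text \<open>The transport \<open>d\<close>, pulled back along \<open>h\<close>, is a local cocycle
  on \<open>S\<close> of the kind integrated by \<open>developing_map\<close>.\<close>

lemma lift_exists:
  fixes S :: "'s::euclidean_space set"
  assumes S: "compact S" "convex S" and h: "continuous_map (top_of_set S) X h"
  shows "\<exists>g. is_lift S h g"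
proof -
  have hX: "h s \<in> topspace X" if "s \<in> S" for s
    using that continuous_map_image_subset_topspace[OF h] by auto
  have "\<exists>e>0. \<forall>u\<in>S. dist s u < e \<longrightarrow> h u \<in> U (h s)" if "s \<in> S" for s
    by (rule preimage_ball[OF h U_open[OF hX[OF that]] that U_self[OF hX[OF that]]]) blast
  then obtain r where r: "\<And>s. s \<in> S \<Longrightarrow> r s > 0"
      "\<And>s u. s \<in> S \<Longrightarrow> u \<in> S \<Longrightarrow> dist s u < r s \<Longrightarrow> h u \<in> U (h s)"
    by metis
  have "\<exists>g. (\<forall>s\<in>S. g s \<in> carrier K) \<and>
    (\<forall>s\<in>S. \<exists>e>0. \<forall>u\<in>S. dist s u < e \<longrightarrow> dist s u < r s \<and> g u = g s \<otimes> d (h s) (h u))"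
  proof (rule developing_map[OF S])
    fix s t assume st: "s \<in> S" "t \<in> S" "dist s t < r s"
    show "d (h s) (h t) \<in> carrier K" using d_closed[OF hX] r(2) st by blast
    obtain V where V: "openin X V" "h t \<in> V" "V \<subseteq> U (h t)"
        "\<forall>v\<in>V. d (h s) v = d (h s) (h t) \<otimes> d (h t) v"
      using d_local[OF hX[OF st(1)] r(2)[OF st]] by blast
    obtain e where "e > 0" "\<And>u. u \<in> S \<Longrightarrow> dist t u < e \<Longrightarrow> h u \<in> V"
      using preimage_ball[OF h V(1) st(2) V(2)] by blast
    then show "\<exists>e>0. \<forall>u\<in>S. dist t u < e \<longrightarrow>
        dist t u < r t \<and> d (h s) (h u) = d (h s) (h t) \<otimes> d (h t) (h u)"
      using V(4) r(1)[OF st(2)] by (intro exI[of _ "min e (r t)"]) auto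
  qed (auto simp: r(1) d_self hX)
  then obtain g where g: "\<forall>s\<in>S. g s \<in> carrier K"
      "\<And>s. s \<in> S \<Longrightarrow> \<exists>e>0. \<forall>u\<in>S. dist s u < e \<longrightarrow> dist s u < r s \<and> g u = g s \<otimes> d (h s) (h u)"
    by blast
  have "is_lift S h g"
    unfolding is_lift_def
  proof (intro ballI conjI)
    fix s assume s: "s \<in> S"
    obtain e where "e > 0"
        "\<forall>u\<in>S. dist s u < e \<longrightarrow> dist s u < r s \<and> g u = g s \<otimes> d (h s) (h u)"
      using g(2)[OF s] by blast
    with r(2)[OF s]
    show "\<exists>e>0. \<forall>u\<in>S. dist s u < e \<longrightarrow> h u \<in> U (h s) \<and> g u = g s \<otimes> d (h s) (h u)"
      by (intro exI[of _ e]) simp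
  qed (use g(1) in blast)
  then show ?thesis by blast
qed

text \<open>Near each point both lifts are multiplied on the right by the same transport, which
  cancels in the quotient; so the quotient is locally constant on a connected set.\<close>

lemma lift_unique:
  assumes S: "connected S" "s \<in> S" "t \<in> S" and h: "h ` S \<subseteq> topspace X"
    and g: "is_lift S h g" and g': "is_lift S h g'"
  shows "g s \<otimes> inv (g' s) = g t \<otimes> inv (g' t)"
proof (rule connected_local_const[OF S(1,2,3)], rule ballI)
  fix a assume a: "a \<in> S"
  obtain e1 where e1: "e1 > 0"
      "\<And>u. u \<in> S \<Longrightarrow> dist a u < e1 \<Longrightarrow> h u \<in> U (h a) \<and> g u = g a \<otimes> d (h a) (h u)"
    using g a unfolding is_lift_def by blast
  obtain e2 where e2: "e2 > 0"
      "\<And>u. u \<in> S \<Longrightarrow> dist a u < e2 \<Longrightarrow> g' u = g' a \<otimes> d (h a) (h u)"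
    using g' a unfolding is_lift_def by blast
  have "g a \<otimes> inv (g' a) = g b \<otimes> inv (g' b)" if "b \<in> S" "dist b a < min e1 e2" for b
  proof -
    let ?d = "d (h a) (h b)"
    have b: "g b = g a \<otimes> ?d" "g' b = g' a \<otimes> ?d" "h b \<in> U (h a)"
      using e1(2)[of b] e2(2)[of b] that by (auto simp: dist_commute)
    have cl: "g a \<in> carrier K" "g' a \<in> carrier K" "?d \<in> carrier K"
      using g g' a h b(3) d_closed unfolding is_lift_def by blast+
    have "g b \<otimes> inv (g' b) = g a \<otimes> (?d \<otimes> inv ?d) \<otimes> inv (g' a)"
      using cl b by (simp add: inv_mult_group m_assoc)
    then show ?thesis using cl by simp
  qed
  then show "eventually (\<lambda>b. g a \<otimes> inv (g' a) = g b \<otimes> inv (g' b)) (at a within S)"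
    unfolding eventually_at using e1(1) e2(1) by (intro exI[of _ "min e1 e2"]) auto
qed

lemma lift_compose:
  assumes g: "is_lift S h g" and u: "continuous_on T u" "u \<in> T \<rightarrow> S"
    and k: "\<And>t. t \<in> T \<Longrightarrow> k t = h (u t)"
  shows "is_lift T k (\<lambda>t. g (u t))"
  unfolding is_lift_def
proof (intro ballI conjI)
  fix t assume t: "t \<in> T"
  then have ut: "u t \<in> S" using u by auto
  then show "g (u t) \<in> carrier K" using g by (auto simp: is_lift_def)
  obtain e where e: "e > 0"
      "\<And>v. v \<in> S \<Longrightarrow> dist (u t) v < e \<Longrightarrow> h v \<in> U (h (u t)) \<and> g v = g (u t) \<otimes> d (h (u t)) (h v)"
    using g ut unfolding is_lift_def by blast
  obtain e' where e': "e' > 0" "\<And>s. s \<in> T \<Longrightarrow> dist s t < e' \<Longrightarrow> dist (u s) (u t) < e"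
    using u(1) t e(1) unfolding continuous_on_iff by metis
  show "\<exists>e>0. \<forall>s\<in>T. dist t s < e \<longrightarrow> k s \<in> U (k t) \<and> g (u s) = g (u t) \<otimes> d (k t) (k s)"
  proof (intro exI[of _ e'] conjI ballI impI)
    fix s assume s: "s \<in> T" "dist t s < e'"
    have "u s \<in> S" "dist (u t) (u s) < e"
      using e'(2)[of s] s u(2) by (auto simp: dist_commute)
    then show "k s \<in> U (k t)" "g (u s) = g (u t) \<otimes> d (k t) (k s)"
      using e(2) k[OF t] k[OF s(1)] by simp_all
  qed (rule e'(1))
qed

definition hol :: "(real \<Rightarrow> 'x) \<Rightarrow> 'a" where
  "hol q = (let g = (SOME g. is_lift {0..1} q g) in inv (g 0) \<otimes> g 1)"

text \<open>Two lifts differ by a constant left factor, which cancels in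
  \<open>inv (g 0) \<otimes> g 1\<close>; the choice made in \<open>hol\<close> is therefore
  immaterial.\<close>

lemma hol_eq:
  assumes q: "pathin X q" and g: "is_lift {0..1} q g"
  shows "hol q = inv (g 0) \<otimes> g 1"
proof -
  define g' where "g' = (SOME g. is_lift {0..1} q g)"
  have g': "is_lift {0..1} q g'"
    unfolding g'_def by (rule someI[where P = "is_lift {0..1} q", OF g])
  have "q ` {0..1} \<subseteq> topspace X"
    using q path_image_subset_topspace by blast
  then have *: "g 0 \<otimes> inv (g' 0) = g 1 \<otimes> inv (g' 1)"
    using lift_unique[of "{0..1::real}" 0 1 q g g'] g g' by simp
  have cl: "g 0 \<in> carrier K" "g 1 \<in> carrier K" "g' 0 \<in> carrier K" "g' 1 \<in> carrier K"
    using g g' by (auto simp: is_lift_def)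
  have "inv (g' 0) \<otimes> g' 1 = inv (g 0) \<otimes> (g 0 \<otimes> inv (g' 0)) \<otimes> g' 1"
    using cl by (simp add: m_assoc[symmetric])
  also have "\<dots> = inv (g 0) \<otimes> g 1"
    unfolding * using cl by (simp add: m_assoc)
  finally show ?thesis by (simp add: hol_def g'_def[symmetric])
qed

lemma path_lift:
  assumes "pathin X q"
  obtains g where "is_lift {0..1} q g"
  using lift_exists[of "{0..1::real}" q] assms by (auto simp: pathin_def)

lemma hol_closed: "pathin X q \<Longrightarrow> hol q \<in> carrier K"
  by (rule path_lift[of q]) (auto simp: hol_eq is_lift_def)

lemma hol_const:
  assumes "y \<in> topspace X" "\<And>t. t \<in> {0..1} \<Longrightarrow> q t = y"
  shows "hol q = \<one>"
proof -
  have "pathin X q"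
    using path_homotopic_ends(4)[OF path_homotopic_eq[of X "\<lambda>_. y" q]] assms by simp
  moreover have "is_lift {0..1} q (\<lambda>_. \<one>)"
    using assms U_self by (auto simp: is_lift_def d_self intro!: exI[of _ 1])
  ultimately show ?thesis by (subst hol_eq) auto
qed

text \<open>The homotopy is lifted over the whole square. Two opposite sides lift \<open>p\<close>
  and \<open>q\<close>; the other two lie over constant paths, where the lift has equal end
  values.\<close>

lemma hol_path_homotopic:
  assumes "path_homotopic X p q"
  shows "hol p = hol q"
proof -
  obtain h where h: "continuous_map (prod_topology (top_of_set {0..1}) (top_of_set {0..1})) X h"
      "\<And>x. h (0::real, x) = p x" "\<And>x. h (1, x) = q x"
      "\<And>t. t \<in> {0..1} \<Longrightarrow> h (t, 0) = p 0 \<and> h (t, 1) = p 1"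
    using assms unfolding path_homotopic_def homotopic_with_def by blast
  let ?S = "{0..1::real} \<times> {0..1::real}"
  obtain g where g: "is_lift ?S h g"
    using lift_exists[of ?S h] h(1) by (auto simp: compact_Times convex_Times)
  note e = path_homotopic_ends[OF assms]
  note top = path_start_in_topspace[OF e(3)] path_finish_in_topspace[OF e(3)]
  have bot: "is_lift {0..1} p (\<lambda>t. g (0, t))" "is_lift {0..1} q (\<lambda>t. g (1, t))"
    by (rule lift_compose[OF g]; auto simp: h intro!: continuous_intros)+
  have sides: "is_lift {0..1} (\<lambda>_. p 0) (\<lambda>t. g (t, 0))" "is_lift {0..1} (\<lambda>_. p 1) (\<lambda>t. g (t, 1))"
    by (rule lift_compose[OF g]; auto simp: h intro!: continuous_intros)+
  have cl: "g (x, y) \<in> carrier K" if "x \<in> {0..1}" "y \<in> {0..1}" for x y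
    using g that by (auto simp: is_lift_def)
  have "inv (g (0, 0)) \<otimes> g (1, 0) = \<one>" "inv (g (0, 1)) \<otimes> g (1, 1) = \<one>"
    using hol_eq[OF _ sides(1)] hol_eq[OF _ sides(2)] hol_const[of "p 0" "\<lambda>_. p 0"]
      hol_const[of "p 1" "\<lambda>_. p 1"] top by auto
  then have "g (1, 0) = g (0, 0)" "g (1, 1) = g (0, 1)"
    using cl by (metis atLeastAtMost_iff inv_closed inv_equality inv_inv order_refl zero_le_one)+
  then show ?thesis
    using hol_eq[OF e(3) bot(1)] hol_eq[OF e(4) bot(2)] by simp
qed

lemma hol_concat:
  assumes p: "pathin X p" and q: "pathin X q" and pq: "p 1 = q 0"
  shows "hol (loop_concat p q) = hol p \<otimes> hol q"
proof -
  obtain g where g: "is_lift {0..1} (loop_concat p q) g"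
    using path_lift pathin_concat[OF p q pq] by blast
  have "is_lift {0..1} p (\<lambda>t. g (t / 2))"
    by (rule lift_compose[OF g]) (auto simp: loop_concat_def intro!: continuous_intros)
  moreover have "is_lift {0..1} q (\<lambda>t. g ((1 + t) / 2))"
    by (rule lift_compose[OF g]) (auto simp: loop_concat_def add_divide_distrib pq intro!: continuous_intros)
  moreover have "g 0 \<in> carrier K" "g (1/2) \<in> carrier K" "g 1 \<in> carrier K"
    using g by (auto simp: is_lift_def)
  ultimately show ?thesis
    using hol_eq[OF pathin_concat[OF p q pq] g] hol_eq[OF p] hol_eq[OF q]
    by (simp add: inv_quotient_mult)
qed

lemma hol_hom:
  assumes "a \<in> topspace X"
  shows "\<exists>\<eta> \<in> hom (fundamental_group X a) K. \<forall>p\<in>loops X a. \<eta> (loop_class X a p) = hol p"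
proof -
  define \<eta> where "\<eta> = (\<lambda>A. hol (SOME p. p \<in> A))"
  have \<eta>: "\<eta> (loop_class X a p) = hol p" if "p \<in> loops X a" for p
  proof -
    have "p \<in> loop_class X a p"
      using that equiv_class_self[OF equiv_loop_homotopic] by metis
    then have "(SOME q. q \<in> loop_class X a p) \<in> loop_class X a p"
      by (rule someI[where P = "\<lambda>q. q \<in> loop_class X a p"])
    then show ?thesis
      unfolding \<eta>_def by (metis Image_singleton_iff hol_path_homotopic loop_homotopic_iff)
  qed
  moreover have "\<eta> \<in> hom (fundamental_group X a) K"
    by (rule homI)
      (auto elim!: fundamental_group_carrierE simp: \<eta> loop_class_mult concat_loops
        simp del: Image_singleton_iff, auto simp: loops_def hol_closed hol_concat)
  ultimately show ?thesis by blast
qed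

end

section \<open>Sides of a regular polygon\<close>

text \<open>Also used with \<open>k = n\<close>, where it repeats corner 0, so that the last side
  needs no separate treatment.\<close>

definition corner :: "nat \<Rightarrow> nat \<Rightarrow> complex" where
  "corner n k = cis (2 * pi * real k / real n)"

lemma side_corner: "side n k = linepath (corner n k) (corner n (Suc k))"
  by (simp add: side_def corner_def)

lemma side_ends [simp]: "side n k 0 = corner n k" "side n k 1 = corner n (Suc k)"
  by (simp_all add: side_corner linepath_def)

lemma corner_wrap: "n > 0 \<Longrightarrow> corner n n = corner n 0"
  by (simp add: corner_def)

lemma convex_ngon: "convex (ngon n)"
  by (simp add: ngon_def convex_convex_hull)

lemma corner_in_ngon: "n > 0 \<Longrightarrow> k \<le> n \<Longrightarrow> corner n k \<in> ngon n"
proof -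
  have "corner n k \<in> ngon n" if "k < n" for k
    using that unfolding ngon_def corner_def by (intro hull_inc) auto
  then show "n > 0 \<Longrightarrow> k \<le> n \<Longrightarrow> corner n k \<in> ngon n"
    using corner_wrap[of n] by (cases "k = n") auto
qed

lemma side_in_ngon: "k < n \<Longrightarrow> t \<in> {0..1} \<Longrightarrow> side n k t \<in> ngon n"
  unfolding side_corner linepath_def
  using convexD_alt[OF convex_ngon[of n] corner_in_ngon[of n k] corner_in_ngon[of n "Suc k"], of t]
  by auto

text \<open>Every side is a rotation about the centre of one segment starting at 1. Distances along
  a side and norms of its points are therefore the same for all sides.\<close>

lemma side_rotate: "side n k t = corner n k * (1 + of_real t * (cis (2 * pi / real n) - 1))"
proof -
  have "corner n (Suc k) = corner n k * cis (2 * pi / real n)"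
    by (simp add: corner_def cis_mult add_divide_distrib distrib_left algebra_simps)
  then show ?thesis
    by (simp add: side_corner linepath_def scaleR_conv_of_real algebra_simps)
qed

lemma dist_side: "dist (side n k s) (side n k t) = \<bar>s - t\<bar> * norm (cis (2 * pi / real n) - 1)"
proof -
  have "side n k s - side n k t = corner n k * of_real (s - t) * (cis (2 * pi / real n) - 1)"
    by (simp add: side_rotate algebra_simps)
  then show ?thesis
    by (simp add: dist_norm norm_mult corner_def flip: of_real_diff)
qed

lemma norm_side: "norm (side n k t) = norm (1 + of_real t * (cis (2 * pi / real n) - 1))"
  by (simp add: side_rotate norm_mult corner_def)

lemma norm_side_square:
  "(norm (side n k t))\<^sup>2 = 1 - 2 * (1 - cos (2 * pi / real n)) * (t * (1 - t))"
proof -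
  let ?c = "cos (2 * pi / real n)" and ?s = "sin (2 * pi / real n)"
  have "(norm (side n k t))\<^sup>2 = (1 + t * (?c - 1))\<^sup>2 + (t * ?s)\<^sup>2"
    unfolding norm_side cmod_power2 by simp
  also have "\<dots> = 1 + 2 * t * (?c - 1) + t\<^sup>2 * ((?c\<^sup>2 + ?s\<^sup>2) + 1 - 2 * ?c)"
    unfolding power2_eq_square by (simp only: algebra_simps)
  also have "\<dots> = 1 + 2 * t * (?c - 1) + t\<^sup>2 * (1 + 1 - 2 * ?c)"
    by (simp only: sin_cos_squared_add2)
  finally show ?thesis by (simp add: power2_eq_square algebra_simps)
qed

lemma cos_less_one: "n \<ge> 3 \<Longrightarrow> cos (2 * pi / real n) < 1"
proof -
  assume n: "n \<ge> 3"
  have "2 * pi / real n \<le> pi" using n by (simp add: field_simps)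
  then show ?thesis using cos_monotone_0_pi[of 0 "2 * pi / real n"] n by simp
qed

text \<open>The squared norm is a quadratic function of the parameter, symmetric about 1/2. Since
  gluings preserve the norm, this bounds the number of representatives of a glued point.\<close>

lemma norm_side_eq:
  assumes "n \<ge> 3" "norm (side n k s) = norm (side n k' t)"
  shows "t = s \<or> t = 1 - s"
proof -
  have "2 * (1 - cos (2 * pi / real n)) * (s * (1 - s)) = 2 * (1 - cos (2 * pi / real n)) * (t * (1 - t))"
    using norm_side_square[of n k s] norm_side_square[of n k' t] unfolding assms(2) by linarith
  moreover have "2 * (1 - cos (2 * pi / real n)) \<noteq> 0" using cos_less_one[OF assms(1)] by simp
  ultimately have "s * (1 - s) = t * (1 - t)" using mult_left_cancel by blast
  then have "(t - s) * (1 - s - t) = 0" by (simp add: algebra_simps)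
  then show ?thesis by auto
qed

lemma cos_less_aux:
  assumes "0 < y" "y < x" "x < 2 * pi - y"
  shows "cos x < cos y"
proof (cases "x \<le> pi")
  case True
  then show ?thesis using assms cos_monotone_0_pi[of y x] by simp
next
  case False
  then have "cos (2 * pi - x) < cos y" using assms cos_monotone_0_pi[of y "2 * pi - x"] by simp
  then show ?thesis by (simp add: cos_diff)
qed

text \<open>The height of a point over the line through the \<open>k\<close>-th side is measured by this
  functional; the polygon lies on one side of that line and only the two ends of the side lie
  on it.\<close>

definition height :: "nat \<Rightarrow> nat \<Rightarrow> complex \<Rightarrow> real" where
  "height n k w = Re (w * cis (- (2 * real k + 1) * pi / real n))"

lemma height_corner: "height n k (corner n j) = cos ((2 * real j - 2 * real k - 1) * pi / real n)"
proof -
  have "2 * pi * real j / real n + - (2 * real k + 1) * pi / real n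
      = (2 * real j - 2 * real k - 1) * pi / real n"
    by (simp add: field_simps flip: add_divide_distrib)
  then show ?thesis by (simp add: height_def corner_def cis_mult)
qed

lemma height_side: "height n k (side n j t) =
    (1 - t) * height n k (corner n j) + t * height n k (corner n (Suc j))"
  by (simp add: height_def side_corner linepath_def algebra_simps)

text \<open>Measured from the direction of the midpoint of side \<open>k\<close>, the angle of
  corner \<open>j\<close> is up to sign an odd multiple \<open>m\<close> of \<open>pi / n\<close>
  with \<open>1 \<le> m \<le> 2 * n - 1\<close>, and the cosine is maximal exactly at the two
  extreme values of \<open>m\<close>. Since \<open>j = n\<close> repeats corner 0, the wrap-around
  appears as two extra alternatives.\<close>

lemma height_corner_less:
  assumes n: "n \<ge> 3" "j \<le> n" "k < n"
  shows "height n k (corner n j) \<le> cos (pi / real n)"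
    and "height n k (corner n j) = cos (pi / real n) \<Longrightarrow>
      j = k \<or> j = Suc k \<or> (j = 0 \<and> Suc k = n) \<or> (j = n \<and> k = 0)"
proof -
  define m where "m = \<bar>2 * int j - 2 * int k - 1\<bar>"
  have "2 * int j - 2 * int k - 1 \<noteq> 0" by presburger
  then have m: "1 \<le> m" "m \<le> 2 * int n - 1" using n by (auto simp: m_def)
  have "(2 * real j - 2 * real k - 1) = real_of_int (2 * int j - 2 * int k - 1)" by simp
  then have "\<bar>2 * real j - 2 * real k - 1\<bar> = real_of_int m" by (simp only: m_def of_int_abs)
  then have "\<bar>(2 * real j - 2 * real k - 1) * pi / real n\<bar> = real_of_int m * pi / real n"
    by (simp add: abs_mult)
  then have h: "height n k (corner n j) = cos (real_of_int m * pi / real n)"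
    by (metis height_corner cos_abs_real)
  have lt: "cos (real_of_int m * pi / real n) < cos (pi / real n)" if "m \<noteq> 1" "m \<noteq> 2 * int n - 1"
  proof (rule cos_less_aux)
    have "1 < m" "m < 2 * int n - 1" using m that by auto
    then have "1 < real_of_int m" "real_of_int m < 2 * real n - 1" by linarith+
    then have "1 * pi < real_of_int m * pi" "real_of_int m * pi < (2 * real n - 1) * pi"
      by (intro mult_strict_right_mono; simp)+
    then show "pi / real n < real_of_int m * pi / real n"
        "real_of_int m * pi / real n < 2 * pi - pi / real n"
      using n by (simp_all add: field_simps)
  qed (use n in simp)
  have eq: "cos (real_of_int m * pi / real n) = cos (pi / real n)" if "m = 2 * int n - 1"
  proof -
    have "real_of_int m * pi / real n = 2 * pi - pi / real n"
      using n by (simp add: that field_simps)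
    then show ?thesis by (simp add: cos_diff)
  qed
  show "height n k (corner n j) \<le> cos (pi / real n)"
    unfolding h using lt eq by (cases "m = 1"; cases "m = 2 * int n - 1") auto
  assume "height n k (corner n j) = cos (pi / real n)"
  then have "m = 1 \<or> m = 2 * int n - 1" using lt h by force
  then show "j = k \<or> j = Suc k \<or> (j = 0 \<and> Suc k = n) \<or> (j = n \<and> k = 0)"
    using n unfolding m_def by linarith
qed

lemma side_meet_aux:
  assumes n: "n \<ge> 3" "k < n" "k' < n" and s: "s \<in> {0..1}" "s' \<in> {0..1}"
    and eq: "side n k s = side n k' s'" and ne: "k \<noteq> k'"
  shows "(s' = 0 \<and> k' = Suc k mod n) \<or> (s' = 1 \<and> k = Suc k' mod n)"
proof -
  let ?c = "cos (pi / real n)"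
  let ?A = "height n k (corner n k')" and ?B = "height n k (corner n (Suc k'))"
  have "height n k (corner n k) = cos (- (pi / real n))"
    "height n k (corner n (Suc k)) = ?c"
    unfolding height_corner by (simp_all del: cos_minus)
  then have "height n k (side n k s) = ?c"
    by (simp add: height_side algebra_simps)
  then have *: "(1 - s') * ?A + s' * ?B = ?c" by (simp add: eq height_side)
  have AB: "?A \<le> ?c" "?B \<le> ?c" using height_corner_less(1) n by auto
  \<comment> \<open>A convex combination of two numbers that are at most \<open>?c\<close> equals
    \<open>?c\<close> only if each of them with nonzero weight does.\<close>
  have "s' * (?c - ?B) = (1 - s') * (?A - ?c)" using * by (simp add: algebra_simps)
  moreover have "s' * (?c - ?B) \<ge> 0" "(1 - s') * (?A - ?c) \<le> 0"
    using s AB by (auto intro: mult_nonneg_nonpos)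
  ultimately have "s' * (?c - ?B) = 0" "(1 - s') * (?A - ?c) = 0" by linarith+
  then have A: "s' = 1 \<or> ?A = ?c" and B: "s' = 0 \<or> ?B = ?c" by auto
  have A': "k' = Suc k mod n" if "?A = ?c"
    using height_corner_less(2)[OF n(1) _ n(2) that] n ne by (auto simp: mod_Suc)
  have B': "k = Suc k' mod n" if "?B = ?c"
    using height_corner_less(2)[OF n(1) _ n(2) that] n ne by (auto simp: mod_Suc)
  \<comment> \<open>Two sides that follow each other in both directions would make a 2-gon, excluded
    by \<open>n \<ge> 3\<close>.\<close>
  have "\<not> (k' = Suc k mod n \<and> k = Suc k' mod n)"
    using n by (auto simp: mod_Suc split: if_splits)
  then show ?thesis using A B A' B' by auto
qed

lemma side_meet:
  assumes n: "n \<ge> 3" "k < n" "k' < n" and s: "s \<in> {0..1}" "s' \<in> {0..1}"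
    and eq: "side n k s = side n k' s'"
  shows "(k = k' \<and> s = s') \<or> (s = 1 \<and> s' = 0 \<and> k' = Suc k mod n) \<or>
    (s = 0 \<and> s' = 1 \<and> k = Suc k' mod n)"
proof (cases "k = k'")
  case True
  have "norm (cis (2 * pi / real n) - 1) \<noteq> 0"
  proof
    assume "norm (cis (2 * pi / real n) - 1) = 0"
    then have "Re (cis (2 * pi / real n)) = 1" by simp
    then show False using cos_less_one[OF n(1)] by simp
  qed
  moreover have "\<bar>s - s'\<bar> * norm (cis (2 * pi / real n) - 1) = 0"
    using dist_side[of n k s s'] eq True by simp
  ultimately show ?thesis using True by simp
next
  case False
  have "\<not> (k' = Suc k mod n \<and> k = Suc k' mod n)"
    using n by (auto simp: mod_Suc split: if_splits)
  \<comment> \<open>The auxiliary lemma determines only the second parameter; exchanging the sides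
    determines the first.\<close>
  then show ?thesis
    using side_meet_aux[OF n s eq False] side_meet_aux[OF n(1,3,2) s(2,1) eq[symmetric]] False by auto
qed

section \<open>Stars in polygonal complexes\<close>

text \<open>With the same number of sides for all polygons, all sides have the same length and the
  gluings are isometric. The bound \<open>n \<ge> 3\<close> keeps the polygons
  nondegenerate.\<close>

locale glued_polygons =
  fixes P :: "'p set" and W :: "'p \<Rightarrow> 'l word" and n :: nat
  assumes fin: "finite P" and n: "n \<ge> 3" and len: "p \<in> P \<Longrightarrow> length (W p) = n"
begin

abbreviation "Q \<equiv> polygons P W"
abbreviation "X \<equiv> polygonal_complex P W"
abbreviation "R \<equiv> gluing P W"
abbreviation "cl z \<equiv> gluing P W `` {z}"
abbreviation "lab p k \<equiv> fst (W p ! k)"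

text \<open>Parametrised in the direction of the label and not counterclockwise, so that points with
  equal parameters are the ones that are glued.\<close>

definition edge :: "'p \<Rightarrow> nat \<Rightarrow> real \<Rightarrow> complex" where
  "edge p k t = side n k (if snd (W p ! k) then t else 1 - t)"

lemma topspace_Q: "topspace Q = P \<times> ngon n"
  by (auto simp: polygons_def len)

lemma quotient_map_cl: "quotient_map Q X cl"
  unfolding polygonal_complex_def
  by (rule quotient_map_quotient_topology[OF equiv_gluing])

lemma topspace_X: "topspace X = (P \<times> ngon n) // R"
  using quotient_imp_surjective_map[OF quotient_map_cl]
  by (simp add: topspace_Q quotient_def UNION_singleton_eq_range)

lemma equiv_R: "equiv (P \<times> ngon n) R"
  using equiv_gluing[of P W] by (simp add: topspace_Q)

lemma cl_in: "p \<in> P \<Longrightarrow> w \<in> ngon n \<Longrightarrow> cl (p, w) \<in> topspace X"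
  by (auto simp: topspace_X intro: quotientI)

lemma cl_self: "p \<in> P \<Longrightarrow> w \<in> ngon n \<Longrightarrow> (p, w) \<in> cl (p, w)"
  using equiv_class_self[OF equiv_R] by blast

lemma point_cl: "x \<in> topspace X \<Longrightarrow> z \<in> x \<Longrightarrow> cl z = x"
  by (auto simp: topspace_X elim!: quotientE intro!: equiv_class_eq[OF equiv_R] symD[OF equiv_gluing[THEN equivE]]
      dest: equiv_class_eq[OF equiv_R])

lemma point_memb: "x \<in> topspace X \<Longrightarrow> (p, w) \<in> x \<Longrightarrow> p \<in> P \<and> w \<in> ngon n"
  using in_quotient_imp_subset[OF equiv_R] by (auto simp: topspace_X)

lemma pointE:
  assumes "x \<in> topspace X"
  obtains p w where "p \<in> P" "w \<in> ngon n" "x = cl (p, w)" "(p, w) \<in> x"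
  using assms cl_self by (auto simp: topspace_X elim!: quotientE)

lemma point_R: "x \<in> topspace X \<Longrightarrow> z \<in> x \<Longrightarrow> z' \<in> x \<Longrightarrow> (z, z') \<in> R"
  using quotient_eq_iff[OF equiv_R, of x x z z'] by (simp add: topspace_X)

lemma cl_eq: "(z, z') \<in> R \<Longrightarrow> cl z = cl z'"
  by (rule equiv_class_eq[OF equiv_R])

lemma edge_in_ngon: "k < n \<Longrightarrow> t \<in> {0..1} \<Longrightarrow> edge p k t \<in> ngon n"
  unfolding edge_def by (intro side_in_ngon) auto

lemma edge_affine: "edge p k s + of_real u * (edge p k t - edge p k s) = edge p k (s + u * (t - s))"
  by (simp add: edge_def side_rotate algebra_simps)

lemma dist_edge: "dist (edge p k s) (edge p k t) = dist (edge p' k' s) (edge p' k' t)"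
  by (simp add: edge_def dist_side abs_minus_commute)

lemma norm_edge: "norm (edge p k t) = norm (edge p' k' t)"
proof -
  have "(norm (edge p k t))\<^sup>2 = (norm (edge p' k' t))\<^sup>2"
    unfolding edge_def norm_side_square by (simp add: mult.commute)
  then show ?thesis by simp
qed

lemma labelled_edge_eq: "p \<in> P \<Longrightarrow> labelled_edge W p k t = (p, edge p k t)"
  by (simp add: labelled_edge_def edge_def len)

lemma glue_edge:
  assumes "p \<in> P" "p' \<in> P" "k < n" "k' < n" "lab p k = lab p' k'" "t \<in> {0..1}"
  shows "((p, edge p k t), (p', edge p' k' t)) \<in> R"
proof -
  have "(labelled_edge W p k t, labelled_edge W p' k' t) \<in> edge_identifications P W"
    using assms len unfolding edge_identifications_def by blast
  then show ?thesis
    using assms by (auto simp: gluing_def labelled_edge_eq topspace_Q edge_in_ngon)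
qed

lemma glue_induct [consumes 1, case_names base step]:
  assumes "(z, z') \<in> R" "I z"
    and step: "\<And>p k p' k' t. p \<in> P \<Longrightarrow> p' \<in> P \<Longrightarrow> k < n \<Longrightarrow> k' < n \<Longrightarrow> lab p k = lab p' k' \<Longrightarrow>
      t \<in> {0..1} \<Longrightarrow> I (p, edge p k t) \<Longrightarrow> I (p', edge p' k' t)"
  shows "I z'"
proof -
  have "(z, z') \<in> (edge_identifications P W)\<^sup>*" using assms(1) by (simp add: gluing_def)
  then show ?thesis
  proof induction
    case (step y z)
    from step.hyps(2) obtain p k p' k' t where "y = labelled_edge W p k t"
        "z = labelled_edge W p' k' t" "p \<in> P" "p' \<in> P" "k < length (W p)" "k' < length (W p')"
        "lab p k = lab p' k'" "t \<in> {0..1}"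
      unfolding edge_identifications_def by blast
    then show ?case
      using assms(3)[of p p' k k' t] step.IH by (simp add: labelled_edge_eq len)
  qed (rule assms(2))
qed

text \<open>Gluing preserves the norm, and each of the finitely many sides has at most two points of
  a given norm.\<close>

lemma finite_point:
  assumes "x \<in> topspace X"
  shows "finite x"
proof -
  obtain p0 w0 where x: "p0 \<in> P" "w0 \<in> ngon n" "x = cl (p0, w0)" "(p0, w0) \<in> x"
    using assms by (rule pointE)
  define B where "B = (\<Union>p\<in>P. \<Union>k<n. (\<lambda>t. (p, side n k t)) ` {t. norm (side n k t) = norm w0})"
  have "finite {t. norm (side n k t) = norm w0}" for k
  proof (cases "{t. norm (side n k t) = norm w0} = {}")
    case False
    then obtain s where "norm (side n k s) = norm w0" by blast
    then have "norm (side n k s) = norm (side n k t)" if "norm (side n k t) = norm w0" for t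
      using that by simp
    then have "{t. norm (side n k t) = norm w0} \<subseteq> {s, 1 - s}"
      using norm_side_eq[OF n] by blast
    then show ?thesis by (rule finite_subset) simp
  qed simp
  then have "finite B" unfolding B_def using fin by blast
  have "z \<in> insert (p0, w0) B \<and> norm (snd z) = norm w0" if "z \<in> x" for z
  proof -
    have "((p0, w0), z) \<in> R" using that x by simp
    then show ?thesis
    proof (induction rule: glue_induct)
      case (step p k p' k' t)
      then have "norm (edge p' k' t) = norm w0"
        using norm_edge[of p' k' t p k] by simp
      moreover have "(p', edge p' k' t) \<in> B"
        unfolding B_def
      proof (intro UN_I)
        show "(p', edge p' k' t) \<in> (\<lambda>t. (p', side n k' t)) ` {t. norm (side n k' t) = norm w0}"
          using calculation unfolding edge_def by (intro image_eqI[OF refl]) simp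
      qed (use step in auto)
      ultimately show ?case by simp
    qed simp
  qed
  then have "x \<subseteq> insert (p0, w0) B" by blast
  then show ?thesis using \<open>finite B\<close> finite_subset by blast
qed

text \<open>Both conditions hold for all small radii at each of finitely many representatives. By
  the first, a side that meets the ball about a representative contains its centre; by the second,
  the balls about different representatives in one polygon are disjoint.\<close>

lemma star_radius:
  assumes x: "x \<in> topspace X"
  shows "\<exists>\<delta>>0. (\<forall>p w k t. (p, w) \<in> x \<longrightarrow> k < n \<longrightarrow> t \<in> {0..1} \<longrightarrow> dist w (edge p k t) < \<delta> \<longrightarrow>
        (\<exists>s\<in>{0..1}. w = edge p k s)) \<and>
      (\<forall>p w w'. (p, w) \<in> x \<longrightarrow> (p, w') \<in> x \<longrightarrow> dist w w' < 2 * \<delta> \<longrightarrow> w = w')"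
proof -
  let ?P = "\<lambda>p w k \<delta>. \<forall>t\<in>{0..1}. dist w (edge p k t) < \<delta> \<longrightarrow> (\<exists>s\<in>{0..1}. w = edge p k s)"
  let ?Q = "\<lambda>z z' \<delta>. fst z = fst z' \<longrightarrow> dist (snd z) (snd z') < 2 * \<delta> \<longrightarrow> snd z = snd z'"
  have 1: "\<forall>\<^sub>F \<delta> in at_right 0. ?P p w k \<delta>" for p w k
  proof (cases "w \<in> edge p k ` {0..1}")
    case True
    then show ?thesis by (auto intro!: always_eventually)
  next
    case False
    have "continuous_on {0..1} (edge p k)"
      unfolding edge_def side_rotate by (cases "snd (W p ! k)") (auto intro!: continuous_intros)
    then have "closed (edge p k ` {0..1})"
      by (intro compact_imp_closed compact_continuous_image) auto
    from separate_point_closed[OF this False] obtain d where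
      "d > 0" "\<forall>y\<in>edge p k ` {0..1}. d \<le> dist w y" by blast
    then show ?thesis by (intro eventually_at_rightI[of 0 d]) force+
  qed
  have 2: "\<forall>\<^sub>F \<delta> in at_right 0. ?Q z z' \<delta>" for z z'
  proof (cases "snd z = snd z'")
    case False
    then show ?thesis
      by (intro eventually_at_rightI[of 0 "dist (snd z) (snd z') / 2"]) (auto simp: field_simps)
  qed auto
  have "\<forall>\<^sub>F \<delta> in at_right 0. \<forall>z\<in>x. \<forall>k\<in>{..<n}. ?P (fst z) (snd z) k \<delta>"
    by (intro eventually_ball_finite finite_point[OF x] ballI 1) auto
  moreover have "\<forall>\<^sub>F \<delta> in at_right 0. \<forall>z\<in>x. \<forall>z'\<in>x. ?Q z z' \<delta>"
    by (intro eventually_ball_finite finite_point[OF x] ballI 2)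
  moreover have "\<forall>\<^sub>F \<delta> in at_right 0. \<delta> > (0::real)"
    by (rule eventually_at_right_less)
  ultimately have "\<forall>\<^sub>F \<delta> in at_right 0. \<delta> > 0 \<and> (\<forall>z\<in>x. \<forall>k\<in>{..<n}. ?P (fst z) (snd z) k \<delta>) \<and>
      (\<forall>z\<in>x. \<forall>z'\<in>x. ?Q z z' \<delta>)"
    by eventually_elim blast
  then obtain \<delta> where "\<delta> > 0" "\<forall>z\<in>x. \<forall>k\<in>{..<n}. ?P (fst z) (snd z) k \<delta>"
      "\<forall>z\<in>x. \<forall>z'\<in>x. ?Q z z' \<delta>"
    using eventually_happens'[OF trivial_limit_at_right_real] by blast
  then show ?thesis by (intro exI[of _ \<delta>]) fastforce
qed

definition dl :: "('p \<times> complex) set \<Rightarrow> real" where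
  "dl x = (SOME \<delta>. \<delta> > 0 \<and>
      (\<forall>p w k t. (p, w) \<in> x \<longrightarrow> k < n \<longrightarrow> t \<in> {0..1} \<longrightarrow> dist w (edge p k t) < \<delta> \<longrightarrow>
        (\<exists>s\<in>{0..1}. w = edge p k s)) \<and>
      (\<forall>p w w'. (p, w) \<in> x \<longrightarrow> (p, w') \<in> x \<longrightarrow> dist w w' < 2 * \<delta> \<longrightarrow> w = w'))"

lemma
  assumes "x \<in> topspace X"
  shows dl_pos: "dl x > 0"
    and dl_edge: "(p, w) \<in> x \<Longrightarrow> k < n \<Longrightarrow> t \<in> {0..1} \<Longrightarrow> dist w (edge p k t) < dl x \<Longrightarrow>
      \<exists>s\<in>{0..1}. w = edge p k s"
    and dl_separated: "(p, w) \<in> x \<Longrightarrow> (p, w') \<in> x \<Longrightarrow> dist w w' < 2 * dl x \<Longrightarrow> w = w'"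
  using someI_ex[OF star_radius[OF assms]] unfolding dl_def[symmetric] by blast+

text \<open>Since the sides are glued isometrically, a gluing that moves a point \<open>v\<close> near a
  representative \<open>w\<close> of \<open>x\<close> moves \<open>w\<close> along; what only depends on the position of both points on
  a common side is preserved.\<close>

lemma star_chain:
  assumes x: "x \<in> topspace X" "(p, w) \<in> x" and v: "((p, v), (p', v')) \<in> R"
    and d: "dist w v < dl x" and I: "I p w v"
    and step: "\<And>p k p' k' s t. p \<in> P \<Longrightarrow> p' \<in> P \<Longrightarrow> k < n \<Longrightarrow> k' < n \<Longrightarrow> lab p k = lab p' k' \<Longrightarrow>
      s \<in> {0..1} \<Longrightarrow> t \<in> {0..1} \<Longrightarrow> I p (edge p k s) (edge p k t) \<Longrightarrow> I p' (edge p' k' s) (edge p' k' t)"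
  shows "\<exists>w'. (p', w') \<in> x \<and> dist w' v' = dist w v \<and> I p' w' v'"
proof -
  define J where "J = (\<lambda>z. \<exists>w'. (fst z, w') \<in> x \<and> dist w' (snd z) = dist w v \<and> I (fst z) w' (snd z))"
  have "J (p', v')"
    using v
  proof (induction rule: glue_induct)
    case base
    then show ?case using x I by (auto simp: J_def)
  next
    case (step p k p' k' t)
    then obtain w' where w': "(p, w') \<in> x" "dist w' (edge p k t) = dist w v" "I p w' (edge p k t)"
      by (auto simp: J_def)
    then obtain s where s: "s \<in> {0..1}" "w' = edge p k s"
      using dl_edge[OF x(1) w'(1) step(3,6)] d by auto
    have "((p, edge p k s), (p', edge p' k' s)) \<in> R"
      using step s by (intro glue_edge)
    then have "(p', edge p' k' s) \<in> x"
      using point_cl[OF x(1) w'(1)] s by auto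
    moreover have "dist (edge p' k' s) (edge p' k' t) = dist w v"
      using w'(2) s dist_edge by metis
    moreover have "I p' (edge p' k' s) (edge p' k' t)"
      using assms(6)[OF step(1-5) s(1) step(6)] w'(3) s(2) by simp
    ultimately show ?case by (auto simp: J_def)
  qed
  then show ?thesis by (simp add: J_def)
qed

text \<open>\<open>star_chain\<close> yields some representative of \<open>x\<close> near
  \<open>v'\<close>; separation of the representatives forces it to be the given
  \<open>w'\<close>.\<close>

lemma star_invariant:
  assumes x: "x \<in> topspace X" "(p, w) \<in> x" "(p', w') \<in> x" and v: "((p, v), (p', v')) \<in> R"
    and d: "dist w v < dl x" "dist w' v' < dl x" and I: "I p w v"
    and step: "\<And>p k p' k' s t. p \<in> P \<Longrightarrow> p' \<in> P \<Longrightarrow> k < n \<Longrightarrow> k' < n \<Longrightarrow> lab p k = lab p' k' \<Longrightarrow>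
      s \<in> {0..1} \<Longrightarrow> t \<in> {0..1} \<Longrightarrow> I p (edge p k s) (edge p k t) \<Longrightarrow> I p' (edge p' k' s) (edge p' k' t)"
  shows "I p' w' v'"
proof -
  obtain w'' where w'': "(p', w'') \<in> x" "dist w'' v' = dist w v" "I p' w'' v'"
    using star_chain[where I = I, OF x(1,2) v d(1) I] step by metis
  have "dist w' w'' < 2 * dl x"
    using dist_triangle[of w' w'' v'] w''(2) d by (simp add: dist_commute)
  then show ?thesis using dl_separated[OF x(1,3) w''(1)] w''(3) by simp
qed

section \<open>Open stars and their radial contraction\<close>

definition star :: "('p \<times> complex) set \<Rightarrow> real \<Rightarrow> ('p \<times> complex) set set" where
  "star x e = {y \<in> topspace X. \<exists>p w v. (p, w) \<in> x \<and> (p, v) \<in> y \<and> dist w v < e}"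

lemma star_self: "x \<in> topspace X \<Longrightarrow> e > 0 \<Longrightarrow> x \<in> star x e"
  unfolding star_def by (auto elim!: pointE) (metis cl_self dist_self)

text \<open>Membership in a star asks for one representative of \<open>y\<close> near
  \<open>x\<close>, but \<open>star_chain\<close> carries nearness over to all of them. Hence the
  preimage of a star is a union of balls in the polygons.\<close>

lemma star_near:
  assumes x: "x \<in> topspace X" and e: "e \<le> dl x" and y: "y \<in> star x e" "(p', v') \<in> y"
  obtains w' where "(p', w') \<in> x" "dist w' v' < e"
proof -
  obtain p w v where pwv: "(p, w) \<in> x" "(p, v) \<in> y" "dist w v < e" "y \<in> topspace X"
    using y(1) by (auto simp: star_def)
  have "((p, v), (p', v')) \<in> R" using point_R pwv(2,4) y(2) by blast
  then show thesis
    using star_chain[where I = "\<lambda>_ _ _. True", OF x pwv(1)] pwv(3) e that by fastforce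
qed

lemma openin_star:
  assumes x: "x \<in> topspace X" and e: "e \<le> dl x"
  shows "openin X (star x e)"
proof -
  have 1: "topspace Q \<inter> \<Union>(star x e) = {(p, v). p \<in> P \<and> v \<in> ngon n \<and> (\<exists>w. (p, w) \<in> x \<and> dist w v < e)}"
  proof (intro equalityI subsetI)
    fix z assume "z \<in> topspace Q \<inter> \<Union>(star x e)"
    then obtain y where y: "z \<in> topspace Q" "y \<in> star x e" "z \<in> y" by blast
    then obtain w where "(fst z, w) \<in> x" "dist w (snd z) < e"
      using star_near[OF x e y(2), of "fst z" "snd z"] by auto
    then show "z \<in> {(p, v). p \<in> P \<and> v \<in> ngon n \<and> (\<exists>w. (p, w) \<in> x \<and> dist w v < e)}"
      using y(1) by (auto simp: topspace_Q)
  next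
    fix z assume "z \<in> {(p, v). p \<in> P \<and> v \<in> ngon n \<and> (\<exists>w. (p, w) \<in> x \<and> dist w v < e)}"
    then obtain p v w where z: "z = (p, v)" "p \<in> P" "v \<in> ngon n" "(p, w) \<in> x" "dist w v < e"
      by blast
    then have "z \<in> topspace Q" "cl z \<in> star x e" "z \<in> cl z"
      using cl_in[OF z(2,3)] cl_self[OF z(2,3)] unfolding topspace_Q star_def by blast+
    then show "z \<in> topspace Q \<inter> \<Union>(star x e)" by blast
  qed
  have "openin Q {(p, v). p \<in> P \<and> v \<in> ngon n \<and> (\<exists>w. (p, w) \<in> x \<and> dist w v < e)}"
    unfolding polygons_def openin_sum_topology
  proof (intro conjI ballI)
    fix p assume p: "p \<in> P"
    have "{v. (p, v) \<in> {(p, v). p \<in> P \<and> v \<in> ngon n \<and> (\<exists>w. (p, w) \<in> x \<and> dist w v < e)}}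
        = ngon n \<inter> (\<Union>w\<in>{w. (p, w) \<in> x}. ball w e)"
      using p by auto
    also have "openin (top_of_set (ngon n)) \<dots>" by (intro openin_open_Int) auto
    finally show "openin (top_of_set (ngon (length (W p))))
      {v. (p, v) \<in> {(p, v). p \<in> P \<and> v \<in> ngon n \<and> (\<exists>w. (p, w) \<in> x \<and> dist w v < e)}}"
      using p by (simp add: len)
  qed (auto simp: len)
  then have "openin Q (topspace Q \<inter> \<Union>(star x e))" by (simp only: 1)
  moreover have "star x e \<subseteq> topspace Q // R" by (auto simp: star_def topspace_X topspace_Q)
  ultimately show ?thesis
    unfolding polygonal_complex_def openin_quotient_topology[OF equiv_gluing] by blast
qed

lemma continuous_map_polygon:
  assumes "p \<in> P"
  shows "continuous_map (top_of_set (ngon n)) X (\<lambda>w. cl (p, w))"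
proof -
  have "continuous_map (top_of_set (ngon (length (W p)))) Q (\<lambda>w. (p, w))"
    unfolding polygons_def by (rule continuous_map_component_injection[OF assms])
  from continuous_map_compose[OF this quotient_imp_continuous_map[OF quotient_map_cl]]
  show ?thesis by (simp add: o_def len[OF assms])
qed

text \<open>Each representative of \<open>x\<close> allows all small radii, and as there are
  finitely many of them a common radius exists.\<close>

lemma star_nbhd:
  assumes V: "openin X V" "x \<in> V"
  obtains e where "e > 0" "e \<le> dl x" "star x e \<subseteq> V"
proof -
  have x: "x \<in> topspace X" using V openin_subset by blast
  have "\<forall>\<^sub>F e in at_right 0. \<forall>v\<in>ngon n. dist (snd z) v < e \<longrightarrow> cl (fst z, v) \<in> V" if z: "z \<in> x" for z
  proof -
    obtain p w where pw: "z = (p, w)" "p \<in> P" "w \<in> ngon n" "cl (p, w) = x"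
      using point_memb[OF x] point_cl[OF x] z by (cases z) auto
    have "openin (top_of_set (ngon n)) {v \<in> ngon n. cl (p, v) \<in> V}"
      using openin_continuous_map_preimage[OF continuous_map_polygon[OF pw(2)] V(1)] by simp
    then obtain e where "e > 0" "\<forall>v\<in>ngon n. dist v w < e \<longrightarrow> v \<in> {v \<in> ngon n. cl (p, v) \<in> V}"
      using pw V(2) unfolding openin_euclidean_subtopology_iff by blast
    then show ?thesis
      by (intro eventually_at_rightI[of 0 e]) (auto simp: pw dist_commute)
  qed
  then have "\<forall>\<^sub>F e in at_right 0. \<forall>z\<in>x. \<forall>v\<in>ngon n. dist (snd z) v < e \<longrightarrow> cl (fst z, v) \<in> V"
    by (intro eventually_ball_finite finite_point[OF x]) blast
  moreover have "\<forall>\<^sub>F e in at_right 0. 0 < e \<and> e < dl x"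
    using dl_pos[OF x] by (intro eventually_at_rightI[of 0 "dl x"]) auto
  ultimately have "\<forall>\<^sub>F e in at_right 0. (0 < e \<and> e < dl x) \<and>
      (\<forall>z\<in>x. \<forall>v\<in>ngon n. dist (snd z) v < e \<longrightarrow> cl (fst z, v) \<in> V)"
    by eventually_elim blast
  then obtain e where e: "0 < e" "e < dl x"
      "\<forall>z\<in>x. \<forall>v\<in>ngon n. dist (snd z) v < e \<longrightarrow> cl (fst z, v) \<in> V"
    using eventually_happens'[OF trivial_limit_at_right_real] by blast
  have "star x e \<subseteq> V"
  proof
    fix y assume "y \<in> star x e"
    then obtain p w v where pwv: "(p, w) \<in> x" "(p, v) \<in> y" "dist w v < e" "y \<in> topspace X"
      by (auto simp: star_def)
    then have "cl (p, v) = y" "v \<in> ngon n" using point_cl[OF pwv(4,2)] point_memb by auto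
    then show "y \<in> V" using e(3) pwv by force
  qed
  with e that show thesis by simp
qed

lemma continuous_map_star:
  assumes f: "\<And>s. s \<in> S \<Longrightarrow> f s \<in> topspace X"
    and c: "\<And>s e. s \<in> S \<Longrightarrow> e > 0 \<Longrightarrow> \<exists>r>0. \<forall>u\<in>S. dist s u < r \<longrightarrow> f u \<in> star (f s) e"
  shows "continuous_map (top_of_set S) X f"
  unfolding continuous_map
proof (intro conjI allI impI)
  fix V assume V: "openin X V"
  show "openin (top_of_set S) {s \<in> topspace (top_of_set S). f s \<in> V}"
    unfolding openin_euclidean_subtopology_iff
  proof (intro conjI ballI)
    fix s assume "s \<in> {s \<in> topspace (top_of_set S). f s \<in> V}"
    then have s: "s \<in> S" "f s \<in> V" by auto
    obtain e where e: "e > 0" "star (f s) e \<subseteq> V" using star_nbhd[OF V s(2)] by blast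
    obtain r where "r > 0" "\<forall>u\<in>S. dist s u < r \<longrightarrow> f u \<in> star (f s) e" using c[OF s(1) e(1)] by blast
    then show "\<exists>r>0. \<forall>u\<in>S. dist u s < r \<longrightarrow> u \<in> {s \<in> topspace (top_of_set S). f s \<in> V}"
      using e(2) by (intro exI[of _ r]) (auto simp: dist_commute)
  qed auto
qed (use f in auto)

text \<open>The value is the centre \<open>x\<close> at \<open>u = 0\<close> and the point
  \<open>y\<close> at \<open>u = 1\<close>; that the choice of representatives does not matter is
  \<open>radial_eq\<close>.\<close>

definition radial :: "('p \<times> complex) set \<Rightarrow> real \<Rightarrow> ('p \<times> complex) set \<Rightarrow> ('p \<times> complex) set" where
  "radial x u y = (SOME z. \<exists>p w v. (p, w) \<in> x \<and> (p, v) \<in> y \<and> dist w v < dl x \<and>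
     z = cl (p, w + of_real u * (v - w)))"

text \<open>Sides are glued by maps that are affine in the parameter, so scaling towards a centre on
  the same side commutes with gluing.\<close>

lemma radial_eq:
  assumes x: "x \<in> topspace X" "(p, w) \<in> x" and y: "y \<in> topspace X" "(p, v) \<in> y"
    and d: "dist w v < dl x" and u: "u \<in> {0..1}"
  shows "radial x u y = cl (p, w + of_real u * (v - w))"
  unfolding radial_def
proof (rule some_equality)
  fix z assume "\<exists>p w v. (p, w) \<in> x \<and> (p, v) \<in> y \<and> dist w v < dl x \<and>
     z = cl (p, w + of_real u * (v - w))"
  then obtain p' w' v' where *: "(p', w') \<in> x" "(p', v') \<in> y" "dist w' v' < dl x"
     "z = cl (p', w' + of_real u * (v' - w'))" by blast
  have "((p, v), (p', v')) \<in> R" using point_R y *(2) by blast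
  then have "cl (p', w' + of_real u * (v' - w')) = cl (p, w + of_real u * (v - w))"
  proof (rule star_invariant[OF x *(1) _ d *(3)])
    fix p1 k p2 k' s t
    assume a: "p1 \<in> P" "p2 \<in> P" "k < n" "k' < n" "lab p1 k = lab p2 k'" "s \<in> {0..1}" "t \<in> {0..1::real}"
      and b: "cl (p1, edge p1 k s + of_real u * (edge p1 k t - edge p1 k s)) = cl (p, w + of_real u * (v - w))"
    have "s + u * (t - s) \<in> {0..1}"
      using a(6,7) u convexD_alt[of "{0..1::real}" s t u] by (simp add: algebra_simps)
    then have "((p1, edge p1 k (s + u * (t - s))), (p2, edge p2 k' (s + u * (t - s)))) \<in> R"
      using a by (intro glue_edge)
    then show "cl (p2, edge p2 k' s + of_real u * (edge p2 k' t - edge p2 k' s)) = cl (p, w + of_real u * (v - w))"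
      using b by (simp add: edge_affine cl_eq)
  qed simp
  then show "z = cl (p, w + of_real u * (v - w))" using * by simp
qed (use assms in blast)

lemma continuous_radial:
  fixes T :: "real set"
  assumes x: "x \<in> topspace X" and q: "continuous_map (top_of_set T) X q"
    and qT: "\<And>t. t \<in> T \<Longrightarrow> q t \<in> star x (dl x)"
  shows "continuous_map (top_of_set ({0..1} \<times> T)) X (\<lambda>(u, t). radial x u (q t))"
proof (rule continuous_map_star)
  have segment: "w + of_real u * (v - w) \<in> ngon n" if "w \<in> ngon n" "v \<in> ngon n" "u \<in> {0..1}" for w v u
    using convexD_alt[OF convex_ngon that(1,2), of u] that(3)
    by (simp add: scaleR_conv_of_real algebra_simps)
  have near: "radial x u y \<in> topspace X" if y: "y \<in> star x (dl x)" and u: "u \<in> {0..1}" for u y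
  proof -
    obtain p w v where pwv: "(p, w) \<in> x" "(p, v) \<in> y" "dist w v < dl x" "y \<in> topspace X"
      using y by (auto simp: star_def)
    then show ?thesis
      using radial_eq[OF x pwv(1,4,2,3) u] segment point_memb[OF x pwv(1)] point_memb[OF pwv(4,2)]
        u by (auto intro!: cl_in)
  qed
  show "(case s of (u, t) \<Rightarrow> radial x u (q t)) \<in> topspace X" if "s \<in> {0..1} \<times> T" for s
    using that qT near by auto
  fix s :: "real \<times> real" and e :: real assume s: "s \<in> {0..1} \<times> T" and e: "e > 0"
  obtain u0 t0 where s_eq: "s = (u0, t0)" and u0: "u0 \<in> {0..1}" and t0: "t0 \<in> T"
    using s by (cases s) auto
  let ?y = "q t0"
  have y: "?y \<in> topspace X" "?y \<in> star x (dl x)" using qT[OF t0] by (auto simp: star_def)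
  obtain p w v where pwv: "(p, w) \<in> x" "(p, v) \<in> ?y" "dist w v < dl x"
    using y(2) by (auto simp: star_def)
  \<comment> \<open>This radius keeps nearby points in the star of \<open>x\<close> and in an open
    star of \<open>q t0\<close>, and leaves half of \<open>e\<close> for the change of
    \<open>u\<close>.\<close>
  define e1 where "e1 = min (e / 2) (min (dl x - dist w v) (dl ?y))"
  have e1: "e1 > 0" "e1 \<le> e / 2" "e1 \<le> dl x - dist w v" "e1 \<le> dl ?y"
    using e pwv(3) dl_pos[OF y(1)] unfolding e1_def by linarith+
  have "openin (top_of_set T) {t \<in> T. q t \<in> star ?y e1}"
    using openin_continuous_map_preimage[OF q openin_star[OF y(1) e1(4)]] by simp
  moreover have "t0 \<in> {t \<in> T. q t \<in> star ?y e1}" using t0 star_self[OF y(1) e1(1)] by simp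
  ultimately obtain r where r: "r > 0" "\<forall>t\<in>T. dist t t0 < r \<longrightarrow> q t \<in> star ?y e1"
    unfolding openin_euclidean_subtopology_iff by blast
  show "\<exists>r>0. \<forall>s'\<in>{0..1} \<times> T. dist s s' < r \<longrightarrow>
      (case s' of (u, t) \<Rightarrow> radial x u (q t)) \<in> star (case s of (u, t) \<Rightarrow> radial x u (q t)) e"
  proof (intro exI[of _ "min r (e / (2 * dl x))"] conjI ballI impI)
    show "0 < min r (e / (2 * dl x))" using r(1) e dl_pos[OF x] by simp
    fix s' assume s': "s' \<in> {0..1} \<times> T" "dist s s' < min r (e / (2 * dl x))"
    obtain u t where s'_eq: "s' = (u, t)" and u: "u \<in> {0..1}" and t: "t \<in> T"
      using s' by (cases s') auto
    have du: "dist u0 u < e / (2 * dl x)" and dt: "dist t0 t < r"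
      using s'(2) dist_fst_le[of s s'] dist_snd_le[of s s'] by (auto simp: s_eq s'_eq)
    have "q t \<in> star ?y e1" using r(2) t dt by (simp add: dist_commute)
    then obtain p' v0 v' where v': "(p', v0) \<in> ?y" "(p', v') \<in> q t" "dist v0 v' < e1" "q t \<in> topspace X"
      by (auto simp: star_def)
    \<comment> \<open>Closeness of \<open>q t\<close> to \<open>q t0\<close> may be visible only in
      a polygon \<open>p'\<close> other than \<open>p\<close>, so the representative of the centre
      is carried over to \<open>p'\<close>.\<close>
    obtain w' where w': "(p', w') \<in> x" "dist w' v0 = dist w v"
      using star_chain[where I = "\<lambda>_ _ _. True", OF x pwv(1) point_R[OF y(1) pwv(2) v'(1)] pwv(3)] by auto
    have d: "dist w' v0 < dl x" "dist w' v' < dl x"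
      using w'(2) pwv(3) v'(3) e1(3) dist_triangle[of w' v' v0] by auto
    define a where "a = w' + of_real u0 * (v0 - w')"
    define b where "b = w' + of_real u * (v' - w')"
    have ab: "radial x u0 ?y = cl (p', a)" "radial x u (q t) = cl (p', b)"
      unfolding a_def b_def by (rule radial_eq[OF x w'(1)]; use y v' d u0 u in simp)+
    have ngon: "p' \<in> P" "a \<in> ngon n" "b \<in> ngon n"
      unfolding a_def b_def using point_memb[OF x w'(1)] point_memb[OF y(1) v'(1)]
        point_memb[OF v'(4,2)] segment u0 u by auto
    have "a - b = of_real (u0 - u) * (v' - w') + of_real u0 * (v0 - v')"
      by (simp add: a_def b_def algebra_simps)
    then have "norm (a - b) \<le> norm (of_real (u0 - u) * (v' - w')) + norm (of_real u0 * (v0 - v'))"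
      using norm_triangle_ineq by metis
    also have "\<dots> = dist u0 u * dist w' v' + u0 * dist v0 v'"
      using u0 by (simp add: norm_mult dist_norm norm_minus_commute del: of_real_diff)
    also have "\<dots> \<le> dist u0 u * dl x + 1 * dist v0 v'"
      using u0 d(2) by (intro add_mono mult_mono) auto
    also have "\<dots> < e / (2 * dl x) * dl x + e1"
      using du v'(3) dl_pos[OF x] by (intro add_strict_mono mult_strict_right_mono) auto
    also have "\<dots> \<le> e" using dl_pos[OF x] e1(2) by simp
    finally have "dist a b < e" by (simp add: dist_norm)
    then have "cl (p', b) \<in> star (cl (p', a)) e"
      unfolding star_def using ngon cl_self cl_in by blast
    then show "(case s' of (u, t) \<Rightarrow> radial x u (q t)) \<in> star (case s of (u, t) \<Rightarrow> radial x u (q t)) e"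
      by (simp add: s_eq s'_eq ab)
  qed
qed

end

section \<open>The local system of a labelling by group elements\<close>

lemma eval_word_Nil [simp]: "eval_word K f [] = \<one>\<^bsub>K\<^esub>"
  by (simp add: eval_word_def)

context glued_polygons begin

definition labels :: "'l set" where
  "labels = (\<Union>p\<in>P. fst ` set (W p))"

definition initial :: "'p \<Rightarrow> nat \<Rightarrow> nat" where
  "initial p k = (if snd (W p ! k) then k else Suc k)"

definition terminal :: "'p \<Rightarrow> nat \<Rightarrow> nat" where
  "terminal p k = (if snd (W p ! k) then Suc k else k)"

lemma lab_in_labels: "p \<in> P \<Longrightarrow> k < n \<Longrightarrow> lab p k \<in> labels"
  unfolding labels_def using len by force

lemma labelsE:
  assumes "l \<in> labels"
  obtains p k where "p \<in> P" "k < n" "l = lab p k"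
  using assms unfolding labels_def by (fastforce simp: in_set_conv_nth len)

lemma W_words: "p \<in> P \<Longrightarrow> W p \<in> words labels"
  by (force simp: words_def labels_def mem_Times_iff)

lemma take_words: "p \<in> P \<Longrightarrow> take k (W p) \<in> words labels"
  using W_words[of p] by (auto simp: words_def dest: in_set_takeD)

lemma initial_le: "k < n \<Longrightarrow> initial p k \<le> n" and terminal_le: "k < n \<Longrightarrow> terminal p k \<le> n"
  by (simp_all add: initial_def terminal_def)

lemma edge_ends: "edge p k 0 = corner n (initial p k)" "edge p k 1 = corner n (terminal p k)"
  by (simp_all add: edge_def initial_def terminal_def)

lemma take_Suc_W: "p \<in> P \<Longrightarrow> k < n \<Longrightarrow> take (Suc k) (W p) = take k (W p) @ [(lab p k, snd (W p ! k))]"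
  by (simp add: take_Suc_conv_app_nth len)

end

locale polygon_local_system = glued_polygons P W n + group K
  for P :: "'p set" and W :: "'p \<Rightarrow> 'l word" and n and K (structure) +
  fixes f :: "'l \<Rightarrow> 'a"
  assumes f_closed: "l \<in> labels \<Longrightarrow> f l \<in> carrier K"
    and relator: "p \<in> P \<Longrightarrow> eval_word K f (W p) = \<one>"
begin

text \<open>In the trivialisation of the polygon \<open>p\<close> this is the transport along its
  boundary from corner 0 to corner \<open>k\<close>; \<open>relator\<close> makes it close up at
  \<open>k = n\<close>.\<close>

definition pre :: "'p \<Rightarrow> nat \<Rightarrow> 'a" where
  "pre p k = eval_word K f (take k (W p))"

lemma pre_closed [simp]: "p \<in> P \<Longrightarrow> pre p k \<in> carrier K"
  unfolding pre_def by (rule eval_word_closed[OF is_group f_closed take_words])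

lemma pre_0 [simp]: "pre p 0 = \<one>" and pre_n [simp]: "p \<in> P \<Longrightarrow> pre p n = \<one>"
  by (simp_all add: pre_def relator len)

lemma f_lab [simp]: "p \<in> P \<Longrightarrow> k < n \<Longrightarrow> f (lab p k) \<in> carrier K"
  using f_closed lab_in_labels by blast

lemma pre_Suc:
  assumes "p \<in> P" "k < n"
  shows "pre p (Suc k) = pre p k \<otimes> (if snd (W p ! k) then f (lab p k) else inv f (lab p k))"
proof -
  have w: "[(lab p k, snd (W p ! k))] \<in> words labels" using assms lab_in_labels by simp
  have "pre p (Suc k) = pre p k \<otimes> eval_word K f [(lab p k, snd (W p ! k))]"
    unfolding pre_def take_Suc_W[OF assms]
    by (rule eval_word_append[OF is_group f_closed take_words[OF assms(1)] w])
  then show ?thesis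
    using f_lab[OF assms] by (cases "W p ! k") (simp add: eval_word_def)
qed

lemma pre_terminal:
  "p \<in> P \<Longrightarrow> k < n \<Longrightarrow> pre p (terminal p k) = pre p (initial p k) \<otimes> f (lab p k)"
  using pre_Suc[of p k] by (auto simp: terminal_def initial_def m_assoc)

text \<open>The total space of the local system is glued from the \<open>P \<times> K\<close>. Over a vertex and
  over the interior of an edge it is trivialised by the fibre over the initial point of the edge;
  \<open>frame p w\<close> compares this trivialisation with that of the polygon \<open>p\<close>, which is normalised at
  corner \<open>0\<close>.\<close>

definition edge_frame :: "'p \<Rightarrow> nat \<Rightarrow> real \<Rightarrow> 'a" where
  "edge_frame p k t = pre p (initial p k) \<otimes> (if t = 1 then f (lab p k) else \<one>)"

definition frame :: "'p \<Rightarrow> complex \<Rightarrow> 'a" where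
  "frame p w = (if \<exists>k<n. \<exists>t\<in>{0..1}. w = edge p k t
     then SOME z. \<exists>k<n. \<exists>t\<in>{0..1}. w = edge p k t \<and> z = edge_frame p k t else \<one>)"

lemma edge_frame_closed: "p \<in> P \<Longrightarrow> k < n \<Longrightarrow> edge_frame p k t \<in> carrier K"
  by (simp add: edge_frame_def)

text \<open>Only at a corner can two sides compete, and there both give the value of
  \<open>pre\<close> at that corner.\<close>

lemma edge_frame_unique:
  assumes p: "p \<in> P" "k < n" "k' < n" and t: "t \<in> {0..1}" "t' \<in> {0..1}"
    and eq: "edge p k t = edge p k' t'"
  shows "edge_frame p k t = edge_frame p k' t'"
proof -
  \<comment> \<open>\<open>s\<close> turns the parameter along the label into the counterclockwise
    parameter of the side.\<close>
  define s where "s = (\<lambda>k (t::real). if snd (W p ! k) then t else 1 - t)"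
  have at0: "edge_frame p k t = pre p k" if "s k t = 0" "k < n" for k t
    using that p(1) pre_terminal[OF p(1) that(2)]
    by (auto simp: s_def edge_frame_def initial_def terminal_def split: if_splits)
  have at1: "edge_frame p k t = pre p (Suc k)" if "s k t = 1" "k < n" for k t
    using that p(1) pre_terminal[OF p(1) that(2)]
    by (auto simp: s_def edge_frame_def initial_def terminal_def split: if_splits)
  \<comment> \<open>At the last side this uses the relator of the polygon: \<open>pre p n\<close>
    equals \<open>pre p 0\<close>.\<close>
  have pre_mod: "pre p (Suc k mod n) = pre p (Suc k)" if "k < n" for k
    using that p(1) by (auto simp: mod_Suc)
  have "side n k (s k t) = side n k' (s k' t')" "s k t \<in> {0..1}" "s k' t' \<in> {0..1}"
    using eq t by (auto simp: edge_def s_def)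
  from side_meet[OF n p(2,3) this(2,3,1)] show ?thesis
  proof (elim disjE conjE)
    assume "k = k'" "s k t = s k' t'"
    then show ?thesis by (auto simp: s_def split: if_splits)
  next
    assume "s k t = 1" "s k' t' = 0" "k' = Suc k mod n"
    then show ?thesis using at0[of k' t'] at1[of k t] pre_mod[of k] p by simp
  next
    assume "s k t = 0" "s k' t' = 1" "k = Suc k' mod n"
    then show ?thesis using at0[of k t] at1[of k' t'] pre_mod[of k'] p by simp
  qed
qed

lemma frame_edge:
  assumes "p \<in> P" "k < n" "t \<in> {0..1}"
  shows "frame p (edge p k t) = edge_frame p k t"
proof -
  have *: "(SOME z. \<exists>k'<n. \<exists>t'\<in>{0..1}. edge p k t = edge p k' t' \<and> z = edge_frame p k' t') = edge_frame p k t"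
  proof (rule some_equality)
    fix z assume "\<exists>k'<n. \<exists>t'\<in>{0..1}. edge p k t = edge p k' t' \<and> z = edge_frame p k' t'"
    then obtain k' t' where "k' < n" "t' \<in> {0..1}" "edge p k t = edge p k' t'" "z = edge_frame p k' t'"
      by blast
    then show "z = edge_frame p k t"
      using edge_frame_unique[OF assms(1,2) _ assms(3), of k' t'] by simp
  qed (use assms in blast)
  show ?thesis
    unfolding frame_def by (subst if_P, use assms in blast, rule *)
qed

lemma frame_closed [simp]: "p \<in> P \<Longrightarrow> frame p w \<in> carrier K"
  using frame_edge[of p] edge_frame_closed[of p]
  by (cases "\<exists>k<n. \<exists>t\<in>{0..1}. w = edge p k t") (auto, auto simp: frame_def)

lemma frame_corner:
  assumes p: "p \<in> P" "k \<le> n"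
  shows "frame p (corner n k) = pre p k"
proof -
  have "frame p (corner n k) = pre p k" if k: "k < n" for k
  proof (cases "snd (W p ! k)")
    case True
    then have "frame p (edge p k 0) = pre p k"
      using p k by (subst frame_edge) (auto simp: edge_frame_def initial_def)
    then show ?thesis using True by (simp add: edge_def)
  next
    case False
    then have "frame p (edge p k 1) = pre p k"
      using p k pre_terminal[of p k]
      by (subst frame_edge) (auto simp: edge_frame_def initial_def terminal_def)
    then show ?thesis using False by (simp add: edge_def)
  qed
  from this[of k] this[of 0] show ?thesis
    using p n corner_wrap[of n] by (cases "k = n") auto
qed

section \<open>Parallel transport between nearby points\<close>

definition transition :: "('p \<times> complex) set \<Rightarrow> ('p \<times> complex) set \<Rightarrow> 'a" where
  "transition x y = (SOME z. \<exists>p w v. (p, w) \<in> x \<and> (p, v) \<in> y \<and> dist w v < dl x \<and>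
     z = inv frame p w \<otimes> frame p v)"

text \<open>Along a side the factor \<open>pre\<close> cancels from the quotient of the two frames.
  What remains depends only on the label and the parameters, which gluing preserves.\<close>

lemma transition_eq:
  assumes x: "x \<in> topspace X" "(p, w) \<in> x" and y: "y \<in> topspace X" "(p, v) \<in> y"
    and d: "dist w v < dl x"
  shows "transition x y = inv frame p w \<otimes> frame p v"
  unfolding transition_def
proof (rule some_equality)
  fix z assume "\<exists>p w v. (p, w) \<in> x \<and> (p, v) \<in> y \<and> dist w v < dl x \<and>
     z = inv frame p w \<otimes> frame p v"
  then obtain p' w' v' where *: "(p', w') \<in> x" "(p', v') \<in> y" "dist w' v' < dl x"
     "z = inv frame p' w' \<otimes> frame p' v'" by blast
  have "((p, v), (p', v')) \<in> R" using point_R y *(2) by blast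
  then have "inv frame p' w' \<otimes> frame p' v' = inv frame p w \<otimes> frame p v"
  proof (rule star_invariant[OF x *(1) _ d *(3)])
    fix p1 k p2 k' s t
    assume a: "p1 \<in> P" "p2 \<in> P" "k < n" "k' < n" "lab p1 k = lab p2 k'" "s \<in> {0..1}" "t \<in> {0..1::real}"
      and b: "inv frame p1 (edge p1 k s) \<otimes> frame p1 (edge p1 k t) = inv frame p w \<otimes> frame p v"
    have *: "inv edge_frame p k s \<otimes> edge_frame p k t
        = inv (if s = 1 then f (lab p k) else \<one>) \<otimes> (if t = 1 then f (lab p k) else \<one>)"
      if "p \<in> P" "k < n" for p k
      using that by (auto simp: edge_frame_def inv_mult_group m_assoc)
    show "inv frame p2 (edge p2 k' s) \<otimes> frame p2 (edge p2 k' t) = inv frame p w \<otimes> frame p v"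
      using b unfolding frame_edge[OF a(1,3,6)] frame_edge[OF a(1,3,7)] frame_edge[OF a(2,4,6)]
        frame_edge[OF a(2,4,7)] *[OF a(1,3)] *[OF a(2,4)] a(5) .
  qed simp
  then show "z = inv frame p w \<otimes> frame p v" using * by simp
qed (use assms in blast)

lemma transition_local:
  assumes x: "x \<in> topspace X" and y: "y \<in> star x (dl x)"
  shows "\<exists>V. openin X V \<and> y \<in> V \<and> V \<subseteq> star y (dl y) \<and>
    (\<forall>z\<in>V. transition x z = transition x y \<otimes> transition y z)"
proof -
  obtain p w v where pwv: "(p, w) \<in> x" "(p, v) \<in> y" "dist w v < dl x" "y \<in> topspace X"
    using y by (auto simp: star_def)
  define e where "e = min (dl y) (dl x - dist w v)"
  have e: "e > 0" "e \<le> dl y" "e \<le> dl x - dist w v"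
    using dl_pos[OF pwv(4)] pwv(3) unfolding e_def by linarith+
  have "transition x z = transition x y \<otimes> transition y z" if z: "z \<in> star y e" for z
  proof -
    obtain p' v' z' where z': "(p', v') \<in> y" "(p', z') \<in> z" "dist v' z' < e" "z \<in> topspace X"
      using z by (auto simp: star_def)
    obtain w' where w': "(p', w') \<in> x" "dist w' v' = dist w v"
      using star_chain[where I = "\<lambda>_ _ _. True", OF x pwv(1) point_R[OF pwv(4,2) z'(1)] pwv(3)] by auto
    have "dist w' z' < dl x" using w'(2) z'(3) e(3) dist_triangle[of w' z' v'] by linarith
    then have "transition x z = inv frame p' w' \<otimes> frame p' z'"
      by (rule transition_eq[OF x w'(1) z'(4,2)])
    moreover have "transition x y = inv frame p' w' \<otimes> frame p' v'"
      by (rule transition_eq[OF x w'(1) pwv(4) z'(1)]) (use w' pwv in simp)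
    moreover have "transition y z = inv frame p' v' \<otimes> frame p' z'"
      by (rule transition_eq[OF pwv(4) z'(1) z'(4,2)]) (use z' e in simp)
    moreover have "p' \<in> P" using point_memb[OF x w'(1)] by simp
    ultimately show ?thesis by (simp add: inv_quotient_mult)
  qed
  moreover have "star y e \<subseteq> star y (dl y)" using e(2) by (force simp: star_def)
  ultimately show ?thesis
    using openin_star[OF pwv(4) e(2)] star_self[OF pwv(4) e(1)] by blast
qed

sublocale local_system K X "\<lambda>x. star x (dl x)" transition
proof
  fix x assume x: "x \<in> topspace X"
  show "openin X (star x (dl x))" by (rule openin_star[OF x order_refl])
  show "x \<in> star x (dl x)" by (rule star_self[OF x dl_pos[OF x]])
  obtain p w where pw: "p \<in> P" "(p, w) \<in> x" using pointE[OF x] by blast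
  show "transition x x = \<one>"
    using transition_eq[OF x pw(2) x pw(2)] dl_pos[OF x] pw(1) by simp
  fix y assume y: "y \<in> star x (dl x)"
  then obtain p w v where pwv: "(p, w) \<in> x" "(p, v) \<in> y" "dist w v < dl x" "y \<in> topspace X"
    by (auto simp: star_def)
  then show "transition x y \<in> carrier K"
    using transition_eq[OF x pwv(1,4,2,3)] point_memb[OF x pwv(1)] by simp
  show "\<exists>V. openin X V \<and> y \<in> V \<and> V \<subseteq> star y (dl y) \<and>
      (\<forall>v\<in>V. transition x v = transition x y \<otimes> transition y v)"
    by (rule transition_local[OF x y])
qed

text \<open>Over a path inside one polygon, \<open>frame p\<close> is itself a lift: its jumps at
  the sides are exactly those recorded by \<open>transition\<close>.\<close>

lemma hol_polygon:
  assumes p: "p \<in> P" and u: "continuous_on {0..1} u" "u \<in> {0..1} \<rightarrow> ngon n"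
  shows "hol (\<lambda>t. cl (p, u t)) = inv frame p (u 0) \<otimes> frame p (u 1)"
proof (rule hol_eq)
  have "continuous_map (top_of_set {0..1}) X ((\<lambda>w. cl (p, w)) \<circ> u)"
    by (rule continuous_map_compose[OF _ continuous_map_polygon[OF p]]) (use u in \<open>auto simp: Pi_iff\<close>)
  then show "pathin X (\<lambda>t. cl (p, u t))" by (simp add: pathin_def o_def)
  show "is_lift {0..1} (\<lambda>t. cl (p, u t)) (\<lambda>t. frame p (u t))"
    unfolding is_lift_def
  proof (intro ballI conjI)
    fix s :: real assume s: "s \<in> {0..1}"
    let ?x = "cl (p, u s)"
    have us: "u s \<in> ngon n" using u s by auto
    have x: "?x \<in> topspace X" "(p, u s) \<in> ?x" using cl_in[OF p us] cl_self[OF p us] by auto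
    obtain r where r: "r > 0" "\<And>t. t \<in> {0..1} \<Longrightarrow> dist t s < r \<Longrightarrow> dist (u t) (u s) < dl ?x"
      using u(1) s dl_pos[OF x(1)] unfolding continuous_on_iff by metis
    show "\<exists>e>0. \<forall>t\<in>{0..1}. dist s t < e \<longrightarrow> cl (p, u t) \<in> star ?x (dl ?x) \<and>
        frame p (u t) = frame p (u s) \<otimes> transition ?x (cl (p, u t))"
    proof (intro exI[of _ r] conjI ballI impI r(1))
      fix t assume t: "t \<in> {0..1}" "dist s t < r"
      have ut: "u t \<in> ngon n" using u t by auto
      have d: "dist (u s) (u t) < dl ?x" using r(2)[of t] t by (simp add: dist_commute)
      have y: "cl (p, u t) \<in> topspace X" "(p, u t) \<in> cl (p, u t)"
        using cl_in[OF p ut] cl_self[OF p ut] by auto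
      show "cl (p, u t) \<in> star ?x (dl ?x)" unfolding star_def using x y d by blast
      show "frame p (u t) = frame p (u s) \<otimes> transition ?x (cl (p, u t))"
        unfolding transition_eq[OF x y d] using p by simp
    qed
  qed (use p in simp)
qed

end

section \<open>A presentation of the fundamental group of a polygonal complex\<close>

lemma hom_eval_word:
  assumes K: "group K" and L: "group L" and h: "h \<in> hom K L"
    and f: "\<And>s. s \<in> S \<Longrightarrow> f s \<in> carrier K" and u: "u \<in> words S"
  shows "h (eval_word K f u) = eval_word L (\<lambda>s. h (f s)) u"
proof -
  interpret group_hom K L h by (intro group_hom.intro group_hom_axioms.intro K L h)
  show ?thesis using u
  proof (induction u)
    case (Cons x u)
    have "eval_word K f u \<in> carrier K"
      using Cons.prems by (intro eval_word_closed[OF K f]) auto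
    then show ?case
      using Cons f by (cases x) (auto simp: eval_word_def)
  qed simp
qed

lemma eval_word_cong:
  "u \<in> words S \<Longrightarrow> (\<And>s. s \<in> S \<Longrightarrow> f s = g s) \<Longrightarrow> eval_word K f u = eval_word K g u"
  by (induction u) (auto simp: eval_word_def)

lemma eval_generator:
  assumes "u \<in> words S"
  shows "eval_word (presented_group S R) (generator S R) u = word_equiv S R `` {u}"
  using assms
proof (induction u)
  case Nil
  then show ?case by (simp add: presented_group_def)
next
  case (Cons x u)
  interpret group "presented_group S R" by (rule group_presented_group)
  obtain s b where x: "x = (s, b)" by (cases x)
  have s: "s \<in> S" "u \<in> words S" using Cons.prems x by auto
  have cl: "word_equiv S R `` {[(s, False)]} \<in> carrier (presented_group S R)"
    using s by (intro presented_carrierI) simp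
  have "(if b then generator S R s else inv\<^bsub>presented_group S R\<^esub> generator S R s)
      = word_equiv S R `` {[(s, b)]}"
    using generator_left_inverse[OF s(1), of R] generator_closed[OF s(1), of R] cl
    by (auto simp: generator_def[symmetric] inv_equality)
  then show ?case
    using Cons.IH[OF s(2)] s by (simp add: x eval_word_def presented_mult)
qed

lemma eval_generator_relator:
  assumes "r \<in> R" "r \<in> words S"
  shows "eval_word (presented_group S R) (generator S R) r = \<one>\<^bsub>presented_group S R\<^esub>"
  by (simp only: eval_generator[OF assms(2)] relator_trivial[OF assms])

lemma (in local_system) hol_reverse:
  assumes "pathin X p"
  shows "hol (reverse_path p) = inv hol p"
proof -
  have "hol p \<otimes> hol (reverse_path p) = hol (loop_concat p (reverse_path p))"
    using assms by (simp add: hol_concat pathin_reverse)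
  also have "\<dots> = hol (\<lambda>_. p 0)"
    by (rule hol_path_homotopic[OF path_homotopic_inverse[OF assms]])
  also have "\<dots> = \<one>"
    by (rule hol_const[of "p 0"]) (use assms path_start_in_topspace in auto)
  finally show ?thesis
    using hol_closed[OF assms] hol_closed[OF pathin_reverse[OF assms]]
    by (metis inv_equality inv_inv inv_closed)
qed

text \<open>Every vertex of the complex is represented by a corner \<open>c \<in> C\<close> of the polygon \<open>p0\<close>; the
  straight paths in \<open>p0\<close> from corner \<open>0\<close> to these corners play the role of a spanning tree.\<close>

locale rooted_polygons = glued_polygons P W n
  for P :: "'p set" and W :: "'p \<Rightarrow> 'l word" and n +
  fixes p0 :: 'p and C :: "nat set" and \<kappa> :: "'p \<Rightarrow> nat \<Rightarrow> nat"
  assumes p0: "p0 \<in> P" and C: "C \<subseteq> {..<n}" "0 \<in> C"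
    and \<kappa>_C: "p \<in> P \<Longrightarrow> k \<le> n \<Longrightarrow> \<kappa> p k \<in> C"
    and \<kappa>_n: "p \<in> P \<Longrightarrow> \<kappa> p n = \<kappa> p 0"
    and \<kappa>_root: "c \<in> C \<Longrightarrow> \<kappa> p0 c = c"
    and \<kappa>_edge: "p \<in> P \<Longrightarrow> p' \<in> P \<Longrightarrow> k < n \<Longrightarrow> k' < n \<Longrightarrow> lab p k = lab p' k' \<Longrightarrow>
      \<kappa> p (initial p k) = \<kappa> p' (initial p' k') \<and> \<kappa> p (terminal p k) = \<kappa> p' (terminal p' k')"
    and \<kappa>_glue: "p \<in> P \<Longrightarrow> k < n \<Longrightarrow> ((p, corner n k), (p0, corner n (\<kappa> p k))) \<in> R"
begin

lemma n_pos: "n > 0" using n by simp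

lemma corner_in: "k \<le> n \<Longrightarrow> corner n k \<in> ngon n"
  by (rule corner_in_ngon[OF n_pos])

lemma C_le: "c \<in> C \<Longrightarrow> c \<le> n"
  using C by auto

lemma \<kappa>_vertex: "p \<in> P \<Longrightarrow> k \<le> n \<Longrightarrow> cl (p, corner n k) = cl (p0, corner n (\<kappa> p k))"
  using cl_eq[OF \<kappa>_glue[of p k]] cl_eq[OF \<kappa>_glue[of p 0]] \<kappa>_n corner_wrap[OF n_pos] n_pos
  by (cases "k = n") auto

text \<open>The boundary arc of \<open>p0\<close> from corner 0 to corner \<open>c\<close> and the
  straight branch to that corner bound a piece of \<open>p0\<close>, so the prefix read along the
  arc must die. The value \<open>c = 0\<close> contributes the empty word.\<close>

definition relators :: "'l word set" where
  "relators = W ` P \<union> (\<lambda>c. take c (W p0)) ` C"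

lemma relators_words: "r \<in> relators \<Longrightarrow> r \<in> words labels"
  using W_words take_words p0 by (auto simp: relators_def)

lemma path_connected_X: 
  assumes "x \<in> topspace X" "y \<in> topspace X"
  shows "path_component_of X x y"
proof -
  have seg: "path_component_of X (cl (p, w)) (cl (p, v))" if "p \<in> P" "w \<in> ngon n" "v \<in> ngon n" for p w v
    unfolding path_component_of_def
  proof (intro exI conjI)
    have "continuous_map (top_of_set {0..1}) X ((\<lambda>w. cl (p, w)) \<circ> linepath w v)"
      by (rule continuous_map_compose[OF _ continuous_map_polygon[OF that(1)]])
        (use that convexD_alt[OF convex_ngon that(2,3)] in \<open>auto simp: linepath_def intro!: continuous_intros\<close>)
    then show "pathin X ((\<lambda>w. cl (p, w)) \<circ> linepath w v)" by (simp add: pathin_def)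
  qed (auto simp: linepath_def)
  have "path_component_of X x (cl (p0, corner n 0))" if x: "x \<in> topspace X" for x
  proof -
    obtain p w where p: "p \<in> P" "w \<in> ngon n" "x = cl (p, w)"
      using pointE[OF x] by blast
    have "path_component_of X x (cl (p, corner n 0))"
      using seg[OF p(1,2)] corner_in[of 0] p(3) by simp
    moreover have "path_component_of X (cl (p0, corner n (\<kappa> p 0))) (cl (p0, corner n 0))"
      using \<kappa>_C[OF p(1), of 0] C_le by (intro seg p0 corner_in) auto
    ultimately show ?thesis
      unfolding \<kappa>_vertex[OF p(1) le0] by (rule path_component_of_trans)
  qed
  from this[OF assms(1)] this[OF assms(2)] show ?thesis
    by (meson path_component_of_trans path_component_of_sym)
qed

end

locale based_polygons = rooted_polygons P W n p0 C \<kappa> + based_paths "polygonal_complex P W" a \<theta>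
  for P :: "'p set" and W :: "'p \<Rightarrow> 'l word" and n p0 C \<kappa> and a \<theta>
begin

section \<open>Realising letters by loops\<close>

definition seg :: "'p \<Rightarrow> complex \<Rightarrow> complex \<Rightarrow> (real \<Rightarrow> ('p \<times> complex) set) set" where
  "seg p w v = pclass (\<lambda>t. cl (p, linepath w v t))"

lemma
  assumes "p \<in> P" "u \<in> ngon n" "v \<in> ngon n"
  shows seg_closed [simp]: "seg p u v \<in> carrier \<pi>"
    and seg_path: "pathin X (\<lambda>t. cl (p, linepath u v t))"
    and seg_inv: "inv\<^bsub>\<pi>\<^esub> seg p u v = seg p v u"
    and seg_self [simp]: "seg p u u = \<one>\<^bsub>\<pi>\<^esub>"
    and seg_trans: "w \<in> ngon n \<Longrightarrow> seg p u v \<otimes>\<^bsub>\<pi>\<^esub> seg p v w = seg p u w"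
  using pclass_linepath[OF convex_ngon continuous_map_polygon[OF assms(1)] assms(2,3)] assms
    pclass_closed by (auto simp: seg_def o_def)

lemma seg_edge:
  assumes p: "p \<in> P" "p' \<in> P" "k < n" "k' < n" "lab p k = lab p' k'" and st: "s \<in> {0..1}" "t \<in> {0..1}"
  shows "seg p (edge p k s) (edge p k t) = seg p' (edge p' k' s) (edge p' k' t)"
  unfolding seg_def
proof (rule pclass_cong[OF path_homotopic_sym[OF path_homotopic_eq]])
  show "pathin X (\<lambda>r. cl (p', linepath (edge p' k' s) (edge p' k' t) r))"
    using assms by (intro seg_path edge_in_ngon)
  fix r :: real assume r: "r \<in> {0..1}"
  have lin: "linepath (edge p k s) (edge p k t) r = edge p k (s + r * (t - s))" for p k
    unfolding edge_affine[symmetric] by (simp add: linepath_def scaleR_conv_of_real algebra_simps)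
  have "s + r * (t - s) \<in> {0..1}"
    using st r convexD_alt[of "{0..1::real}" s t r] by (simp add: algebra_simps)
  then show "cl (p, linepath (edge p k s) (edge p k t) r) = cl (p', linepath (edge p' k' s) (edge p' k' t) r)"
    unfolding lin using p by (intro cl_eq glue_edge)
qed

definition branch :: "nat \<Rightarrow> (real \<Rightarrow> ('p \<times> complex) set) set" where
  "branch c = seg p0 (corner n 0) (corner n c)"

lemma branch_closed [simp]: "c \<in> C \<Longrightarrow> branch c \<in> carrier \<pi>"
  unfolding branch_def using C_le by (intro seg_closed p0 corner_in) auto

text \<open>The edge is closed up by the branches to its two ends. By \<open>edge_loop_eq\<close>
  any occurrence of the label gives the same class.\<close>

definition edge_loop :: "'l \<Rightarrow> (real \<Rightarrow> ('p \<times> complex) set) set" where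
  "edge_loop l = (SOME z. \<exists>p\<in>P. \<exists>k<n. l = lab p k \<and>
     z = branch (\<kappa> p (initial p k)) \<otimes>\<^bsub>\<pi>\<^esub> seg p (edge p k 0) (edge p k 1) \<otimes>\<^bsub>\<pi>\<^esub>
       inv\<^bsub>\<pi>\<^esub> branch (\<kappa> p (terminal p k)))"

lemma edge_loop_eq:
  assumes p: "p \<in> P" "k < n"
  shows "edge_loop (lab p k) = branch (\<kappa> p (initial p k)) \<otimes>\<^bsub>\<pi>\<^esub> seg p (edge p k 0) (edge p k 1) \<otimes>\<^bsub>\<pi>\<^esub>
    inv\<^bsub>\<pi>\<^esub> branch (\<kappa> p (terminal p k))"
  unfolding edge_loop_def
proof (rule some_equality)
  fix z assume "\<exists>p'\<in>P. \<exists>k'<n. lab p k = lab p' k' \<and>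
     z = branch (\<kappa> p' (initial p' k')) \<otimes>\<^bsub>\<pi>\<^esub> seg p' (edge p' k' 0) (edge p' k' 1) \<otimes>\<^bsub>\<pi>\<^esub>
       inv\<^bsub>\<pi>\<^esub> branch (\<kappa> p' (terminal p' k'))"
  then obtain p' k' where p': "p' \<in> P" "k' < n" "lab p k = lab p' k'"
     "z = branch (\<kappa> p' (initial p' k')) \<otimes>\<^bsub>\<pi>\<^esub> seg p' (edge p' k' 0) (edge p' k' 1) \<otimes>\<^bsub>\<pi>\<^esub>
       inv\<^bsub>\<pi>\<^esub> branch (\<kappa> p' (terminal p' k'))" by blast
  then show "z = branch (\<kappa> p (initial p k)) \<otimes>\<^bsub>\<pi>\<^esub> seg p (edge p k 0) (edge p k 1) \<otimes>\<^bsub>\<pi>\<^esub>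
    inv\<^bsub>\<pi>\<^esub> branch (\<kappa> p (terminal p k))"
    using \<kappa>_edge[OF p(1) p'(1) p(2) p'(2,3)] seg_edge[OF p(1) p'(1) p(2) p'(2,3), of 0 1] by simp
qed (use p in blast)

lemma \<kappa>_ends: "p \<in> P \<Longrightarrow> k < n \<Longrightarrow> \<kappa> p (initial p k) \<in> C \<and> \<kappa> p (terminal p k) \<in> C"
  using \<kappa>_C initial_le terminal_le by blast

lemma edge_loop_closed: "l \<in> labels \<Longrightarrow> edge_loop l \<in> carrier \<pi>"
  by (erule labelsE) (auto simp: edge_loop_eq \<kappa>_ends edge_in_ngon)

text \<open>The branches to intermediate corners cancel and consecutive sides compose to chords, so
  a boundary arc becomes its chord closed up by two branches.\<close>

lemma eval_edge_loop:
  assumes p: "p \<in> P"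
  shows "k \<le> n \<Longrightarrow> eval_word \<pi> edge_loop (take k (W p)) =
    branch (\<kappa> p 0) \<otimes>\<^bsub>\<pi>\<^esub> seg p (corner n 0) (corner n k) \<otimes>\<^bsub>\<pi>\<^esub> inv\<^bsub>\<pi>\<^esub> branch (\<kappa> p k)"
proof (induction k)
  case 0
  then show ?case using p \<kappa>_C[OF p, of 0] corner_in[of 0] by simp
next
  case (Suc k)
  let ?s = "corner n k" and ?t = "corner n (Suc k)"
  have k: "k < n" using Suc.prems by simp
  have c: "?s \<in> ngon n" "?t \<in> ngon n" "corner n 0 \<in> ngon n" using corner_in Suc.prems by auto
  have \<kappa>: "branch (\<kappa> p k) \<in> carrier \<pi>" "branch (\<kappa> p (Suc k)) \<in> carrier \<pi>" "branch (\<kappa> p 0) \<in> carrier \<pi>"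
    using \<kappa>_C[OF p] Suc.prems by auto
  have l: "edge_loop (lab p k) \<in> carrier \<pi>" by (rule edge_loop_closed[OF lab_in_labels[OF p k]])
  have "eval_word \<pi> edge_loop [(lab p k, snd (W p ! k))] =
      branch (\<kappa> p k) \<otimes>\<^bsub>\<pi>\<^esub> seg p ?s ?t \<otimes>\<^bsub>\<pi>\<^esub> inv\<^bsub>\<pi>\<^esub> branch (\<kappa> p (Suc k))"
  proof (cases "snd (W p ! k)")
    case True
    then have "eval_word \<pi> edge_loop [(lab p k, snd (W p ! k))] = edge_loop (lab p k)"
      using l by (simp add: eval_word_def)
    then show ?thesis
      unfolding edge_loop_eq[OF p k] edge_ends using True by (simp add: initial_def terminal_def)
  next
    case False
    then have "eval_word \<pi> edge_loop [(lab p k, snd (W p ! k))] = inv\<^bsub>\<pi>\<^esub> edge_loop (lab p k)"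
      using l by (simp add: eval_word_def)
    then show ?thesis
      unfolding edge_loop_eq[OF p k] edge_ends using False \<kappa> c p
      by (simp add: initial_def terminal_def \<pi>.inv_mult_group \<pi>.m_assoc seg_inv)
  qed
  moreover have "eval_word \<pi> edge_loop (take (Suc k) (W p)) =
      eval_word \<pi> edge_loop (take k (W p)) \<otimes>\<^bsub>\<pi>\<^esub> eval_word \<pi> edge_loop [(lab p k, snd (W p ! k))]"
    unfolding take_Suc_W[OF p k]
    by (rule eval_word_append[OF \<pi>.is_group edge_loop_closed take_words[OF p]])
      (use lab_in_labels[OF p k] in auto)
  moreover have "seg p (corner n 0) ?t = seg p (corner n 0) ?s \<otimes>\<^bsub>\<pi>\<^esub> seg p ?s ?t"
    using c p by (simp add: seg_trans)
  ultimately show ?case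
    using Suc.IH k c \<kappa> p by (simp add: \<pi>.m_assoc)
qed

lemma eval_edge_loop_relator:
  assumes "r \<in> relators"
  shows "eval_word \<pi> edge_loop r = \<one>\<^bsub>\<pi>\<^esub>"
proof -
  have "eval_word \<pi> edge_loop (W p) = \<one>\<^bsub>\<pi>\<^esub>" if p: "p \<in> P" for p
    using eval_edge_loop[OF p, of n] p corner_in[of 0] \<kappa>_C[OF p, of 0]
    by (simp add: len \<kappa>_n corner_wrap[OF n_pos])
  moreover have "eval_word \<pi> edge_loop (take c (W p0)) = \<one>\<^bsub>\<pi>\<^esub>" if c: "c \<in> C" for c
  proof -
    \<comment> \<open>In \<open>p0\<close> the map \<open>\<kappa>\<close> fixes \<open>C\<close>,
      so the chord of the arc is the branch itself and the two cancel.\<close>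
    have "branch 0 = \<one>\<^bsub>\<pi>\<^esub>" using p0 corner_in[of 0] by (simp add: branch_def)
    then have "eval_word \<pi> edge_loop (take c (W p0)) = branch c \<otimes>\<^bsub>\<pi>\<^esub> inv\<^bsub>\<pi>\<^esub> branch c"
      using eval_edge_loop[OF p0, of c] C_le[OF c] \<kappa>_root C(2) c p0 corner_in
      by (simp add: branch_def)
    then show ?thesis using c by simp
  qed
  ultimately show ?thesis using assms by (auto simp: relators_def)
qed

abbreviation "K \<equiv> presented_group labels relators"

text \<open>The radial contraction of a star pushes a path that stays in the star of its initial point
  into a single polygon.\<close>

lemma pclass_star_path:
  assumes q: "pathin X q" and star: "\<And>t. t \<in> {0..1} \<Longrightarrow> q t \<in> star (q 0) (dl (q 0))"
    and pw: "(p, w) \<in> q 0" and pv: "(p, v) \<in> q 1" and d: "dist w v < dl (q 0)"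
  shows "pclass q = seg p w v"
proof -
  let ?x = "q 0" and ?I = "{0..1::real}"
  let ?c = "\<lambda>(u, t). radial ?x u (q t)"
  have x: "?x \<in> topspace X" and y: "q 1 \<in> topspace X"
    using path_ends[OF q] by auto
  have c: "continuous_map (top_of_set (?I \<times> ?I)) X ?c"
    using continuous_radial[OF x q[unfolded pathin_def] star] by blast
  have sq: "convex (?I \<times> ?I)" by (intro convex_Times) auto
  have pts: "(1, 0) \<in> ?I \<times> ?I" "(0, 0) \<in> ?I \<times> ?I" "(0, 1) \<in> ?I \<times> ?I" "(1, 1) \<in> ?I \<times> ?I" by auto
  note lp = pclass_linepath[OF sq c]
  have rad: "radial ?x u z = cl (p', w' + of_real u * (v' - w'))"
    if "(p', w') \<in> ?x" "(p', v') \<in> z" "z \<in> topspace X" "dist w' v' < dl ?x" "u \<in> ?I" for p' w' v' z u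
    by (rule radial_eq[OF x that(1,3,2,4,5)])
  have rad_x: "radial ?x u ?x = ?x" if "u \<in> ?I" for u
    using rad[OF pw pw x _ that] dl_pos[OF x] point_cl[OF x pw] by simp
  have qt: "\<exists>p' w' v'. (p', w') \<in> ?x \<and> (p', v') \<in> q t \<and> dist w' v' < dl ?x \<and> q t \<in> topspace X"
    if "t \<in> ?I" for t
    using star[OF that] by (auto simp: star_def)
  have rad0: "radial ?x 0 (q t) = ?x" and rad1: "radial ?x 1 (q t) = q t" if "t \<in> ?I" for t
    using qt[OF that] rad point_cl x by fastforce+
  have s: "seg p w v \<in> carrier \<pi>"
    using point_memb[OF x pw] point_memb[OF y pv] by (intro seg_closed) auto
  \<comment> \<open>The side of the square from \<open>(1, 0)\<close> to \<open>(1, 1)\<close> maps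
    to \<open>q\<close>. The way around through \<open>(0, 0)\<close> and \<open>(0, 1)\<close> has
    two legs that stay at the centre, followed by the radial segment from \<open>w\<close> to
    \<open>v\<close>.\<close>
  have "pclass (?c \<circ> linepath (1, 0) (0, 0)) = pclass (\<lambda>_. ?x)"
    by (rule pclass_cong[OF path_homotopic_sym[OF path_homotopic_eq]])
      (use x in \<open>auto simp: linepath_def rad_x\<close>)
  moreover have "pclass (?c \<circ> linepath (0, 0) (0, 1)) = pclass (\<lambda>_. ?x)"
    by (rule pclass_cong[OF path_homotopic_sym[OF path_homotopic_eq]])
      (use x in \<open>auto simp: linepath_def rad0\<close>)
  moreover have "pclass (\<lambda>_. ?x) = \<one>\<^bsub>\<pi>\<^esub>" by (rule pclass_const[OF x])
  moreover have "pclass (?c \<circ> linepath (0, 1) (1, 1)) = seg p w v"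
    unfolding seg_def
  proof (rule pclass_cong[OF path_homotopic_sym[OF path_homotopic_eq]])
    show "pathin X (\<lambda>t. cl (p, linepath w v t))"
      using point_memb[OF x pw] point_memb[OF y pv] seg_path by blast
    show "(?c \<circ> linepath (0, 1) (1, 1)) t = cl (p, linepath w v t)" if "t \<in> ?I" for t
      using rad[OF pw pv y d that] by (simp add: linepath_def scaleR_conv_of_real algebra_simps)
  qed
  moreover have "pclass (?c \<circ> linepath (1, 0) (1, 1)) = pclass q"
    by (rule pclass_cong[OF path_homotopic_sym[OF path_homotopic_eq[OF q]]])
      (auto simp: linepath_def rad1)
  ultimately show ?thesis
    using lp(1)[OF pts(1,2,4)] lp(1)[OF pts(2,3,4)] s by (metis \<pi>.l_one)
qed

end

context rooted_polygons begin

sublocale L: polygon_local_system P W n "presented_group labels relators" "generator labels relators"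
proof -
  interpret group "presented_group labels relators" by (rule group_presented_group)
  show "polygon_local_system P W n (presented_group labels relators) (generator labels relators)"
  proof
    show "l \<in> labels \<Longrightarrow> generator labels relators l \<in> carrier (presented_group labels relators)" for l
      by (rule generator_closed)
    show "p \<in> P \<Longrightarrow> eval_word (presented_group labels relators) (generator labels relators) (W p)
        = \<one>\<^bsub>presented_group labels relators\<^esub>" for p
      by (rule eval_generator_relator) (auto simp: relators_def W_words)
  qed
qed

lemma pre_root:
  assumes "c \<in> C"
  shows "L.pre p0 c = \<one>\<^bsub>presented_group labels relators\<^esub>"
  unfolding L.pre_def
  by (rule eval_generator_relator) (use assms take_words[OF p0] in \<open>auto simp: relators_def\<close>)

end

context based_polygons begin

lemma realise_exists: "\<exists>r \<in> hom K \<pi>. \<forall>l\<in>labels. r (generator labels relators l) = edge_loop l"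
  by (rule presented_group_universal[OF \<pi>.is_group edge_loop_closed])
    (use eval_edge_loop_relator relators_words in auto)

definition realise :: "'l word set \<Rightarrow> (real \<Rightarrow> ('p \<times> complex) set) set" where
  "realise = (SOME r. r \<in> hom K \<pi> \<and> (\<forall>l\<in>labels. r (generator labels relators l) = edge_loop l))"

lemma realise_hom: "realise \<in> hom K \<pi>"
  and realise_generator: "l \<in> labels \<Longrightarrow> realise (generator labels relators l) = edge_loop l"
proof -
  have "\<exists>r. r \<in> hom K \<pi> \<and> (\<forall>l\<in>labels. r (generator labels relators l) = edge_loop l)"
    using realise_exists by blast
  from someI_ex[OF this]
  have "realise \<in> hom K \<pi> \<and> (\<forall>l\<in>labels. realise (generator labels relators l) = edge_loop l)"
    unfolding realise_def .
  then show "realise \<in> hom K \<pi>"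
    "l \<in> labels \<Longrightarrow> realise (generator labels relators l) = edge_loop l" by auto
qed

sublocale r: group_hom K \<pi> realise
  by (intro group_hom.intro group_hom_axioms.intro group_presented_group \<pi>.is_group realise_hom)

lemma realise_pre:
  assumes p: "p \<in> P" "k \<le> n"
  shows "realise (L.pre p k) =
    branch (\<kappa> p 0) \<otimes>\<^bsub>\<pi>\<^esub> seg p (corner n 0) (corner n k) \<otimes>\<^bsub>\<pi>\<^esub> inv\<^bsub>\<pi>\<^esub> branch (\<kappa> p k)"
proof -
  have "realise (L.pre p k) = eval_word \<pi> (\<lambda>l. realise (generator labels relators l)) (take k (W p))"
    unfolding L.pre_def
    by (rule hom_eval_word[OF group_presented_group \<pi>.is_group realise_hom generator_closed take_words[OF p(1)]])
  also have "\<dots> = eval_word \<pi> edge_loop (take k (W p))"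
    by (rule eval_word_cong[OF take_words[OF p(1)] realise_generator])
  finally show ?thesis by (simp add: eval_edge_loop p)
qed

text \<open>Compares two ways from the root to a point of \<open>p\<close>: the class of an actual
  path through corner 0 of \<open>p\<close>, and the realised frame. It is the correction between
  holonomy and homotopy class in \<open>realise_hol\<close>.\<close>

definition fibre :: "'p \<Rightarrow> complex \<Rightarrow> (real \<Rightarrow> ('p \<times> complex) set) set" where
  "fibre p w = inv\<^bsub>\<pi>\<^esub> realise (L.frame p w) \<otimes>\<^bsub>\<pi>\<^esub> branch (\<kappa> p 0) \<otimes>\<^bsub>\<pi>\<^esub> seg p (corner n 0) w"

lemma fibre_closed [simp]: "p \<in> P \<Longrightarrow> w \<in> ngon n \<Longrightarrow> fibre p w \<in> carrier \<pi>"
  using \<kappa>_C[of p 0] corner_in[of 0] by (simp add: fibre_def)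

text \<open>Moving the reference point from corner 0 to the initial corner of the edge leaves only
  quantities that gluing respects, which gives \<open>fibre_glue\<close>.\<close>

lemma fibre_edge:
  assumes p: "p \<in> P" "k < n" and t: "t \<in> {0..1}"
  shows "fibre p (edge p k t) =
    inv\<^bsub>\<pi>\<^esub> realise (if t = 1 then generator labels relators (lab p k) else \<one>\<^bsub>K\<^esub>) \<otimes>\<^bsub>\<pi>\<^esub>
    branch (\<kappa> p (initial p k)) \<otimes>\<^bsub>\<pi>\<^esub> seg p (edge p k 0) (edge p k t)"
proof -
  define z where "z = (if t = 1 then generator labels relators (lab p k) else \<one>\<^bsub>K\<^esub>)"
  let ?i = "initial p k"
  have z: "z \<in> carrier K" using p by (simp add: z_def)
  have i: "?i \<le> n" by (rule initial_le[OF p(2)])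
  have c: "corner n 0 \<in> ngon n" "corner n ?i \<in> ngon n" "edge p k t \<in> ngon n"
    using corner_in i edge_in_ngon p t by auto
  have b: "branch (\<kappa> p 0) \<in> carrier \<pi>" "branch (\<kappa> p ?i) \<in> carrier \<pi>"
    using \<kappa>_C[OF p(1)] i by auto
  have s: "seg p (corner n 0) (edge p k t) = seg p (corner n 0) (corner n ?i) \<otimes>\<^bsub>\<pi>\<^esub> seg p (corner n ?i) (edge p k t)"
    using c p by (simp add: seg_trans)
  have "fibre p (edge p k t) = inv\<^bsub>\<pi>\<^esub> realise (L.pre p ?i \<otimes>\<^bsub>K\<^esub> z) \<otimes>\<^bsub>\<pi>\<^esub>
      branch (\<kappa> p 0) \<otimes>\<^bsub>\<pi>\<^esub> seg p (corner n 0) (edge p k t)"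
    unfolding fibre_def L.frame_edge[OF p t] L.edge_frame_def z_def ..
  also have "\<dots> = inv\<^bsub>\<pi>\<^esub> realise z \<otimes>\<^bsub>\<pi>\<^esub> branch (\<kappa> p ?i) \<otimes>\<^bsub>\<pi>\<^esub> seg p (corner n ?i) (edge p k t)"
    using p z c b by (simp add: realise_pre[OF p(1) i] s \<pi>.inv_mult_group \<pi>.m_assoc)
  finally show ?thesis by (simp add: edge_ends z_def)
qed

lemma fibre_glue:
  assumes "((p, w), (p', w')) \<in> R"
  shows "fibre p w = fibre p' w'"
proof -
  have "fibre p w = fibre (fst (p', w')) (snd (p', w'))"
    using assms
  proof (induction rule: glue_induct)
    case (step p1 k p2 k' t)
    have "fibre p1 (edge p1 k t) = fibre p2 (edge p2 k' t)"
      unfolding fibre_edge[OF step(1,3,6)] fibre_edge[OF step(2,4,6)] step(5)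
      using \<kappa>_edge[OF step(1-5)] seg_edge[OF step(1-5) _ step(6), of 0] by simp
    then show ?case using step(7) by simp
  qed simp
  then show ?thesis by simp
qed

definition fib :: "('p \<times> complex) set \<Rightarrow> (real \<Rightarrow> ('p \<times> complex) set) set" where
  "fib y = (let (p, w) = (SOME z. z \<in> y) in fibre p w)"

lemma fib_eq:
  assumes "y \<in> topspace X" "(p, w) \<in> y"
  shows "fib y = fibre p w"
proof -
  obtain p' w' where z: "(SOME z. z \<in> y) = (p', w')" by (cases "SOME z. z \<in> y")
  have "(p', w') \<in> y" using someI[of "\<lambda>z. z \<in> y", OF assms(2)] z by simp
  then show ?thesis
    using fibre_glue point_R[OF assms(1) _ assms(2)] z by (simp add: fib_def)
qed

lemma fib_closed: "y \<in> topspace X \<Longrightarrow> fib y \<in> carrier \<pi>"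
  by (erule pointE) (simp add: fib_eq cl_in)

text \<open>Both sides change in the same way along a path, as long as it stays in a star.\<close>

lemma realise_hol:
  assumes q: "pathin X q"
  shows "realise (L.hol q) = fib (q 0) \<otimes>\<^bsub>\<pi>\<^esub> pclass q \<otimes>\<^bsub>\<pi>\<^esub> inv\<^bsub>\<pi>\<^esub> fib (q 1)"
proof -
  obtain g where g: "L.is_lift {0..1} q g" using L.path_lift[OF q] by blast
  have qX: "q t \<in> topspace X" if "t \<in> {0..1}" for t
    using q that path_image_subset_topspace by blast
  have g_closed: "g t \<in> carrier K" if "t \<in> {0..1}" for t
    using g that by (auto simp: L.is_lift_def)
  have q': "continuous_map (top_of_set {0..1}) X q" using q by (simp add: pathin_def)
  have cv: "convex {0..1::real}" by simp
  note lp = pclass_linepath[OF cv q']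
  \<comment> \<open>\<open>c\<close> is shown to be locally constant; \<open>c 0 = c 1\<close> is a
    rearrangement of the claim.\<close>
  define c where "c = (\<lambda>t. realise (g t) \<otimes>\<^bsub>\<pi>\<^esub> fib (q t) \<otimes>\<^bsub>\<pi>\<^esub> inv\<^bsub>\<pi>\<^esub> pclass (q \<circ> linepath 0 t))"
  have "\<forall>t\<in>{0..1}. \<forall>\<^sub>F u in at t within {0..1}. c t = c u"
  proof
    fix t :: real assume t: "t \<in> {0..1}"
    obtain e where e: "e > 0" "\<And>u. u \<in> {0..1} \<Longrightarrow> dist t u < e \<Longrightarrow>
        q u \<in> star (q t) (dl (q t)) \<and> g u = g t \<otimes>\<^bsub>K\<^esub> L.transition (q t) (q u)"
      using g t unfolding L.is_lift_def by blast
    have "c t = c u" if u: "u \<in> {0..1}" "dist u t < e" for u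
    proof -
      have du: "dist t u < e" using u by (simp add: dist_commute)
      from e(2)[OF u(1) du] obtain p w v where
        pwv: "(p, w) \<in> q t" "(p, v) \<in> q u" "dist w v < dl (q t)" by (auto simp: star_def)
      have mem: "p \<in> P" "w \<in> ngon n" "v \<in> ngon n"
        using point_memb[OF qX[OF t] pwv(1)] point_memb[OF qX[OF u(1)] pwv(2)] by auto
      have s: "pclass (q \<circ> linepath t u) = seg p w v"
      proof (rule pclass_star_path[OF lp(3)[OF t u(1) t]])
        fix s :: real assume s: "s \<in> {0..1}"
        have "linepath t u s \<in> {0..1}"
          using convexD_alt[OF cv t u(1), of s] s by (simp add: linepath_def)
        moreover have "t - linepath t u s = s * (t - u)" by (simp add: linepath_def algebra_simps)
        then have "dist t (linepath t u s) = s * dist t u" using s by (simp add: dist_real_def abs_mult)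
        then have "dist t (linepath t u s) \<le> 1 * dist t u"
          using s by (metis atLeastAtMost_iff mult_right_mono zero_le_dist)
        then have "dist t (linepath t u s) < e" using du by simp
        ultimately show "(q \<circ> linepath t u) s \<in> star ((q \<circ> linepath t u) 0) (dl ((q \<circ> linepath t u) 0))"
          using e(2) by (simp add: linepath_def)
      qed (use pwv in \<open>simp_all add: linepath_def\<close>)
      let ?b = "branch (\<kappa> p 0)" and ?f = "\<lambda>w. realise (L.frame p w)"
      have cl: "?b \<in> carrier \<pi>" "?f w \<in> carrier \<pi>" "?f v \<in> carrier \<pi>" "realise (g t) \<in> carrier \<pi>"
        "seg p (corner n 0) w \<in> carrier \<pi>" "seg p w v \<in> carrier \<pi>"
        "pclass (q \<circ> linepath 0 t) \<in> carrier \<pi>"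
        using \<kappa>_C[OF mem(1), of 0] mem corner_in[of 0] g_closed[OF t] t lp(3)[of 0 t] pclass_closed
        by auto
      have "g u = g t \<otimes>\<^bsub>K\<^esub> (inv\<^bsub>K\<^esub> L.frame p w \<otimes>\<^bsub>K\<^esub> L.frame p v)"
        using e(2)[OF u(1) du] L.transition_eq[OF qX[OF t] pwv(1) qX[OF u(1)] pwv(2,3)] by simp
      then have gu: "realise (g u) = realise (g t) \<otimes>\<^bsub>\<pi>\<^esub> (inv\<^bsub>\<pi>\<^esub> ?f w \<otimes>\<^bsub>\<pi>\<^esub> ?f v)"
        using g_closed[OF t] mem by simp
      have fu: "fib (q u) = inv\<^bsub>\<pi>\<^esub> ?f v \<otimes>\<^bsub>\<pi>\<^esub> ?b \<otimes>\<^bsub>\<pi>\<^esub> (seg p (corner n 0) w \<otimes>\<^bsub>\<pi>\<^esub> seg p w v)"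
        using fib_eq[OF qX[OF u(1)] pwv(2)] mem corner_in[of 0] by (simp add: fibre_def seg_trans)
      have ft: "fib (q t) = inv\<^bsub>\<pi>\<^esub> ?f w \<otimes>\<^bsub>\<pi>\<^esub> ?b \<otimes>\<^bsub>\<pi>\<^esub> seg p (corner n 0) w"
        using fib_eq[OF qX[OF t] pwv(1)] by (simp add: fibre_def)
      have lu: "pclass (q \<circ> linepath 0 u) = pclass (q \<circ> linepath 0 t) \<otimes>\<^bsub>\<pi>\<^esub> seg p w v"
        using lp(1)[of 0 t u] t u(1) s by simp
      \<comment> \<open>The factor gained by \<open>g\<close> is cancelled by the frames inside
        \<open>fib\<close>, and the segment gained by \<open>fib\<close> is cancelled by the inverse
        of the lengthened path class.\<close>
      show ?thesis
        unfolding c_def gu fu ft lu using cl by (simp add: \<pi>.inv_mult_group \<pi>.m_assoc)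
    qed
    then show "\<forall>\<^sub>F u in at t within {0..1}. c t = c u"
      unfolding eventually_at using e(1) by (intro exI[of _ e]) auto
  qed
  then have "c 0 = c 1"
    by - (rule connected_local_const[of "{0..1::real}"], auto)
  moreover have "q \<circ> linepath 0 1 = q" by (simp add: linepath_def fun_eq_iff)
  moreover have cl: "realise (g 0) \<in> carrier \<pi>" "realise (g 1) \<in> carrier \<pi>" "fib (q 0) \<in> carrier \<pi>"
    "fib (q 1) \<in> carrier \<pi>" "pclass q \<in> carrier \<pi>"
    using g_closed fib_closed qX pclass_closed[OF q] by auto
  ultimately have "realise (g 0) \<otimes>\<^bsub>\<pi>\<^esub> fib (q 0) = realise (g 1) \<otimes>\<^bsub>\<pi>\<^esub> fib (q 1) \<otimes>\<^bsub>\<pi>\<^esub> inv\<^bsub>\<pi>\<^esub> pclass q"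
    using lp(2)[of 0 0 0] by (simp add: c_def)
  then have "realise (g 0) \<otimes>\<^bsub>\<pi>\<^esub> fib (q 0) \<otimes>\<^bsub>\<pi>\<^esub> (pclass q \<otimes>\<^bsub>\<pi>\<^esub> inv\<^bsub>\<pi>\<^esub> fib (q 1)) = realise (g 1)"
    using cl by (simp add: \<pi>.m_assoc)
  then have "realise (g 1) = realise (g 0) \<otimes>\<^bsub>\<pi>\<^esub> (fib (q 0) \<otimes>\<^bsub>\<pi>\<^esub> pclass q \<otimes>\<^bsub>\<pi>\<^esub> inv\<^bsub>\<pi>\<^esub> fib (q 1))"
    using cl by (simp add: \<pi>.m_assoc)
  then show ?thesis
    using cl g_closed by (simp add: L.hol_eq[OF q g] \<pi>.m_assoc)
qed

theorem fundamental_group_iso: "\<pi> \<cong> K"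
proof -
  obtain \<eta> where \<eta>: "\<eta> \<in> hom \<pi> K" "\<And>p. p \<in> loops X a \<Longrightarrow> \<eta> (loop_class X a p) = L.hol p"
    using L.hol_hom[OF a] by blast
  interpret \<eta>: group_hom \<pi> K \<eta>
    by (intro group_hom.intro group_hom_axioms.intro \<pi>.is_group L.is_group \<eta>(1))
  \<comment> \<open>Holonomy of the paths with which \<open>pclass\<close> closes up; in the images
    of the edge loops it cancels except at the root vertex.\<close>
  define \<beta> where "\<beta> = (\<lambda>y. L.hol (\<theta> y))"
  have \<beta>: "\<beta> y \<in> carrier K" if "y \<in> topspace X" for y
    using \<theta>[OF that] by (simp add: \<beta>_def L.hol_closed)
  have \<eta>_pclass: "\<eta> (pclass q) = \<beta> (q 0) \<otimes>\<^bsub>K\<^esub> L.hol q \<otimes>\<^bsub>K\<^esub> inv\<^bsub>K\<^esub> \<beta> (q 1)" if q: "pathin X q" for q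
    using \<theta> path_ends[OF q] q
    by (simp add: pclass_def \<eta>(2) pclass_loop L.hol_concat L.hol_reverse \<beta>_def pathin_concat pathin_reverse)
  have \<eta>_seg: "\<eta> (seg p w v) = \<beta> (cl (p, w)) \<otimes>\<^bsub>K\<^esub> (inv\<^bsub>K\<^esub> L.frame p w \<otimes>\<^bsub>K\<^esub> L.frame p v) \<otimes>\<^bsub>K\<^esub>
      inv\<^bsub>K\<^esub> \<beta> (cl (p, v))"
    if "p \<in> P" "w \<in> ngon n" "v \<in> ngon n" for p w v
  proof -
    have "linepath w v \<in> {0..1} \<rightarrow> ngon n"
      using convexD_alt[OF convex_ngon that(2,3)] by (auto simp: linepath_def)
    then have "L.hol (\<lambda>t. cl (p, linepath w v t)) = inv\<^bsub>K\<^esub> L.frame p w \<otimes>\<^bsub>K\<^esub> L.frame p v"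
      using L.hol_polygon[OF that(1) continuous_on_linepath, of w v] by (simp add: linepath_0' linepath_1')
    then show ?thesis
      unfolding seg_def using \<eta>_pclass[OF seg_path[OF that]] by (simp add: linepath_def)
  qed
  define v0 where "v0 = cl (p0, corner n 0)"
  have vertex: "cl (p, corner n k) \<in> topspace X" if "p \<in> P" "k \<le> n" for p k
    using that by (intro cl_in corner_in)
  have \<beta>0: "\<beta> v0 \<in> carrier K" using vertex p0 by (auto simp: v0_def intro: \<beta>)
  have \<eta>_branch: "\<eta> (branch c) = \<beta> v0 \<otimes>\<^bsub>K\<^esub> inv\<^bsub>K\<^esub> \<beta> (cl (p0, corner n c))" if c: "c \<in> C" for c
    using \<beta>0 \<beta>[OF vertex[OF p0 C_le[OF c]]] C_le[OF c] p0 pre_root[OF c] corner_in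
    by (simp add: branch_def \<eta>_seg L.frame_corner v0_def)
  have conj1: "\<eta> (realise z) = \<beta> v0 \<otimes>\<^bsub>K\<^esub> z \<otimes>\<^bsub>K\<^esub> inv\<^bsub>K\<^esub> \<beta> v0" if "z \<in> carrier K" for z
  proof (rule presented_group_hom_unique[OF L.is_group L.f_closed _ _ _ that])
    show "(\<lambda>z. \<eta> (realise z)) \<in> hom K K"
      using hom_compose[OF realise_hom \<eta>(1)] by (simp add: o_def)
    show "(\<lambda>z. \<beta> v0 \<otimes>\<^bsub>K\<^esub> z \<otimes>\<^bsub>K\<^esub> inv\<^bsub>K\<^esub> \<beta> v0) \<in> hom K K"
      using \<beta>0 by (intro homI) (simp_all add: L.m_assoc)
    fix l assume l: "l \<in> labels"
    then obtain p k where p: "p \<in> P" "k < n" "l = lab p k" by (rule labelsE)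
    let ?i = "initial p k" and ?j = "terminal p k"
    have ij: "?i \<le> n" "?j \<le> n" using initial_le terminal_le p by auto
    note \<kappa>C = \<kappa>_C[OF p(1) ij(1)] \<kappa>_C[OF p(1) ij(2)]
    have cc: "corner n ?i \<in> ngon n" "corner n ?j \<in> ngon n" using corner_in ij by auto
    have \<beta>ij: "\<beta> (cl (p, corner n ?i)) \<in> carrier K" "\<beta> (cl (p, corner n ?j)) \<in> carrier K"
      using \<beta> vertex p ij by auto
    have "\<eta> (realise (generator labels relators l)) =
      \<eta> (branch (\<kappa> p ?i)) \<otimes>\<^bsub>K\<^esub> \<eta> (seg p (corner n ?i) (corner n ?j)) \<otimes>\<^bsub>K\<^esub> inv\<^bsub>K\<^esub> \<eta> (branch (\<kappa> p ?j))"
      using realise_generator[OF l] edge_loop_eq[OF p(1,2)] p(1) cc \<kappa>C by (simp add: edge_ends p(3))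
    also have "\<dots> = \<beta> v0 \<otimes>\<^bsub>K\<^esub> (inv\<^bsub>K\<^esub> L.pre p ?i \<otimes>\<^bsub>K\<^esub> L.pre p ?j) \<otimes>\<^bsub>K\<^esub> inv\<^bsub>K\<^esub> \<beta> v0"
      unfolding \<eta>_branch[OF \<kappa>C(1)] \<eta>_branch[OF \<kappa>C(2)] \<eta>_seg[OF p(1) cc]
        L.frame_corner[OF p(1) ij(1)] L.frame_corner[OF p(1) ij(2)]
        \<kappa>_vertex[OF p(1) ij(1), symmetric] \<kappa>_vertex[OF p(1) ij(2), symmetric]
      using \<beta>0 \<beta>ij p by (simp add: L.m_assoc L.inv_mult_group)
    also have "inv\<^bsub>K\<^esub> L.pre p ?i \<otimes>\<^bsub>K\<^esub> L.pre p ?j = generator labels relators l"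
      using p by (simp add: L.pre_terminal)
    finally show "\<eta> (realise (generator labels relators l)) =
      \<beta> v0 \<otimes>\<^bsub>K\<^esub> generator labels relators l \<otimes>\<^bsub>K\<^esub> inv\<^bsub>K\<^esub> \<beta> v0" .
  qed
  have f: "fib a \<in> carrier \<pi>" using fib_closed a by blast
  have conj2: "realise (\<eta> x) = fib a \<otimes>\<^bsub>\<pi>\<^esub> x \<otimes>\<^bsub>\<pi>\<^esub> inv\<^bsub>\<pi>\<^esub> fib a" if "x \<in> carrier \<pi>" for x
  proof -
    obtain q where q: "q \<in> loops X a" "x = loop_class X a q"
      using \<open>x \<in> carrier \<pi>\<close> by (rule fundamental_group_carrierE)
    then have "pathin X q" "q 0 = a" "q 1 = a" by (auto simp: loops_def)
    then show ?thesis using realise_hol[of q] q pclass_of_loop[OF q(1)] \<eta>(2)[OF q(1)] by simp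
  qed
  \<comment> \<open>Conjugations are bijective, so \<open>conj2\<close> gives injectivity of
    \<open>\<eta>\<close> and \<open>conj1\<close> its surjectivity.\<close>
  have "inj_on \<eta> (carrier \<pi>)"
  proof (rule inj_onI)
    fix x y assume xy: "x \<in> carrier \<pi>" "y \<in> carrier \<pi>" "\<eta> x = \<eta> y"
    then have "fib a \<otimes>\<^bsub>\<pi>\<^esub> x \<otimes>\<^bsub>\<pi>\<^esub> inv\<^bsub>\<pi>\<^esub> fib a = fib a \<otimes>\<^bsub>\<pi>\<^esub> y \<otimes>\<^bsub>\<pi>\<^esub> inv\<^bsub>\<pi>\<^esub> fib a"
      using conj2 by metis
    then show "x = y" using xy(1,2) f by (simp add: \<pi>.m_assoc)
  qed
  moreover have "\<eta> ` carrier \<pi> = carrier K"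
  proof (intro equalityI subsetI)
    fix z assume z: "z \<in> carrier K"
    let ?z = "inv\<^bsub>K\<^esub> \<beta> v0 \<otimes>\<^bsub>K\<^esub> z \<otimes>\<^bsub>K\<^esub> \<beta> v0"
    have "\<eta> (realise ?z) = z"
      using conj1[of ?z] z \<beta>0 by (simp add: L.m_assoc)
    moreover have "realise ?z \<in> carrier \<pi>" using z \<beta>0 by simp
    ultimately show "z \<in> \<eta> ` carrier \<pi>" by (metis imageI)
  qed auto
  ultimately show ?thesis
    unfolding is_iso_def iso_def bij_betw_def using \<eta>(1) by blast
qed

end

theorem (in rooted_polygons) fundamental_group_presentation:
  assumes a: "a \<in> topspace X"
  shows "fundamental_group X a \<cong> presented_group labels relators"
proof -
  have "\<exists>g. pathin X g \<and> g 0 = a \<and> g 1 = y \<and> (y = a \<longrightarrow> g = (\<lambda>_. a))" if "y \<in> topspace X" for y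
    using path_connected_X[OF a that] a
    by (cases "y = a") (auto simp: path_component_of_def)
  then obtain \<theta> where "\<And>y. y \<in> topspace X \<Longrightarrow>
      pathin X (\<theta> y) \<and> \<theta> y 0 = a \<and> \<theta> y 1 = y \<and> (y = a \<longrightarrow> \<theta> y = (\<lambda>_. a))"
    by metis
  then interpret based_polygons P W n p0 C \<kappa> a \<theta>
    using a by unfold_locales auto
  show ?thesis by (rule fundamental_group_iso)
qed

section \<open>Another presentation of surface groups\<close>

lemma isoI_inverse:
  assumes "h \<in> hom G H" "k \<in> hom H G"
    and "\<And>x. x \<in> carrier G \<Longrightarrow> k (h x) = x" "\<And>y. y \<in> carrier H \<Longrightarrow> h (k y) = y"
  shows "h \<in> iso G H"
  unfolding iso_def using assms by (auto intro!: bij_betw_byWitness[of _ k] simp: hom_def Pi_iff)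

text \<open>The last two hypotheses speak of every homomorphism that extends the assignment, because
  the extensions are only obtained existentially inside the proof.\<close>

lemma presented_group_iso:
  assumes f: "\<And>s. s \<in> S \<Longrightarrow> f s \<in> carrier (presented_group S' R')"
    and f': "\<And>s. s \<in> S' \<Longrightarrow> f' s \<in> carrier (presented_group S R)"
    and R: "\<And>r. r \<in> R \<Longrightarrow> r \<in> words S \<and> eval_word (presented_group S' R') f r = \<one>\<^bsub>presented_group S' R'\<^esub>"
    and R': "\<And>r. r \<in> R' \<Longrightarrow> r \<in> words S' \<and> eval_word (presented_group S R) f' r = \<one>\<^bsub>presented_group S R\<^esub>"
    and ff': "\<And>h s. h \<in> hom (presented_group S R) (presented_group S' R') \<Longrightarrow>
      (\<And>s. s \<in> S \<Longrightarrow> h (generator S R s) = f s) \<Longrightarrow> s \<in> S' \<Longrightarrow> h (f' s) = generator S' R' s"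
    and f'f: "\<And>h s. h \<in> hom (presented_group S' R') (presented_group S R) \<Longrightarrow>
      (\<And>s. s \<in> S' \<Longrightarrow> h (generator S' R' s) = f' s) \<Longrightarrow> s \<in> S \<Longrightarrow> h (f s) = generator S R s"
  shows "presented_group S R \<cong> presented_group S' R'"
proof -
  let ?G = "presented_group S R" and ?H = "presented_group S' R'"
  have G: "group ?G" and H: "group ?H" by (rule group_presented_group)+
  have "\<exists>h\<in>hom ?G ?H. \<forall>s\<in>S. h (generator S R s) = f s"
    by (rule presented_group_universal[OF H f R])
  then obtain h where h: "h \<in> hom ?G ?H" "\<And>s. s \<in> S \<Longrightarrow> h (generator S R s) = f s"
    by blast
  have "\<exists>k\<in>hom ?H ?G. \<forall>s\<in>S'. k (generator S' R' s) = f' s"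
    by (rule presented_group_universal[OF G f' R'])
  then obtain k where k: "k \<in> hom ?H ?G" "\<And>s. s \<in> S' \<Longrightarrow> k (generator S' R' s) = f' s"
    by blast
  have "h \<in> iso ?G ?H"
  proof (rule isoI_inverse[OF h(1) k(1)])
    fix x assume x: "x \<in> carrier ?G"
    show "k (h x) = x"
    proof (rule presented_group_hom_unique[OF G generator_closed _ _ _ x])
      show "(\<lambda>x. k (h x)) \<in> hom ?G ?G" using hom_compose[OF h(1) k(1)] by (simp add: o_def)
      show "(\<lambda>x. x) \<in> hom ?G ?G" by (simp add: hom_def)
      show "k (h (generator S R s)) = generator S R s" if "s \<in> S" for s
        unfolding h(2)[OF that] by (rule f'f[OF k that])
    qed
  next
    fix x assume x: "x \<in> carrier ?H"
    show "h (k x) = x"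
    proof (rule presented_group_hom_unique[OF H generator_closed _ _ _ x])
      show "(\<lambda>x. h (k x)) \<in> hom ?H ?H" using hom_compose[OF k(1) h(1)] by (simp add: o_def)
      show "(\<lambda>x. x) \<in> hom ?H ?H" by (simp add: hom_def)
      show "h (k (generator S' R' s)) = generator S' R' s" if "s \<in> S'" for s
        unfolding k(2)[OF that] by (rule ff'[OF h that])
    qed
  qed
  then show ?thesis by (auto simp: is_iso_def)
qed

section \<open>Ordered products and the change of basis to commutators\<close>

primrec pprod :: "('k, 'm) monoid_scheme \<Rightarrow> (nat \<Rightarrow> 'k) \<Rightarrow> nat \<Rightarrow> 'k" where
  "pprod G x 0 = \<one>\<^bsub>G\<^esub>"
| "pprod G x (Suc k) = pprod G x k \<otimes>\<^bsub>G\<^esub> x k"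

lemma pprod_cong: "(\<And>i. i < k \<Longrightarrow> x i = y i) \<Longrightarrow> pprod G x k = pprod G y k"
  by (induction k) auto

lemma (in group) pprod_closed: "(\<And>i. i < k \<Longrightarrow> x i \<in> carrier G) \<Longrightarrow> pprod G x k \<in> carrier G"
  by (induction k) auto

lemma (in group) pprod_one: "pprod G (\<lambda>_. \<one>) k = \<one>"
  by (induction k) auto

lemma hom_pprod:
  assumes "group G" "group H" "h \<in> hom G H" "\<And>i. i < k \<Longrightarrow> x i \<in> carrier G"
  shows "h (pprod G x k) = pprod H (\<lambda>i. h (x i)) k"
proof -
  interpret group_hom G H h by (intro group_hom.intro group_hom_axioms.intro assms)
  show ?thesis using assms(4)
    by (induction k) (auto simp: G.pprod_closed)
qed

lemma eval_word_inverse: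
  assumes K: "group K" and f: "\<And>s. s \<in> S \<Longrightarrow> f s \<in> carrier K" and u: "u \<in> words S"
  shows "eval_word K f (inverse_word u) = inv\<^bsub>K\<^esub> eval_word K f u"
proof -
  interpret group K by (rule K)
  have "eval_word K f (inverse_word u) \<otimes>\<^bsub>K\<^esub> eval_word K f u = eval_word K f (inverse_word u @ u)"
    using eval_word_append[where S = S and f = f, OF K f inverse_word_words[OF u] u] by simp
  also have "\<dots> = eval_word K f []"
    by (rule eval_word_equiv[where S = S and f = f, OF K f _ inverse_word_left[OF u, of "{}"]]) auto
  finally show ?thesis
    using eval_word_closed[where S = S and f = f, OF K f] u by (intro inv_equality[symmetric]) auto
qed

text \<open>The offset \<open>a\<close> serves both numberings of letters that occur, from 0 and
  from 1.\<close>

lemma eval_word_concat: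
  assumes K: "group K" and f: "\<And>s. s \<in> S \<Longrightarrow> f s \<in> carrier K"
    and w: "\<And>i. i < k \<Longrightarrow> w (a + i) \<in> words S"
  shows "concat (map w [a..<a + k]) \<in> words S"
    and "eval_word K f (concat (map w [a..<a + k])) = pprod K (\<lambda>i. eval_word K f (w (a + i))) k"
proof -
  have "concat (map w [a..<a + k]) \<in> words S \<and>
    eval_word K f (concat (map w [a..<a + k])) = pprod K (\<lambda>i. eval_word K f (w (a + i))) k"
    using w
  proof (induction k)
    case (Suc k)
    then show ?case
      using eval_word_append[where S = S and f = f and u = "concat (map w [a..<a + k])" and v = "w (a + k)", OF K f]
      by simp
  qed simp
  then show "concat (map w [a..<a + k]) \<in> words S"
    "eval_word K f (concat (map w [a..<a + k])) = pprod K (\<lambda>i. eval_word K f (w (a + i))) k" by auto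
qed

context group begin

definition commutator :: "'a \<Rightarrow> 'a \<Rightarrow> 'a" where
  "commutator a b = a \<otimes> (b \<otimes> (inv a \<otimes> inv b))"

text \<open>With \<open>X\<^sub>k = x\<^sub>0 \<dots> x\<^sub>k\<^sub>-\<^sub>1\<close> and \<open>Y\<^sub>k = y\<^sub>0 \<dots> y\<^sub>k\<^sub>-\<^sub>1\<close>, the commutator of the following two elements
  is \<open>(Y\<^sub>k X\<^sub>k) x\<^sub>k y\<^sub>k (Y\<^sub>k\<^sub>+\<^sub>1 X\<^sub>k\<^sub>+\<^sub>1)\<^sup>-\<^sup>1\<close>, so that the product of these commutators telescopes.\<close>

definition handle_a :: "(nat \<Rightarrow> 'a) \<Rightarrow> (nat \<Rightarrow> 'a) \<Rightarrow> nat \<Rightarrow> 'a" where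
  "handle_a x y k = pprod G y k \<otimes> pprod G x (Suc k) \<otimes> inv pprod G y k"

definition handle_b :: "(nat \<Rightarrow> 'a) \<Rightarrow> nat \<Rightarrow> 'a" where
  "handle_b y k = pprod G y (Suc k) \<otimes> inv pprod G y k"

lemma pprod_commutators:
  assumes "\<And>i. i < k \<Longrightarrow> x i \<in> carrier G" "\<And>i. i < k \<Longrightarrow> y i \<in> carrier G"
  shows "pprod G (\<lambda>i. commutator (handle_a x y i) (handle_b y i)) k =
    pprod G (\<lambda>i. x i \<otimes> y i) k \<otimes> (inv pprod G x k \<otimes> inv pprod G y k)"
  using assms
proof (induction k)
  case (Suc k)
  have "x k \<in> carrier G" "y k \<in> carrier G" "pprod G x k \<in> carrier G" "pprod G y k \<in> carrier G"
    "pprod G (\<lambda>i. x i \<otimes> y i) k \<in> carrier G"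
    using Suc.prems by (auto intro!: pprod_closed)
  then show ?case
    using Suc by (simp add: commutator_def handle_a_def handle_b_def m_assoc inv_mult_group)
qed simp

text \<open>Conversely, \<open>Y\<^sub>k\<close> and \<open>X\<^sub>k\<close> are recovered from these elements as \<open>prod_y b k\<close> and
  \<open>prod_x a b k\<close>.\<close>

fun prod_y :: "(nat \<Rightarrow> 'a) \<Rightarrow> nat \<Rightarrow> 'a" where
  "prod_y b 0 = \<one>"
| "prod_y b (Suc k) = b k \<otimes> prod_y b k"

fun prod_x :: "(nat \<Rightarrow> 'a) \<Rightarrow> (nat \<Rightarrow> 'a) \<Rightarrow> nat \<Rightarrow> 'a" where
  "prod_x a b 0 = \<one>"
| "prod_x a b (Suc k) = inv prod_y b k \<otimes> a k \<otimes> prod_y b k"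

definition letter_y :: "(nat \<Rightarrow> 'a) \<Rightarrow> nat \<Rightarrow> 'a" where
  "letter_y b k = inv prod_y b k \<otimes> prod_y b (Suc k)"

definition letter_x :: "(nat \<Rightarrow> 'a) \<Rightarrow> (nat \<Rightarrow> 'a) \<Rightarrow> nat \<Rightarrow> 'a" where
  "letter_x a b k = inv prod_x a b k \<otimes> prod_x a b (Suc k)"

lemma prod_y_closed: "(\<And>i. i < k \<Longrightarrow> b i \<in> carrier G) \<Longrightarrow> prod_y b k \<in> carrier G"
  by (induction k) auto

lemma prod_x_closed:
  "(\<And>i. i < k \<Longrightarrow> a i \<in> carrier G) \<Longrightarrow> (\<And>i. i < k \<Longrightarrow> b i \<in> carrier G) \<Longrightarrow> prod_x a b k \<in> carrier G"
  using prod_y_closed[of "k - 1" b] by (cases k) auto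

lemma letters_closed:
  assumes "\<And>i. i \<le> k \<Longrightarrow> a i \<in> carrier G" "\<And>i. i \<le> k \<Longrightarrow> b i \<in> carrier G"
  shows "letter_x a b k \<in> carrier G" "letter_y b k \<in> carrier G"
proof -
  have "prod_y b k \<in> carrier G" "prod_x a b k \<in> carrier G"
    using assms by (auto intro!: prod_y_closed prod_x_closed)
  then show "letter_x a b k \<in> carrier G" "letter_y b k \<in> carrier G"
    using assms by (auto simp: letter_x_def letter_y_def)
qed

lemma handles_closed:
  assumes "\<And>i. i \<le> k \<Longrightarrow> x i \<in> carrier G" "\<And>i. i \<le> k \<Longrightarrow> y i \<in> carrier G"
  shows "handle_a x y k \<in> carrier G" "handle_b y k \<in> carrier G"
proof -
  have "pprod G x k \<in> carrier G" "pprod G y k \<in> carrier G"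
    using assms by (auto intro!: pprod_closed)
  then show "handle_a x y k \<in> carrier G" "handle_b y k \<in> carrier G"
    using assms by (auto simp: handle_a_def handle_b_def)
qed

lemma pprod_letter_y:
  "(\<And>i. i < k \<Longrightarrow> b i \<in> carrier G) \<Longrightarrow> pprod G (letter_y b) k = prod_y b k"
proof (induction k)
  case (Suc k)
  then have "prod_y b k \<in> carrier G" "b k \<in> carrier G" by (auto intro!: prod_y_closed)
  then show ?case using Suc by (simp add: letter_y_def)
qed simp

lemma pprod_letter_x:
  "(\<And>i. i < k \<Longrightarrow> a i \<in> carrier G) \<Longrightarrow> (\<And>i. i < k \<Longrightarrow> b i \<in> carrier G) \<Longrightarrow>
    pprod G (letter_x a b) k = prod_x a b k"
proof (induction k)
  case (Suc k)
  then have "prod_y b k \<in> carrier G" "a k \<in> carrier G" "prod_x a b k \<in> carrier G"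
    by (auto intro!: prod_y_closed prod_x_closed)
  then show ?case using Suc by (simp add: letter_x_def)
qed simp

lemma handles_of_letters:
  assumes "\<And>i. i \<le> k \<Longrightarrow> a i \<in> carrier G" "\<And>i. i \<le> k \<Longrightarrow> b i \<in> carrier G"
  shows "handle_a (letter_x a b) (letter_y b) k = a k" "handle_b (letter_y b) k = b k"
proof -
  have "prod_y b k \<in> carrier G" using assms by (auto intro!: prod_y_closed)
  moreover have "pprod G (letter_x a b) (Suc k) = prod_x a b (Suc k)" "pprod G (letter_y b) k = prod_y b k"
    "pprod G (letter_y b) (Suc k) = prod_y b (Suc k)"
    using assms by (intro pprod_letter_x pprod_letter_y; simp)+
  ultimately show "handle_a (letter_x a b) (letter_y b) k = a k" "handle_b (letter_y b) k = b k"
    using assms[of k] unfolding handle_a_def handle_b_def by (simp_all add: m_assoc del: pprod.simps)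
qed

lemma prod_y_handle_b:
  "(\<And>i. i < k \<Longrightarrow> y i \<in> carrier G) \<Longrightarrow> prod_y (handle_b y) k = pprod G y k"
proof (induction k)
  case (Suc k)
  then have "pprod G y k \<in> carrier G" "y k \<in> carrier G" by (auto intro!: pprod_closed)
  then show ?case using Suc by (simp add: handle_b_def m_assoc)
qed simp

lemma prod_x_handle_a:
  assumes "\<And>i. i < k \<Longrightarrow> x i \<in> carrier G" "\<And>i. i < k \<Longrightarrow> y i \<in> carrier G"
  shows "prod_x (handle_a x y) (handle_b y) k = pprod G x k"
proof (cases k)
  case (Suc j)
  have "pprod G y j \<in> carrier G" "pprod G x j \<in> carrier G" "x j \<in> carrier G"
    using assms Suc by (auto intro!: pprod_closed)
  then show ?thesis
    using prod_y_handle_b[of j y] assms Suc by (simp add: handle_a_def m_assoc)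
qed simp

lemma letters_of_handles:
  assumes "\<And>i. i \<le> k \<Longrightarrow> x i \<in> carrier G" "\<And>i. i \<le> k \<Longrightarrow> y i \<in> carrier G"
  shows "letter_x (handle_a x y) (handle_b y) k = x k" "letter_y (handle_b y) k = y k"
proof -
  have "pprod G y k \<in> carrier G" "pprod G x k \<in> carrier G"
    using assms by (auto intro!: pprod_closed)
  moreover have "prod_x (handle_a x y) (handle_b y) i = pprod G x i" "prod_y (handle_b y) i = pprod G y i"
    if "i \<le> Suc k" for i
    using assms that by (intro prod_x_handle_a prod_y_handle_b; simp)+
  ultimately show "letter_x (handle_a x y) (handle_b y) k = x k" "letter_y (handle_b y) k = y k"
    using assms[of k] unfolding letter_x_def letter_y_def
    by (simp_all add: m_assoc del: prod_x.simps prod_y.simps)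
qed

end

context group_hom begin

lemma hom_handles:
  assumes "\<And>i. i \<le> k \<Longrightarrow> x i \<in> carrier G" "\<And>i. i \<le> k \<Longrightarrow> y i \<in> carrier G"
  shows "h (G.handle_a x y k) = H.handle_a (\<lambda>i. h (x i)) (\<lambda>i. h (y i)) k"
    and "h (G.handle_b y k) = H.handle_b (\<lambda>i. h (y i)) k"
proof -
  have "pprod G x k \<in> carrier G" "pprod G y k \<in> carrier G" "x k \<in> carrier G" "y k \<in> carrier G"
    using assms by (auto intro!: G.pprod_closed)
  moreover have "h (pprod G x k) = pprod H (\<lambda>i. h (x i)) k" "h (pprod G y k) = pprod H (\<lambda>i. h (y i)) k"
    using assms by (auto intro!: hom_pprod G.is_group H.is_group homh)
  ultimately show "h (G.handle_a x y k) = H.handle_a (\<lambda>i. h (x i)) (\<lambda>i. h (y i)) k"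
    "h (G.handle_b y k) = H.handle_b (\<lambda>i. h (y i)) k"
    by (simp_all add: G.handle_a_def H.handle_a_def G.handle_b_def H.handle_b_def)
qed

lemma hom_prod_y:
  "(\<And>i. i < k \<Longrightarrow> b i \<in> carrier G) \<Longrightarrow> h (G.prod_y b k) = H.prod_y (\<lambda>i. h (b i)) k"
  by (induction k) (auto simp: G.prod_y_closed)

lemma hom_prod_x:
  assumes "\<And>i. i < k \<Longrightarrow> a i \<in> carrier G" "\<And>i. i < k \<Longrightarrow> b i \<in> carrier G"
  shows "h (G.prod_x a b k) = H.prod_x (\<lambda>i. h (a i)) (\<lambda>i. h (b i)) k"
  using assms by (cases k) (auto simp: G.prod_y_closed hom_prod_y)

lemma hom_letters:
  assumes "\<And>i. i \<le> k \<Longrightarrow> a i \<in> carrier G" "\<And>i. i \<le> k \<Longrightarrow> b i \<in> carrier G"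
  shows "h (G.letter_x a b k) = H.letter_x (\<lambda>i. h (a i)) (\<lambda>i. h (b i)) k"
    and "h (G.letter_y b k) = H.letter_y (\<lambda>i. h (b i)) k"
proof -
  have cl: "G.prod_x a b i \<in> carrier G" "G.prod_y b i \<in> carrier G" if "i \<le> Suc k" for i
    using assms that by (auto intro!: G.prod_x_closed G.prod_y_closed)
  have "h (G.prod_x a b i) = H.prod_x (\<lambda>i. h (a i)) (\<lambda>i. h (b i)) i"
    "h (G.prod_y b i) = H.prod_y (\<lambda>i. h (b i)) i" if "i \<le> Suc k" for i
    using assms that by (auto intro!: hom_prod_x hom_prod_y)
  then show "h (G.letter_x a b k) = H.letter_x (\<lambda>i. h (a i)) (\<lambda>i. h (b i)) k"
    "h (G.letter_y b k) = H.letter_y (\<lambda>i. h (b i)) k"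
    using cl[of k] cl[of "Suc k"]
    by (simp_all add: G.letter_x_def H.letter_x_def G.letter_y_def H.letter_y_def
        del: G.prod_x.simps H.prod_x.simps G.prod_y.simps H.prod_y.simps)
qed

end

context glued_polygons begin

lemma cl_ends:
  assumes "p \<in> P" "p' \<in> P" "k < n" "k' < n" "lab p k = lab p' k'"
  shows "cl (p, corner n (initial p k)) = cl (p', corner n (initial p' k'))"
    and "cl (p, corner n (terminal p k)) = cl (p', corner n (terminal p' k'))"
  using cl_eq[OF glue_edge[OF assms, of 0]] cl_eq[OF glue_edge[OF assms, of 1]]
  by (simp_all add: edge_ends)

lemma cl_eqD: "p \<in> P \<Longrightarrow> p' \<in> P \<Longrightarrow> w \<in> ngon n \<Longrightarrow> w' \<in> ngon n \<Longrightarrow> cl (p, w) = cl (p', w') \<Longrightarrow>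
    ((p, w), (p', w')) \<in> R"
  using eq_equiv_class[OF _ equiv_R] by blast

end

context group begin

lemma letters_cong:
  assumes "\<And>i. i \<le> k \<Longrightarrow> a i = a' i" "\<And>i. i \<le> k \<Longrightarrow> b i = b' i"
  shows "letter_x a b k = letter_x a' b' k" "letter_y b k = letter_y b' k"
proof -
  have y: "(\<And>i. i < j \<Longrightarrow> b i = b' i) \<Longrightarrow> prod_y b j = prod_y b' j" for j
    by (induction j) auto
  have "prod_x a b j = prod_x a' b' j" if "j \<le> Suc k" for j
    using that assms y[of "j - 1"] by (cases j) auto
  moreover have "prod_y b j = prod_y b' j" if "j \<le> Suc k" for j
    using that assms by (intro y) auto
  ultimately show "letter_x a b k = letter_x a' b' k" "letter_y b k = letter_y b' k"
    by (simp_all add: letter_x_def letter_y_def del: prod_x.simps prod_y.simps)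
qed

lemma handles_cong:
  assumes "\<And>i. i \<le> k \<Longrightarrow> x i = x' i" "\<And>i. i \<le> k \<Longrightarrow> y i = y' i"
  shows "handle_a x y k = handle_a x' y' k" "handle_b y k = handle_b y' k"
proof -
  have "pprod G x j = pprod G x' j" "pprod G y j = pprod G y' j" if "j \<le> Suc k" for j
    using assms that by (auto intro!: pprod_cong)
  then show "handle_a x y k = handle_a x' y' k" "handle_b y k = handle_b y' k"
    by (simp_all add: handle_a_def handle_b_def del: pprod.simps)
qed

end

lemma Plus_iff [simp]: "Inl a \<in> A <+> B \<longleftrightarrow> a \<in> A" "Inr b \<in> A <+> B \<longleftrightarrow> b \<in> B"
  by auto

section \<open>The surface word and the presentation of the surface group\<close>

lemma length_surface_word: "length (surface_word g) = 4 * g"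
  by (induction g) (simp_all add: surface_word_def)

lemma surface_word_Suc: "surface_word (Suc g) = surface_word g @
    [(Inl (Suc g), True), (Inr (Suc g), True), (Inl (Suc g), False), (Inr (Suc g), False)]"
  by (simp add: surface_word_def)

lemma surface_word_nth:
  "j < g \<Longrightarrow> i < 4 \<Longrightarrow> surface_word g ! (4 * j + i) =
    [(Inl (Suc j), True), (Inr (Suc j), True), (Inl (Suc j), False), (Inr (Suc j), False)] ! i"
proof (induction g)
  case (Suc g)
  show ?case
  proof (cases "j = g")
    case True
    then show ?thesis by (simp add: surface_word_Suc nth_append length_surface_word)
  next
    case False
    then show ?thesis using Suc by (simp add: surface_word_Suc nth_append length_surface_word)
  qed
qed simp

lemma set_surface_word: "fst ` set (surface_word g) = {Suc 0..g} <+> {Suc 0..g}"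
  by (induction g)
    (auto simp: surface_word_Suc surface_word_def[of 0] atLeastAtMostSuc_conv)

text \<open>In each block of four sides, gluing \<open>a\<^sub>k\<close> and
  \<open>b\<^sub>k\<close> with their inverses identifies all five corners. The surface thus has a
  single vertex, and \<open>C = {0}\<close> suffices.\<close>

lemma rooted_surface:
  assumes "g \<ge> 1"
  shows "rooted_polygons {()} (\<lambda>_. surface_word g) (4 * g) () {0} (\<lambda>_ _. 0)"
proof -
  interpret glued_polygons "{()}" "\<lambda>_. surface_word g" "4 * g"
    by unfold_locales (use assms in \<open>auto simp: length_surface_word\<close>)
  let ?c = "\<lambda>k. cl ((), corner (4 * g) k)"
  have nth: "surface_word g ! (4 * j) = (Inl (Suc j), True)"
    "surface_word g ! Suc (4 * j) = (Inr (Suc j), True)"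
    "surface_word g ! Suc (Suc (4 * j)) = (Inl (Suc j), False)"
    "surface_word g ! Suc (Suc (Suc (4 * j))) = (Inr (Suc j), False)"
    if "j < g" for j
    using surface_word_nth[OF that, of 0] surface_word_nth[OF that, of "Suc 0"]
      surface_word_nth[OF that, of "Suc (Suc 0)"] surface_word_nth[OF that, of "Suc (Suc (Suc 0))"]
    by simp_all
  have step: "?c (Suc (4 * j)) = ?c (4 * j)" "?c (Suc (Suc (4 * j))) = ?c (4 * j)"
    "?c (Suc (Suc (Suc (4 * j)))) = ?c (4 * j)" "?c (Suc (Suc (Suc (Suc (4 * j))))) = ?c (4 * j)"
    if j: "j < g" for j
  proof -
    have "Suc (Suc (Suc (4 * j))) < 4 * g" using j by presburger
    then show "?c (Suc (4 * j)) = ?c (4 * j)" "?c (Suc (Suc (4 * j))) = ?c (4 * j)"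
      "?c (Suc (Suc (Suc (4 * j)))) = ?c (4 * j)" "?c (Suc (Suc (Suc (Suc (4 * j))))) = ?c (4 * j)"
      using cl_ends[of "()" "()" "4 * j" "Suc (Suc (4 * j))"]
        cl_ends[of "()" "()" "Suc (4 * j)" "Suc (Suc (Suc (4 * j)))"]
      by (simp_all add: nth[OF j] initial_def terminal_def)
  qed
  have base: "j \<le> g \<Longrightarrow> ?c (4 * j) = ?c 0" for j
  proof (induction j)
    case (Suc j)
    have "4 * Suc j = Suc (Suc (Suc (Suc (4 * j))))" by simp
    then show ?case using Suc step(4)[of j] by (simp only: Suc_le_eq less_imp_le)
  qed simp
  have all: "?c k = ?c 0" if "k < 4 * g" for k
  proof -
    define j where "j = k div 4"
    have j: "j < g" using that by (auto simp: j_def)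
    have "k = 4 * j \<or> k = Suc (4 * j) \<or> k = Suc (Suc (4 * j)) \<or> k = Suc (Suc (Suc (4 * j)))"
      unfolding j_def by presburger
    then have "?c k = ?c (4 * j)"
      using step[OF j] by metis
    then show ?thesis using base[of j] j by simp
  qed
  show ?thesis
  proof
    fix p :: unit and k assume "k < 4 * g"
    then show "((p, corner (4 * g) k), (), corner (4 * g) 0) \<in> R"
      using all[of k] assms by (intro cl_eqD corner_in_ngon) auto
  qed (use assms in auto)
qed

text \<open>The empty word among the relators is the prefix belonging to the only corner in
  \<open>C\<close>.\<close>

lemma surface_group_presentation:
  assumes g: "g \<ge> 1"
  shows "surface_group g \<cong> presented_group ({Suc 0..g} <+> {Suc 0..g}) {surface_word g, []}"
proof -
  interpret rooted_polygons "{()}" "\<lambda>_. surface_word g" "4 * g" "()" "{0}" "\<lambda>_ _. 0"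
    by (rule rooted_surface[OF g])
  have 1: "(1::complex) = corner (4 * g) 0" by (simp add: corner_def)
  have "cl ((), 1) \<in> topspace X"
    unfolding 1 using corner_in by (intro cl_in) auto
  from fundamental_group_presentation[OF this]
  show ?thesis
    by (simp add: surface_group_def closed_surface_def labels_def relators_def set_surface_word insert_commute)
qed

text \<open>The word of a polygon with both letters of last superscript replaced by inverses of the
  products of the other letters in their families. The ranges are written \<open>0 + g\<close> to
  match \<open>eval_word_concat\<close>.\<close>

definition xy_word :: "nat \<Rightarrow> (nat + nat) word" where
  "xy_word g = concat (map (\<lambda>k. [(Inl k, True), (Inr k, True)]) [0..<0 + g]) @
     inverse_word (concat (map (\<lambda>k. [(Inl k, True)]) [0..<0 + g])) @
     inverse_word (concat (map (\<lambda>k. [(Inr k, True)]) [0..<0 + g]))"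

abbreviation xy_letters :: "nat \<Rightarrow> (nat + nat) set" where
  "xy_letters g \<equiv> {..<g} <+> {..<g}"

lemma eval_single: "monoid K \<Longrightarrow> f s \<in> carrier K \<Longrightarrow> eval_word K f [(s, True)] = f s"
  by (simp add: eval_word_def monoid.r_one)

lemma eval_pair: "monoid K \<Longrightarrow> f s \<in> carrier K \<Longrightarrow> f t \<in> carrier K \<Longrightarrow>
    eval_word K f [(s, True), (t, True)] = f s \<otimes>\<^bsub>K\<^esub> f t"
  by (simp add: eval_word_def monoid.r_one)

lemma xy_word_eval:
  assumes K: "group K" and f: "\<And>s. s \<in> xy_letters g \<Longrightarrow> f s \<in> carrier K"
  shows "xy_word g \<in> words (xy_letters g)"
    and "eval_word K f (xy_word g) = pprod K (\<lambda>k. f (Inl k) \<otimes>\<^bsub>K\<^esub> f (Inr k)) g \<otimes>\<^bsub>K\<^esub>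
      (inv\<^bsub>K\<^esub> pprod K (\<lambda>k. f (Inl k)) g \<otimes>\<^bsub>K\<^esub> inv\<^bsub>K\<^esub> pprod K (\<lambda>k. f (Inr k)) g)"
proof -
  interpret group K by (rule K)
  let ?S = "xy_letters g"
  let ?z = "concat (map (\<lambda>k. [(Inl k, True), (Inr k, True)]) [0..<0 + g])"
  let ?x = "concat (map (\<lambda>k. [(Inl k, True)]) [0..<0 + g])"
  let ?y = "concat (map (\<lambda>k. [(Inr k, True)]) [0..<0 + g])"
  have fc: "f (Inl k) \<in> carrier K" "f (Inr k) \<in> carrier K" if "k < g" for k
    using that by (auto intro!: f)
  note ev = eval_word_concat[where S = ?S and f = f and K = K and a = 0 and k = g, OF K f]
  have z: "?z \<in> words ?S" "eval_word K f ?z = pprod K (\<lambda>k. f (Inl k) \<otimes>\<^bsub>K\<^esub> f (Inr k)) g"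
    using ev[of "\<lambda>k. [(Inl k, True), (Inr k, True)]"] fc
    by (auto simp: eval_pair[OF is_monoid] intro!: pprod_cong)
  have x: "?x \<in> words ?S" "eval_word K f ?x = pprod K (\<lambda>k. f (Inl k)) g"
    using ev[of "\<lambda>k. [(Inl k, True)]"] fc by (auto simp: eval_single[OF is_monoid] intro!: pprod_cong)
  have y: "?y \<in> words ?S" "eval_word K f ?y = pprod K (\<lambda>k. f (Inr k)) g"
    using ev[of "\<lambda>k. [(Inr k, True)]"] fc by (auto simp: eval_single[OF is_monoid] intro!: pprod_cong)
  show "xy_word g \<in> words ?S"
    unfolding xy_word_def using x(1) y(1) z(1) by simp
  have "eval_word K f (xy_word g) = eval_word K f ?z \<otimes>\<^bsub>K\<^esub> eval_word K f (inverse_word ?x @ inverse_word ?y)"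
    unfolding xy_word_def
    by (rule eval_word_append[where S = ?S and f = f, OF K f z(1)]) (use x(1) y(1) in simp_all)
  also have "eval_word K f (inverse_word ?x @ inverse_word ?y) =
      eval_word K f (inverse_word ?x) \<otimes>\<^bsub>K\<^esub> eval_word K f (inverse_word ?y)"
    by (rule eval_word_append[where S = ?S and f = f, OF K f]) (use x(1) y(1) in simp_all)
  also have "eval_word K f (inverse_word ?x) = inv\<^bsub>K\<^esub> eval_word K f ?x"
    by (rule eval_word_inverse[where S = ?S and f = f, OF K f x(1)])
  also have "eval_word K f (inverse_word ?y) = inv\<^bsub>K\<^esub> eval_word K f ?y"
    by (rule eval_word_inverse[where S = ?S and f = f, OF K f y(1)])
  finally show "eval_word K f (xy_word g) = pprod K (\<lambda>k. f (Inl k) \<otimes>\<^bsub>K\<^esub> f (Inr k)) g \<otimes>\<^bsub>K\<^esub>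
      (inv\<^bsub>K\<^esub> pprod K (\<lambda>k. f (Inl k)) g \<otimes>\<^bsub>K\<^esub> inv\<^bsub>K\<^esub> pprod K (\<lambda>k. f (Inr k)) g)"
    by (simp only: x(2) y(2) z(2))
qed

lemma surface_word_eval:
  assumes K: "group K" and f: "\<And>s. s \<in> {Suc 0..g} <+> {Suc 0..g} \<Longrightarrow> f s \<in> carrier K"
  shows "surface_word g \<in> words ({Suc 0..g} <+> {Suc 0..g})"
    and "eval_word K f (surface_word g) =
      pprod K (\<lambda>k. group.commutator K (f (Inl (Suc k))) (f (Inr (Suc k)))) g"
proof -
  interpret group K by (rule K)
  let ?w = "\<lambda>k. [(Inl k, True), (Inr k, True), (Inl k, False), (Inr k, False)]"
  have fc: "f (Inl (Suc k)) \<in> carrier K" "f (Inr (Suc k)) \<in> carrier K" if "k < g" for k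
    using that by (auto intro!: f)
  have w: "?w (1 + i) \<in> words ({Suc 0..g} <+> {Suc 0..g})" if "i < g" for i
    using that by auto
  have c: "eval_word K f (?w (1 + i)) = commutator (f (Inl (Suc i))) (f (Inr (Suc i)))" if "i < g" for i
    using fc[OF that] by (simp add: eval_word_def commutator_def)
  note ev = eval_word_concat[where S = "{Suc 0..g} <+> {Suc 0..g}" and f = f and K = K and a = 1 and k = g
      and w = ?w, OF K f w]
  show "surface_word g \<in> words ({Suc 0..g} <+> {Suc 0..g})"
    using ev(1) by (simp add: surface_word_def)
  have "eval_word K f (surface_word g) = pprod K (\<lambda>i. eval_word K f (?w (1 + i))) g"
    using ev(2) by (simp add: surface_word_def)
  also have "\<dots> = pprod K (\<lambda>k. commutator (f (Inl (Suc k))) (f (Inr (Suc k)))) g"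
    by (rule pprod_cong) (rule c)
  finally show "eval_word K f (surface_word g) =
      pprod K (\<lambda>k. commutator (f (Inl (Suc k))) (f (Inr (Suc k)))) g" .
qed

text \<open>The single identity \<open>pprod_commutators\<close> carries each relator to the other,
  and handles and letters are mutually inverse substitutions.\<close>

lemma surface_group_xy:
  assumes g: "g \<ge> 1"
  shows "surface_group g \<cong> presented_group (xy_letters g) {xy_word g}"
proof -
  let ?S = "{Suc 0..g} <+> {Suc 0..g}" and ?R = "{surface_word g, []}"
  let ?T = "xy_letters g" and ?Q = "{xy_word g}"
  let ?G = "presented_group ?S ?R" and ?H = "presented_group ?T ?Q"
  interpret G: group ?G by (rule group_presented_group)
  interpret H: group ?H by (rule group_presented_group)
  define a where "a = (\<lambda>k. generator ?S ?R (Inl (Suc k)))"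
  define b where "b = (\<lambda>k. generator ?S ?R (Inr (Suc k)))"
  define x where "x = (\<lambda>k. generator ?T ?Q (Inl k))"
  define y where "y = (\<lambda>k. generator ?T ?Q (Inr k))"
  have ab: "a k \<in> carrier ?G" "b k \<in> carrier ?G" if "k < g" for k
    unfolding a_def b_def using that by (auto intro!: generator_closed)
  have xy: "x k \<in> carrier ?H" "y k \<in> carrier ?H" if "k < g" for k
    unfolding x_def y_def using that by (auto intro!: generator_closed)
  \<comment> \<open>Surface letters are numbered from 1 and the letters of \<open>xy_word\<close>
    from 0, hence the shift.\<close>
  define f where "f = case_sum (\<lambda>k. H.handle_a x y (k - 1)) (\<lambda>k. H.handle_b y (k - 1))"
  define f' where "f' = case_sum (\<lambda>k. G.letter_x a b k) (\<lambda>k. G.letter_y b k)"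
  have f: "f s \<in> carrier ?H" if "s \<in> ?S" for s
    using that xy by (auto simp: f_def intro!: H.handles_closed)
  have f': "f' s \<in> carrier ?G" if "s \<in> ?T" for s
    using that ab by (auto simp: f'_def intro!: G.letters_closed)
  have genG: "generator ?S ?R s \<in> carrier ?G" if "s \<in> ?S" for s
    using that by (rule generator_closed)
  have genH: "generator ?T ?Q s \<in> carrier ?H" if "s \<in> ?T" for s
    using that by (rule generator_closed)
  have sw: "surface_word g \<in> words ?S"
    by (rule surface_word_eval(1)[OF G.is_group genG])
  have xw: "xy_word g \<in> words ?T"
    by (rule xy_word_eval(1)[OF H.is_group genH])
  have "?G \<cong> ?H"
  proof (rule presented_group_iso[where f = f and f' = f'])
    fix r assume r: "r \<in> ?R"
    have "eval_word ?H f (surface_word g) = pprod ?H (\<lambda>i. H.commutator (H.handle_a x y i) (H.handle_b y i)) g"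
      using surface_word_eval(2)[OF H.is_group f] by (simp add: f_def)
    also have "\<dots> = eval_word ?H (generator ?T ?Q) (xy_word g)"
      using xy by (simp add: H.pprod_commutators xy_word_eval(2)[OF H.is_group genH] x_def y_def)
    also have "\<dots> = \<one>\<^bsub>?H\<^esub>" by (rule eval_generator_relator) (use xw in auto)
    finally have e: "eval_word ?H f (surface_word g) = \<one>\<^bsub>?H\<^esub>" .
    from r consider "r = surface_word g" | "r = []" by blast
    then show "r \<in> words ?S \<and> eval_word ?H f r = \<one>\<^bsub>?H\<^esub>"
      by cases (simp_all only: e sw words_simps eval_word_Nil simp_thms)
  next
    fix r assume r: "r \<in> ?Q"
    have lc: "G.letter_x a b i \<in> carrier ?G" "G.letter_y b i \<in> carrier ?G" if "i < g" for i
      using ab that by (auto intro!: G.letters_closed)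
    have "eval_word ?G f' (xy_word g) = pprod ?G (\<lambda>k. G.letter_x a b k \<otimes>\<^bsub>?G\<^esub> G.letter_y b k) g \<otimes>\<^bsub>?G\<^esub>
      (inv\<^bsub>?G\<^esub> pprod ?G (G.letter_x a b) g \<otimes>\<^bsub>?G\<^esub> inv\<^bsub>?G\<^esub> pprod ?G (G.letter_y b) g)"
      using xy_word_eval(2)[OF G.is_group f'] by (simp add: f'_def)
    also have "\<dots> = pprod ?G (\<lambda>i. G.commutator (G.handle_a (G.letter_x a b) (G.letter_y b) i)
        (G.handle_b (G.letter_y b) i)) g"
      by (rule G.pprod_commutators[symmetric]) (use lc in auto)
    also have "\<dots> = pprod ?G (\<lambda>i. G.commutator (a i) (b i)) g"
      by (intro pprod_cong) (use ab G.handles_of_letters[of _ a b] in simp)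
    also have "\<dots> = eval_word ?G (generator ?S ?R) (surface_word g)"
      by (simp add: surface_word_eval(2)[OF G.is_group genG] a_def b_def)
    also have "\<dots> = \<one>\<^bsub>?G\<^esub>" by (rule eval_generator_relator) (use sw in auto)
    finally show "r \<in> words ?T \<and> eval_word ?G f' r = \<one>\<^bsub>?G\<^esub>" using r xw by simp
  next
    fix h s assume h: "h \<in> hom ?G ?H" "\<And>s. s \<in> ?S \<Longrightarrow> h (generator ?S ?R s) = f s" and s: "s \<in> ?T"
    interpret h: group_hom ?G ?H h
      by (intro group_hom.intro group_hom_axioms.intro G.is_group H.is_group h(1))
    have hab: "h (a i) = H.handle_a x y i" "h (b i) = H.handle_b y i" if "i < g" for i
      using h(2)[of "Inl (Suc i)"] h(2)[of "Inr (Suc i)"] that by (auto simp: a_def b_def f_def)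
    have "h (G.letter_x a b k) = x k" "h (G.letter_y b k) = y k" if k: "k < g" for k
    proof -
      have "h (G.letter_x a b k) = H.letter_x (\<lambda>i. h (a i)) (\<lambda>i. h (b i)) k"
        "h (G.letter_y b k) = H.letter_y (\<lambda>i. h (b i)) k"
        using ab k by (auto intro!: h.hom_letters)
      moreover have "H.letter_x (\<lambda>i. h (a i)) (\<lambda>i. h (b i)) k = H.letter_x (H.handle_a x y) (H.handle_b y) k"
        "H.letter_y (\<lambda>i. h (b i)) k = H.letter_y (H.handle_b y) k"
        using hab k by (auto intro!: H.letters_cong)
      ultimately show "h (G.letter_x a b k) = x k" "h (G.letter_y b k) = y k"
        using H.letters_of_handles[of k x y] xy k by auto
    qed
    then show "h (f' s) = generator ?T ?Q s" using s by (auto simp: f'_def x_def y_def)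
  next
    fix h s assume h: "h \<in> hom ?H ?G" "\<And>s. s \<in> ?T \<Longrightarrow> h (generator ?T ?Q s) = f' s" and s: "s \<in> ?S"
    interpret h: group_hom ?H ?G h
      by (intro group_hom.intro group_hom_axioms.intro G.is_group H.is_group h(1))
    have hxy: "h (x i) = G.letter_x a b i" "h (y i) = G.letter_y b i" if "i < g" for i
      using h(2)[of "Inl i"] h(2)[of "Inr i"] that by (auto simp: x_def y_def f'_def)
    have "h (H.handle_a x y k) = a k" "h (H.handle_b y k) = b k" if k: "k < g" for k
    proof -
      have "h (H.handle_a x y k) = G.handle_a (\<lambda>i. h (x i)) (\<lambda>i. h (y i)) k"
        "h (H.handle_b y k) = G.handle_b (\<lambda>i. h (y i)) k"
        using xy k by (auto intro!: h.hom_handles)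
      moreover have "G.handle_a (\<lambda>i. h (x i)) (\<lambda>i. h (y i)) k = G.handle_a (G.letter_x a b) (G.letter_y b) k"
        "G.handle_b (\<lambda>i. h (y i)) k = G.handle_b (G.letter_y b) k"
        using hxy k by (auto intro!: G.handles_cong)
      ultimately show "h (H.handle_a x y k) = a k" "h (H.handle_b y k) = b k"
        using G.handles_of_letters[of k a b] ab k by auto
    qed
    note this[of "k - 1" for k]
    then show "h (f s) = generator ?S ?R s" using s by (auto simp: f_def a_def b_def)
  qed (use f f' in auto)
  then show ?thesis
    using iso_trans[OF surface_group_presentation[OF g]] by blast
qed

section \<open>The complex of a complete bipartite graph\<close>

lemma length_edge_word: "length (edge_word m p) = 2 * m"
  by (cases p, induction m) (simp_all add: edge_word_def)

lemma edge_word_Suc: "edge_word (Suc m) (i, j) =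
    edge_word m (i, j) @ [(Edge_x i (Suc m), True), (Edge_y j (Suc m), True)]"
  by (simp add: edge_word_def)

lemma edge_word_nth:
  "k < m \<Longrightarrow> edge_word m (i, j) ! (2 * k) = (Edge_x i (Suc k), True) \<and>
    edge_word m (i, j) ! Suc (2 * k) = (Edge_y j (Suc k), True)"
proof (induction m)
  case (Suc m)
  show ?case
  proof (cases "k = m")
    case True
    then show ?thesis by (simp add: edge_word_Suc nth_append length_edge_word)
  next
    case False
    then have "k < m" using Suc.prems by simp
    then show ?thesis using Suc.IH by (simp add: edge_word_Suc nth_append length_edge_word)
  qed
qed simp

text \<open>The Boolean lets both families of labels be treated at once; superscripts are counted
  from 0 here.\<close>

definition letter :: "bool \<Rightarrow> nat \<Rightarrow> nat \<Rightarrow> edge_label" where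
  "letter b i k = (if b then Edge_x i (Suc k) else Edge_y i (Suc k))"

lemma set_edge_word:
  "fst ` set (edge_word m (i, j)) = letter True i ` {..<m} \<union> letter False j ` {..<m}"
  by (induction m) (auto simp: edge_word_Suc edge_word_def[of 0] letter_def lessThan_Suc)

lemma edge_word_nth':
  assumes "k < 2 * m"
  shows "edge_word m (i, j) ! k = (letter (even k) (if even k then i else j) (k div 2), True)"
proof -
  have "k div 2 < m" using assms by simp
  from edge_word_nth[OF this, of i j] show ?thesis
    by (cases "even k") (auto simp: letter_def elim!: evenE oddE)
qed

lemma letter_inject [simp]: "letter b i k = letter b' i' k' \<longleftrightarrow> b = b' \<and> i = i' \<and> k = k'"
  by (auto simp: letter_def)

text \<open>A label has the same position in every polygon that contains it, so the position of a
  corner is an invariant of the vertex and \<open>P\<^sub>1\<^sub>1\<close> contains each vertex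
  once. The reduction modulo \<open>2 * m\<close> only matters for the repeated corner
  \<open>2 * m\<close>.\<close>

lemma rooted_bipartite:
  assumes m: "m \<ge> 2" and q: "q1 \<ge> 1" "q2 \<ge> 1"
  shows "rooted_polygons (complete_bipartite q1 q2) (edge_word m) (2 * m) (1, 1) {..<2 * m}
    (\<lambda>_ k. k mod (2 * m))"
proof -
  let ?P = "complete_bipartite q1 q2" and ?n = "2 * m"
  interpret glued_polygons ?P "edge_word m" ?n
    by unfold_locales (use m in \<open>auto simp: complete_bipartite_def length_edge_word\<close>)
  have P: "(i, j) \<in> ?P \<longleftrightarrow> 1 \<le> i \<and> i \<le> q1 \<and> 1 \<le> j \<and> j \<le> q2" for i j
    by (auto simp: complete_bipartite_def)
  have it: "initial p k = k" "terminal p k = Suc k" if "k < ?n" for p k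
    using edge_word_nth'[OF that] by (cases p; simp add: initial_def terminal_def)+
  have lab_eq: "k = k'" if "lab p k = lab p' k'" "k < ?n" "k' < ?n" for p k p' k'
  proof -
    have "even k = even k'" "k div 2 = k' div 2"
      using that edge_word_nth'[OF that(2)] edge_word_nth'[OF that(3)] by (cases p; cases p'; simp)+
    then show ?thesis by (metis bit_eq_rec even_iff_mod_2_eq_zero mod2_eq_if div_mult_mod_eq)
  qed
  let ?c = "\<lambda>p k. cl (p, corner ?n k)"
  have c_wrap: "?c p ?n = ?c p 0" for p using corner_wrap[of ?n] m by simp
  have c_init: "?c p k = ?c p' k" if "p \<in> ?P" "p' \<in> ?P" "k < ?n" "lab p k = lab p' k" for p p' k
    using cl_ends(1)[OF that(1,2,3,3,4)] that(3) by (simp add: it)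
  have c_term: "?c p (Suc k) = ?c p' (Suc k)" if "p \<in> ?P" "p' \<in> ?P" "k < ?n" "lab p k = lab p' k" for p p' k
    using cl_ends(2)[OF that(1,2,3,3,4)] that(3) by (simp add: it)
  have lab: "lab (i, j) k = lab (i', j') k" if "k < ?n" "if even k then i = i' else j = j'" for i j i' j' k
    using that by (simp add: edge_word_nth')
  \<comment> \<open>Of the two sides meeting at a corner one carries an \<open>x\<close> letter and
    the other a \<open>y\<close> letter. If only one index changes, one of these sides is common to
    both polygons.\<close>
  have move: "?c (i, j) k = ?c (i', j') k"
    if ij: "(i, j) \<in> ?P" "(i', j') \<in> ?P" and k: "k < ?n" and eq: "i = i' \<or> j = j'" for i j i' j' k
  proof (cases "if even k then i = i' else j = j'")
    case True
    then show ?thesis using c_init[OF ij k] lab[OF k] by blast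
  next
    case False
    \<comment> \<open>The cyclically preceding side, which ends at corner \<open>k\<close>.\<close>
    define k' where "k' = (if k = 0 then ?n - 1 else k - 1)"
    have k': "k' < ?n" "even k' \<longleftrightarrow> odd k" "?c p (Suc k') = ?c p k" for p
      using k m c_wrap[of p] by (auto simp: k'_def)
    have "if even k' then i = i' else j = j'" using False eq k'(2) by (auto split: if_splits)
    then have "?c (i, j) (Suc k') = ?c (i', j') (Suc k')"
      using c_term[OF ij k'(1)] lab[OF k'(1)] by blast
    then show ?thesis using k'(3) by simp
  qed
  show ?thesis
  proof
    fix p k assume p: "p \<in> ?P" and k: "k < ?n"
    obtain i j where ij: "p = (i, j)" by (cases p)
    have "?c (i, j) k = ?c (i, 1) k" "?c (i, 1) k = ?c (1, 1) k"
      using p k q by (intro move; simp add: P ij)+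
    then show "((p, corner ?n k), (1, 1), corner ?n (k mod ?n)) \<in> R"
      using p k q by (intro cl_eqD corner_in_ngon) (auto simp: P ij)
  next
    fix p p' k k' assume "k < ?n" "k' < ?n" "lab p k = lab p' k'"
    then show "initial p k mod ?n = initial p' k' mod ?n \<and> terminal p k mod ?n = terminal p' k' mod ?n"
      using lab_eq[of p k p' k'] by (simp add: it)
  qed (use m q in \<open>auto simp: P\<close>)
qed

lemma eval_edge_word:
  assumes K: "group K" and f: "\<And>s. s \<in> S \<Longrightarrow> f s \<in> carrier K"
    and S: "\<And>k. k < m \<Longrightarrow> letter True i k \<in> S \<and> letter False j k \<in> S"
  shows "eval_word K f (edge_word m (i, j)) =
    pprod K (\<lambda>k. f (letter True i k) \<otimes>\<^bsub>K\<^esub> f (letter False j k)) m"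
proof -
  interpret group K by (rule K)
  have "eval_word K f (edge_word m (i, j)) =
      pprod K (\<lambda>k. eval_word K f [(Edge_x i (1 + k), True), (Edge_y j (1 + k), True)]) m"
    using eval_word_concat(2)[where S = S and f = f and K = K and a = 1 and k = m and
        w = "\<lambda>k. [(Edge_x i k, True), (Edge_y j k, True)]", OF K f] S
    by (simp add: edge_word_def letter_def)
  also have "\<dots> = pprod K (\<lambda>k. f (letter True i k) \<otimes>\<^bsub>K\<^esub> f (letter False j k)) m"
    using S f by (intro pprod_cong) (simp add: letter_def eval_pair[OF is_monoid])
  finally show ?thesis .
qed

lemma eval_word_trivial:
  assumes "group K" "\<And>s. s \<in> fst ` set u \<Longrightarrow> f s = \<one>\<^bsub>K\<^esub>"
  shows "eval_word K f u = \<one>\<^bsub>K\<^esub>"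
proof -
  interpret group K by (rule assms)
  show ?thesis using assms(2)
  proof (induction u)
    case (Cons x u)
    then show ?case by (cases x) (simp add: eval_word_def)
  qed simp
qed

section \<open>Surface groups with free subgroups\<close>

lemma group_surface_group:
  assumes "g \<ge> 1"
  shows "group (surface_group g)"
proof -
  interpret rooted_polygons "{()}" "\<lambda>_. surface_word g" "4 * g" "()" "{0}" "\<lambda>_ _. 0"
    by (rule rooted_surface[OF assms])
  have 1: "(1::complex) = corner (4 * g) 0" by (simp add: corner_def)
  have "cl ((), 1) \<in> topspace X"
    unfolding 1 using corner_in by (intro cl_in) auto
  then show ?thesis
    unfolding surface_group_def closed_surface_def by (rule group_fundamental_group)
qed

definition xy_letter :: "bool \<Rightarrow> nat \<Rightarrow> nat + nat" where
  "xy_letter b k = (if b then Inl k else Inr k)"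

text \<open>Setting the letters of the other family to \<open>1\<close> trivialises the relator, so the surface
  group retracts onto the subgroup generated by one family.\<close>

lemma free_embedding:
  "\<exists>e \<in> mon (free_group g) (presented_group (xy_letters g) {xy_word g}).
    \<forall>k<g. e (generator {..<g} {} k) = generator (xy_letters g) {xy_word g} (xy_letter b k)"
proof -
  let ?S = "xy_letters g" and ?R = "{xy_word g}"
  let ?G = "presented_group ?S ?R" and ?F = "presented_group {..<g} {}"
  let ?k = "generator {..<g} {}"
  interpret F: group ?F by (rule group_presented_group)
  have G: "group ?G" by (rule group_presented_group)
  have kc: "?k i \<in> carrier ?F" if "i < g" for i using that by (intro generator_closed) simp
  have "\<exists>e\<in>hom ?F ?G. \<forall>k\<in>{..<g}. e (?k k) = generator ?S ?R (xy_letter b k)"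
    by (rule presented_group_universal[OF G]) (auto simp: xy_letter_def intro!: generator_closed)
  then obtain e where e: "e \<in> hom ?F ?G" "\<forall>k<g. e (?k k) = generator ?S ?R (xy_letter b k)"
    by auto
  define f where "f = case_sum (\<lambda>k. if b then ?k k else \<one>\<^bsub>?F\<^esub>) (\<lambda>k. if b then \<one>\<^bsub>?F\<^esub> else ?k k)"
  have f: "f s \<in> carrier ?F" if "s \<in> ?S" for s using that kc by (auto simp: f_def)
  have pk: "pprod ?F ?k g \<in> carrier ?F" using kc by (intro F.pprod_closed)
  have pb: "pprod ?F (\<lambda>i. ?k i \<otimes>\<^bsub>?F\<^esub> \<one>\<^bsub>?F\<^esub>) g = pprod ?F ?k g"
    "pprod ?F (\<lambda>i. \<one>\<^bsub>?F\<^esub> \<otimes>\<^bsub>?F\<^esub> ?k i) g = pprod ?F ?k g"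
    using kc by (auto intro!: pprod_cong)
  \<comment> \<open>With one family set to the unit, the word evaluates to the product of the other
    family times its inverse.\<close>
  have "eval_word ?F f (xy_word g) = \<one>\<^bsub>?F\<^esub>"
    using xy_word_eval(2)[OF F.is_group f] pk by (cases b) (simp_all add: f_def pb F.pprod_one)
  then have "\<exists>r\<in>hom ?G ?F. \<forall>s\<in>?S. r (generator ?S ?R s) = f s"
    using xy_word_eval(1)[OF F.is_group f] by (intro presented_group_universal[OF F.is_group f]) auto
  then obtain r where r: "r \<in> hom ?G ?F" "\<And>s. s \<in> ?S \<Longrightarrow> r (generator ?S ?R s) = f s" by blast
  have "r (e z) = z" if z: "z \<in> carrier ?F" for z
  proof (rule presented_group_hom_unique[OF F.is_group generator_closed _ _ _ z])
    show "(\<lambda>z. r (e z)) \<in> hom ?F ?F" using hom_compose[OF e(1) r(1)] by (simp add: o_def)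
    show "(\<lambda>z. z) \<in> hom ?F ?F" by (simp add: hom_def)
    show "r (e (?k k)) = ?k k" if "k \<in> {..<g}" for k
      using that e(2) r(2)[of "xy_letter b k"] by (auto simp: xy_letter_def f_def)
  qed
  then have "inj_on e (carrier ?F)" by (rule inj_on_inverseI)
  then show ?thesis using e by (auto simp: mon_def free_group_def)
qed

section \<open>The fundamental group as an amalgam\<close>

text \<open>An arrow of the diagram starts at the free group of a vertex of the graph, \<open>True\<close> standing for
  the vertices \<open>x\<^sub>i\<close> and \<open>False\<close> for the vertices \<open>y\<^sub>j\<close>, \<open>i, j \<ge> 2\<close>.\<close>

definition vertex_index :: "bool \<Rightarrow> nat \<Rightarrow> nat" where
  "vertex_index b i = prod_encode (if b then 0 else 1, i)"

definition edge_index :: "nat \<Rightarrow> nat \<Rightarrow> nat" where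
  "edge_index i j = prod_encode (i, j)"

text \<open>Each surface group receives two arrows, one of either kind, and the free group of a
  vertex maps to the surface groups of all edges at it with both indices at least 2.\<close>

definition amalgam_arrows :: "nat \<Rightarrow> nat \<Rightarrow> (nat \<times> nat) set" where
  "amalgam_arrows q1 q2 = {(vertex_index b (if b then i else j), edge_index i j) | b i j.
     i \<in> {2..q1} \<and> j \<in> {2..q2}}"

lemma index_inject [simp]:
  "vertex_index b i = vertex_index b' i' \<longleftrightarrow> b = b' \<and> i = i'"
  "edge_index i j = edge_index i' j' \<longleftrightarrow> i = i' \<and> j = j'"
  by (auto simp: vertex_index_def edge_index_def inj_eq[OF inj_prod_encode])

definition vertex_kind :: "nat \<Rightarrow> bool" where
  "vertex_kind v = (fst (prod_decode v) = 0)"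

definition vertex_number :: "nat \<Rightarrow> nat" where
  "vertex_number v = snd (prod_decode v)"

lemma vertex_index_inverse [simp]:
  "vertex_kind (vertex_index b i) = b" "vertex_number (vertex_index b i) = i"
  by (simp_all add: vertex_index_def vertex_kind_def vertex_number_def)

lemma edge_index_inverse [simp]: "prod_decode (edge_index i j) = (i, j)"
  by (simp add: edge_index_def)

lemma free_group_hom_unique:
  assumes "f \<in> hom (free_group n) L" "g \<in> hom (free_group n) L" "group L"
    and "\<And>k. k < n \<Longrightarrow> f (generator {..<n} {} k) = g (generator {..<n} {} k)"
    and z: "z \<in> carrier (free_group n)"
  shows "f z = g z"
proof (rule presented_group_hom_unique[OF assms(3), where S = "{..<n}" and R = "{}"
      and f = "\<lambda>k. f (generator {..<n} {} k)"])
  show "f (generator {..<n} {} k) \<in> carrier L" if "k \<in> {..<n}" for k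
    using generator_closed[OF that, of "{}"] assms(1) by (auto simp: hom_def free_group_def)
qed (use assms in \<open>auto simp: free_group_def\<close>)

theorem theorem1p3:
  fixes m q1 q2 :: nat and x0 :: "((nat \<times> nat) \<times> complex) set"
  assumes "m \<ge> 2" "q1 \<ge> 2" "q2 \<ge> 2"
    and "x0 \<in> topspace (bipartite_complex m (complete_bipartite q1 q2))"
  shows "\<exists>(I :: nat set) (J :: nat set) (A :: (nat \<times> nat) set) \<phi>.
    finite I \<and> card I = (q1 - 1) * (q2 - 1) \<and> finite J \<and>
    embedding_diagram I (\<lambda>_. surface_group (m - 1)) J (\<lambda>_. free_group (m - 1)) A \<phi> \<and>
    fundamental_group (bipartite_complex m (complete_bipartite q1 q2)) x0
      \<cong> colimit_group I (\<lambda>_. surface_group (m - 1)) J (\<lambda>_. free_group (m - 1)) A \<phi>"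
proof -

  \<comment> \<open>Generators and relations of the fundamental group of the complex\<close>
  define n where "n = m - 1"
  have n: "m = Suc n" "n \<ge> 1" using assms(1) by (auto simp: n_def)
  let ?P = "complete_bipartite q1 q2"
  interpret X: rooted_polygons ?P "edge_word m" "2 * m" "(1, 1)" "{..<2 * m}" "\<lambda>_ k. k mod (2 * m)"
    by (rule rooted_bipartite) (use assms in auto)
  define H where "H = presented_group X.labels X.relators"
  define gen where "gen = (\<lambda>b i k. generator X.labels X.relators (letter b i k))"
  define q where "q = (\<lambda>b. if b then q1 else q2)"
  have H: "group H" unfolding H_def by (rule group_presented_group)
  interpret H: group H by (rule H)
  have iso_H: "fundamental_group (bipartite_complex m ?P) x0 \<cong> H"
    using X.fundamental_group_presentation assms(4) by (simp add: bipartite_complex_def H_def)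
  have P: "(i, j) \<in> ?P \<longleftrightarrow> i \<in> {1..q1} \<and> j \<in> {1..q2}" for i j
    by (auto simp: complete_bipartite_def)
  have labels: "X.labels = {letter b i k | b i k. i \<in> {1..q b} \<and> k < m}" (is "_ = ?L")
  proof (intro equalityI subsetI)
    fix l assume "l \<in> X.labels"
    then obtain i j where "(i, j) \<in> ?P" "l \<in> fst ` set (edge_word m (i, j))"
      by (auto simp: X.labels_def)
    then show "l \<in> ?L" unfolding set_edge_word P q_def by auto
  next
    fix l assume "l \<in> ?L"
    then obtain b i k where l: "l = letter b i k" "i \<in> {1..q b}" "k < m" by blast
    then have "(if b then i else 1, if b then 1 else i) \<in> ?P"
      using assms by (auto simp: P q_def split: if_splits)
    moreover have "l \<in> fst ` set (edge_word m (if b then i else 1, if b then 1 else i))"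
      using l unfolding set_edge_word by auto
    ultimately show "l \<in> X.labels" unfolding X.labels_def by blast
  qed
  have letter_in: "letter b i k \<in> X.labels \<longleftrightarrow> i \<in> {1..q b} \<and> k < m" for b i k
    by (auto simp: labels)
  have gen_closed: "gen b i k \<in> carrier H" if "i \<in> {1..q b}" "k < m" for b i k
    unfolding gen_def H_def using that letter_in by (intro generator_closed) simp
  \<comment> \<open>The letter is the quotient of two successive prefixes of the word of
    \<open>P\<^sub>1\<^sub>1\<close>, both trivial because every corner of this polygon belongs to
    \<open>C\<close>.\<close>
  have gen_1: "gen b 1 k = \<one>\<^bsub>H\<^esub>" if k: "k < m" for b k
  proof -
    define k' where "k' = (if b then 2 * k else Suc (2 * k))"
    have k': "k' < 2 * m" "edge_word m (1, 1) ! k' = (letter b 1 k, True)"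
      using k edge_word_nth'[of k' m 1 1] by (auto simp: k'_def)
    have p0: "(1, 1) \<in> ?P" using assms by (simp add: P)
    have pre: "X.L.pre (1, 1) i = \<one>\<^bsub>H\<^esub>" if "i \<le> 2 * m" for i
      using X.pre_root[of i] X.L.pre_n[OF p0] that by (cases "i = 2 * m") (auto simp: H_def)
    have "\<one>\<^bsub>H\<^esub> = \<one>\<^bsub>H\<^esub> \<otimes>\<^bsub>H\<^esub> gen b 1 k"
      using X.L.pre_Suc[OF p0 k'(1)] pre[of k'] pre[of "Suc k'"] k' by (simp add: gen_def H_def)
    then show ?thesis using gen_closed[of 1 b k] k assms by (simp add: q_def split: if_splits)
  qed
  have gen_rel: "pprod H (\<lambda>k. gen True i k \<otimes>\<^bsub>H\<^esub> gen False j k) m = \<one>\<^bsub>H\<^esub>" if "(i, j) \<in> ?P" for i j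
  proof -
    have "eval_word H (generator X.labels X.relators) (edge_word m (i, j)) =
        pprod H (\<lambda>k. gen True i k \<otimes>\<^bsub>H\<^esub> gen False j k) m"
      unfolding gen_def
    proof (rule eval_edge_word[OF H])
      show "generator X.labels X.relators s \<in> carrier H" if "s \<in> X.labels" for s
        using that unfolding H_def by (rule generator_closed)
    qed (use that in \<open>simp add: letter_in P q_def\<close>)
    then show ?thesis using X.L.relator[OF that] by (simp add: H_def)
  qed
  \<comment> \<open>The relator of \<open>P\<^sub>i\<^sub>1\<close> or
    \<open>P\<^sub>1\<^sub>j\<close>, in which the other family has index 1 and vanishes.\<close>
  have gen_prod: "pprod H (gen b i) m = \<one>\<^bsub>H\<^esub>" if i: "i \<in> {1..q b}" for b i
  proof -
    have "pprod H (gen b i) m = pprod H (\<lambda>k. gen True (if b then i else 1) k \<otimes>\<^bsub>H\<^esub> gen False (if b then 1 else i) k) m"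
      using gen_closed[OF i] by (intro pprod_cong) (auto simp: gen_1[simplified])
    also have "\<dots> = \<one>\<^bsub>H\<^esub>"
      using i assms by (intro gen_rel) (auto simp: P q_def split: if_splits)
    finally show ?thesis .
  qed

  \<comment> \<open>The diagram of surface groups and free groups\<close>
  let ?SG = "surface_group n" and ?F = "free_group n"
  define T where "T = presented_group (xy_letters n) {xy_word n}"
  define xy where "xy = (\<lambda>b k. generator (xy_letters n) {xy_word n} (xy_letter b k))"
  define fg where "fg = generator {..<n} ({} :: nat word set)"
  have T: "group T" unfolding T_def by (rule group_presented_group)
  have F: "group ?F" unfolding free_group_def by (rule group_presented_group)
  have SG: "group ?SG" by (rule group_surface_group[OF n(2)])
  interpret T: group T by (rule T)
  interpret F: group ?F by (rule F)
  interpret SG: group ?SG by (rule SG)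
  have fg_closed: "fg k \<in> carrier ?F" if "k < n" for k
    unfolding fg_def free_group_def using that by (intro generator_closed) simp
  have xy_closed: "xy b k \<in> carrier T" if "k < n" for b k
    unfolding xy_def T_def using that by (intro generator_closed) (simp add: xy_letter_def)
  obtain h where h: "h \<in> iso T ?SG"
    using T.iso_sym SG.iso_sym surface_group_xy[OF n(2)] unfolding T_def is_iso_def by blast
  define h' where "h' = inv_into (carrier T) h"
  have h': "h' \<in> iso ?SG T" unfolding h'_def by (rule T.iso_set_sym[OF h])
  have hh': "h (h' a) = a" if "a \<in> carrier ?SG" for a
    unfolding h'_def using h that by (simp add: iso_def bij_betw_def f_inv_into_f)
  have h'h: "h' (h z) = z" if "z \<in> carrier T" for z
    unfolding h'_def using h that by (simp add: iso_def bij_betw_def inv_into_f_f)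
  have h_hom: "h \<in> hom T ?SG" and h'_hom: "h' \<in> hom ?SG T" using h h' by (auto simp: iso_def)
  have "\<exists>e. \<forall>b. e b \<in> mon ?F T \<and> (\<forall>k<n. e b (fg k) = xy b k)"
    unfolding fg_def xy_def T_def using free_embedding[of n] by (intro choice) blast
  then obtain e where e: "e b \<in> mon ?F T" "k < n \<Longrightarrow> e b (fg k) = xy b k" for b k by blast
  have e_hom: "e b \<in> hom ?F T" for b using e(1) by (simp add: mon_def)

  define I where "I = (\<lambda>(i, j). edge_index i j) ` ({2..q1} \<times> {2..q2})"
  define J where "J = (\<Union>b. vertex_index b ` {2..q b})"
  define A where "A = amalgam_arrows q1 q2"
  \<comment> \<open>The embedding depends only on the kind of the vertex: all surface groups are
    copies of one group, and the target enters only through the arrows.\<close>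
  define \<phi> where "\<phi> = (\<lambda>v (_::nat) z. h (e (vertex_kind v) z))"
  have I_iff: "edge_index i j \<in> I \<longleftrightarrow> i \<in> {2..q1} \<and> j \<in> {2..q2}" for i j by (auto simp: I_def)
  have J_iff: "vertex_index b i \<in> J \<longleftrightarrow> i \<in> {2..q b}" for b i by (auto simp: J_def image_iff)
  have "finite I" "finite J" by (simp_all add: I_def J_def)
  have "card I = (q1 - 1) * (q2 - 1)"
    unfolding I_def by (subst card_image) (auto simp: inj_on_def card_cartesian_product)
  have D: "embedding_diagram I (\<lambda>_. ?SG) J (\<lambda>_. ?F) A \<phi>"
    unfolding embedding_diagram_def
  proof (intro conjI ballI)
    show "A \<subseteq> J \<times> I" by (auto simp: A_def amalgam_arrows_def I_iff J_iff q_def)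
    show "\<exists>i. (v, i) \<in> A" if v: "v \<in> J" for v
    proof -
      obtain b i where i: "v = vertex_index b i" "i \<in> {2..q b}" using v by (auto simp: J_def)
      then have "(v, edge_index (if b then i else 2) (if b then 2 else i)) \<in> A"
        using assms(2,3) unfolding A_def amalgam_arrows_def
        by (intro CollectI exI[of _ b] exI[of _ "if b then i else 2"] exI[of _ "if b then 2 else i"])
          (auto simp: q_def)
      then show ?thesis by blast
    qed
    show "case a of (v, i) \<Rightarrow> \<phi> v i \<in> mon ?F ?SG" if "a \<in> A" for a
    proof -
      have "h \<circ> e b \<in> mon ?F ?SG" for b
      proof -
        have "inj_on (h \<circ> e b) (carrier ?F)"
          using e(1)[of b] h
          by (intro comp_inj_on) (auto simp: mon_def iso_def bij_betw_def hom_def intro: inj_on_subset)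
        then show ?thesis using hom_compose[OF e_hom h_hom] by (simp add: mon_def)
      qed
      then show ?thesis by (auto simp: \<phi>_def o_def)
    qed
  qed (use SG F in auto)

  \<comment> \<open>The direct limit and its canonical maps\<close>
  define C where "C = colimit_group I (\<lambda>_. ?SG) J (\<lambda>_. ?F) A \<phi>"
  define inl where "inl = (\<lambda>i j. colimit_inl I (\<lambda>_. ?SG) J (\<lambda>_. ?F) A \<phi> (edge_index i j))"
  define inr where "inr = (\<lambda>b i. colimit_inr I (\<lambda>_. ?SG) J (\<lambda>_. ?F) A \<phi> (vertex_index b i))"
  have C: "group C" unfolding C_def colimit_group_def by (rule group_presented_group)
  interpret C: group C by (rule C)
  have inl: "inl i j \<in> hom ?SG C" if "i \<in> {2..q1}" "j \<in> {2..q2}" for i j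
    unfolding inl_def C_def by (rule colimit_group_cocone(1)[OF D]) (use that in \<open>simp add: I_iff\<close>)
  have inr: "inr b i \<in> hom ?F C" if "i \<in> {2..q b}" for b i
    unfolding inr_def C_def by (rule colimit_group_cocone(2)[OF D]) (use that in \<open>simp add: J_iff\<close>)
  have inl_inr: "inl i j (h (xy b k)) = inr b (if b then i else j) (fg k)"
    if "i \<in> {2..q1}" "j \<in> {2..q2}" "k < n" for i j b k
  proof -
    have "(vertex_index b (if b then i else j), edge_index i j) \<in> A"
      unfolding A_def amalgam_arrows_def using that by blast
    from colimit_group_cocone(3)[OF D this fg_closed[OF that(3)]] show ?thesis
      using e(2)[OF that(3)] by (simp add: inl_def inr_def \<phi>_def)
  qed

  \<comment> \<open>The homomorphism from the direct limit\<close>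
  have "\<exists>u. u \<in> hom T H \<and> (\<forall>b k. k < n \<longrightarrow> u (xy b k) = gen b (if b then i else j) k)"
    if ij: "i \<in> {2..q1}" "j \<in> {2..q2}" for i j
  proof -
    define f where "f = case_sum (gen True i) (gen False j)"
    have f: "f s \<in> carrier H" if "s \<in> xy_letters n" for s
      using that ij n(1) by (auto simp: f_def q_def intro!: gen_closed)
    have cl: "pprod H (gen True i) n \<in> carrier H" "pprod H (gen False j) n \<in> carrier H"
      "gen True i n \<in> carrier H" "gen False j n \<in> carrier H"
      using ij n(1) by (auto intro!: H.pprod_closed gen_closed simp: q_def)
    have cl': "pprod H (\<lambda>k. gen True i k \<otimes>\<^bsub>H\<^esub> gen False j k) n \<in> carrier H"
      using ij n(1) by (intro H.pprod_closed) (auto intro!: gen_closed simp: q_def)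
    have "pprod H (gen True i) m = \<one>\<^bsub>H\<^esub>" "pprod H (gen False j) m = \<one>\<^bsub>H\<^esub>"
      using gen_prod[of i True] gen_prod[of j False] ij by (auto simp: q_def)
    \<comment> \<open>The letters of superscript \<open>m\<close> are inverses of the products of
      the others, so \<open>xy_word\<close> evaluates to the word of
      \<open>P\<^sub>i\<^sub>j\<close>.\<close>
    then have inv: "inv\<^bsub>H\<^esub> pprod H (gen True i) n = gen True i n" "inv\<^bsub>H\<^esub> pprod H (gen False j) n = gen False j n"
      using cl n(1) H.inv_equality H.inv_inv by (metis H.inv_closed pprod.simps(2))+
    have "eval_word H f (xy_word n) = pprod H (\<lambda>k. gen True i k \<otimes>\<^bsub>H\<^esub> gen False j k) m"
      using xy_word_eval(2)[OF H f] cl cl' by (simp add: f_def inv n(1))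
    also have "\<dots> = \<one>\<^bsub>H\<^esub>" using ij by (intro gen_rel) (simp add: P)
    finally have "\<exists>u\<in>hom T H. \<forall>s\<in>xy_letters n. u (generator (xy_letters n) {xy_word n} s) = f s"
      unfolding T_def using xy_word_eval(1)[OF H f] by (intro presented_group_universal[OF H f]) auto
    then obtain u where u: "u \<in> hom T H" "\<And>s. s \<in> xy_letters n \<Longrightarrow> u (generator (xy_letters n) {xy_word n} s) = f s"
      by blast
    then show ?thesis
      by (intro exI[of _ u] conjI allI impI) (auto simp: xy_def xy_letter_def f_def)
  qed
  then obtain u where u: "\<And>i j. i \<in> {2..q1} \<Longrightarrow> j \<in> {2..q2} \<Longrightarrow> u i j \<in> hom T H"
      "\<And>i j b k. i \<in> {2..q1} \<Longrightarrow> j \<in> {2..q2} \<Longrightarrow> k < n \<Longrightarrow> u i j (xy b k) = gen b (if b then i else j) k"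
    by metis
  have ex_v: "\<exists>v. v \<in> hom ?F H \<and> (\<forall>k<n. v (fg k) = gen b i k)" if i: "i \<in> {2..q b}" for b i
  proof -
    have "\<exists>v\<in>hom ?F H. \<forall>k\<in>{..<n}. v (fg k) = gen b i k"
      unfolding free_group_def fg_def
      by (rule presented_group_universal[OF H]) (use i n(1) in \<open>auto intro!: gen_closed\<close>)
    then show ?thesis by auto
  qed
  define v where "v = (\<lambda>b i. SOME v. v \<in> hom ?F H \<and> (\<forall>k<n. v (fg k) = gen b i k))"
  have v: "v b i \<in> hom ?F H" "k < n \<Longrightarrow> v b i (fg k) = gen b i k" if "i \<in> {2..q b}" for b i k
    using someI_ex[OF ex_v[OF that]] unfolding v_def by blast+

  note F_unique = free_group_hom_unique[of _ n, folded fg_def]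

  define f1 where "f1 = (\<lambda>ij a. u (fst (prod_decode ij)) (snd (prod_decode ij)) (h' a))"
  define g1 where "g1 = (\<lambda>w. v (vertex_kind w) (vertex_number w))"
  have "\<exists>\<alpha>\<in>hom (colimit_group I (\<lambda>_. ?SG) J (\<lambda>_. ?F) A \<phi>) H.
      (\<forall>ij\<in>I. \<forall>a\<in>carrier ?SG. \<alpha> (colimit_inl I (\<lambda>_. ?SG) J (\<lambda>_. ?F) A \<phi> ij a) = f1 ij a) \<and>
      (\<forall>w\<in>J. \<forall>z\<in>carrier ?F. \<alpha> (colimit_inr I (\<lambda>_. ?SG) J (\<lambda>_. ?F) A \<phi> w z) = g1 w z)"
  proof (rule colimit_group_universal(1)[OF D H])
    show "f1 ij \<in> hom ?SG H" if "ij \<in> I" for ij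
    proof -
      obtain i j where ij: "ij = edge_index i j" "i \<in> {2..q1}" "j \<in> {2..q2}"
        using \<open>ij \<in> I\<close> by (auto simp: I_def)
      show ?thesis using hom_compose[OF h'_hom u(1)[OF ij(2,3)]] by (simp add: f1_def ij(1) o_def)
    qed
    show "g1 w \<in> hom ?F H" if "w \<in> J" for w
      using that v(1) by (auto simp: g1_def J_def)
    show "f1 ij (\<phi> w ij z) = g1 w z" if "(w, ij) \<in> A" "z \<in> carrier ?F" for w ij z
    proof -
      obtain b i j where *: "w = vertex_index b (if b then i else j)" "ij = edge_index i j"
          "i \<in> {2..q1}" "j \<in> {2..q2}"
        using \<open>(w, ij) \<in> A\<close> unfolding A_def amalgam_arrows_def by blast
      have ib: "(if b then i else j) \<in> {2..q b}" using * by (simp add: q_def)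
      have "u i j (e b z) = v b (if b then i else j) z"
      proof (rule F_unique[OF _ v(1)[OF ib] H _ that(2)])
        show "(\<lambda>z. u i j (e b z)) \<in> hom ?F H"
          using hom_compose[OF e_hom u(1)[OF *(3,4)]] by (simp add: o_def)
        show "u i j (e b (fg k)) = v b (if b then i else j) (fg k)" if "k < n" for k
          unfolding e(2)[OF that] u(2)[OF *(3,4) that] v(2)[OF ib that] ..
      qed
      moreover have "e b z \<in> carrier T" using e_hom[of b] that(2) by (auto simp: hom_def)
      ultimately show ?thesis by (simp add: f1_def g1_def \<phi>_def *(1,2) h'h)
    qed
  qed
  then obtain \<alpha> where \<alpha>: "\<alpha> \<in> hom C H"
      "\<And>i j a. i \<in> {2..q1} \<Longrightarrow> j \<in> {2..q2} \<Longrightarrow> a \<in> carrier ?SG \<Longrightarrow> \<alpha> (inl i j a) = u i j (h' a)"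
      "\<And>b i z. i \<in> {2..q b} \<Longrightarrow> z \<in> carrier ?F \<Longrightarrow> \<alpha> (inr b i z) = v b i z"
    unfolding C_def inl_def inr_def
    by (auto simp: I_iff J_iff f1_def g1_def)
  interpret \<alpha>: group_hom C H \<alpha>
    by (intro group_hom.intro group_hom_axioms.intro C H \<alpha>(1))

  \<comment> \<open>The homomorphism to the direct limit\<close>
  define px where "px = (\<lambda>b i k. inr b i (fg k))"
  \<comment> \<open>The values are forced by \<open>gen_1\<close>, by the free generators and by
    \<open>gen_prod\<close>; among superscripts below \<open>m\<close> the last case is
    \<open>k = n\<close>.\<close>
  define \<xi> where "\<xi> = (\<lambda>b (i::nat) k. if i = 1 then \<one>\<^bsub>C\<^esub> else if k < n then px b i k
      else inv\<^bsub>C\<^esub> pprod C (px b i) n)"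
  have px: "px b i k \<in> carrier C" if "i \<in> {2..q b}" "k < n" for b i k
    using inr[OF that(1)] fg_closed[OF that(2)] by (auto simp: px_def hom_def)
  have px_prod: "pprod C (px b i) n \<in> carrier C" if "i \<in> {2..q b}" for b i
    using px[OF that] by (intro C.pprod_closed)
  have two: "i \<in> {2..q b}" if "i \<in> {1..q b}" "i \<noteq> 1" for b i
    using that by auto
  have \<xi>_closed: "\<xi> b i k \<in> carrier C" if "i \<in> {1..q b}" for b i k
    using px[OF two[OF that]] px_prod[OF two[OF that]] by (auto simp: \<xi>_def)
  have \<xi>_1: "\<xi> b 1 k = \<one>\<^bsub>C\<^esub>" for b k by (simp add: \<xi>_def)
  have \<xi>_prod: "pprod C (\<xi> b i) m = \<one>\<^bsub>C\<^esub>" if i: "i \<in> {1..q b}" for b i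
  proof (cases "i = 1")
    case True
    then show ?thesis by (simp add: \<xi>_def C.pprod_one)
  next
    case False
    have "pprod C (\<xi> b i) n = pprod C (px b i) n"
      using False by (intro pprod_cong) (simp add: \<xi>_def)
    then show ?thesis using False px_prod[OF two[OF i False]] by (simp add: n(1) \<xi>_def)
  qed
  have \<xi>_rel: "pprod C (\<lambda>k. \<xi> True i k \<otimes>\<^bsub>C\<^esub> \<xi> False j k) m = \<one>\<^bsub>C\<^esub>"
    if i: "i \<in> {1..q True}" and j: "j \<in> {1..q False}" for i j
  proof -
    \<comment> \<open>Polygons with an index 1 reduce to \<open>\<xi>_prod\<close>. For the others
      the relator holds in the surface group belonging to \<open>(i, j)\<close> and is moved to
      \<open>C\<close> by \<open>inl i j\<close>.\<close>
    consider "i = 1" | "j = 1" | "i \<noteq> 1" "j \<noteq> 1" by blast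
    then show ?thesis
    proof cases
      case 1
      have "pprod C (\<lambda>k. \<xi> True i k \<otimes>\<^bsub>C\<^esub> \<xi> False j k) m = pprod C (\<xi> False j) m"
        using \<xi>_closed[OF j] by (intro pprod_cong) (simp add: 1 \<xi>_1[simplified])
      then show ?thesis using \<xi>_prod[OF j] by simp
    next
      case 2
      have "pprod C (\<lambda>k. \<xi> True i k \<otimes>\<^bsub>C\<^esub> \<xi> False j k) m = pprod C (\<xi> True i) m"
        using \<xi>_closed[OF i] by (intro pprod_cong) (simp add: 2 \<xi>_1[simplified])
      then show ?thesis using \<xi>_prod[OF i] by simp
    next
      case 3
      note i' = two[OF i 3(1)] and j' = two[OF j 3(2)]
      have ij: "i \<in> {2..q1}" "j \<in> {2..q2}" using i' j' by (auto simp: q_def)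
      define f where "f = (\<lambda>s. inl i j (h (generator (xy_letters n) {xy_word n} s)))"
      have t: "(\<lambda>z. inl i j (h z)) \<in> hom T C"
        using hom_compose[OF h_hom inl[OF ij]] by (simp add: o_def)
      have gc: "generator (xy_letters n) {xy_word n} s \<in> carrier T" if "s \<in> xy_letters n" for s
        unfolding T_def using that by (rule generator_closed)
      have f: "f s \<in> carrier C" if "s \<in> xy_letters n" for s
        using gc[OF that] t by (auto simp: f_def hom_def)
      have xw: "xy_word n \<in> words (xy_letters n)" by (rule xy_word_eval(1)[OF C f])
      have "eval_word C f (xy_word n) = inl i j (h (eval_word T (generator (xy_letters n) {xy_word n}) (xy_word n)))"
        unfolding f_def by (rule hom_eval_word[OF T C t gc xw, symmetric])
      also have "eval_word T (generator (xy_letters n) {xy_word n}) (xy_word n) = \<one>\<^bsub>T\<^esub>"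
        unfolding T_def by (rule eval_generator_relator[OF _ xw]) simp
      also have "inl i j (h \<one>\<^bsub>T\<^esub>) = \<one>\<^bsub>C\<^esub>" by (rule hom_one[OF t T C])
      finally have 1: "pprod C (\<lambda>k. f (Inl k) \<otimes>\<^bsub>C\<^esub> f (Inr k)) n \<otimes>\<^bsub>C\<^esub>
          (inv\<^bsub>C\<^esub> pprod C (\<lambda>k. f (Inl k)) n \<otimes>\<^bsub>C\<^esub> inv\<^bsub>C\<^esub> pprod C (\<lambda>k. f (Inr k)) n) = \<one>\<^bsub>C\<^esub>"
        by (simp only: xy_word_eval(2)[OF C f])
      have fk: "f (Inl k) = px True i k" "f (Inr k) = px False j k" if "k < n" for k
        using inl_inr[OF ij that, of True] inl_inr[OF ij that, of False]
        by (simp_all add: f_def px_def xy_def xy_letter_def)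
      have "pprod C (\<lambda>k. f (Inl k)) n = pprod C (px True i) n" "pprod C (\<lambda>k. f (Inr k)) n = pprod C (px False j) n"
        "pprod C (\<lambda>k. f (Inl k) \<otimes>\<^bsub>C\<^esub> f (Inr k)) n = pprod C (\<lambda>k. \<xi> True i k \<otimes>\<^bsub>C\<^esub> \<xi> False j k) n"
        using fk 3 by (auto intro!: pprod_cong simp: \<xi>_def)
      then show ?thesis using 1 3 by (simp add: n(1) \<xi>_def)
    qed
  qed
  \<comment> \<open>The superscripts inside the labels start at 1.\<close>
  define fl where "fl = (\<lambda>l. case l of Edge_x i k \<Rightarrow> \<xi> True i (k - 1) | Edge_y j k \<Rightarrow> \<xi> False j (k - 1))"
  have fl: "fl (letter b i k) = \<xi> b i k" for b i k by (simp add: fl_def letter_def)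
  have fl_closed: "fl l \<in> carrier C" if "l \<in> X.labels" for l
    using that \<xi>_closed by (auto simp: labels fl)
  have "\<exists>\<beta>\<in>hom H C. \<forall>l\<in>X.labels. \<beta> (generator X.labels X.relators l) = fl l"
    unfolding H_def
  proof (rule presented_group_universal[OF C fl_closed])
    fix r assume r: "r \<in> X.relators"
    have 1: "eval_word C fl (edge_word m (i, j)) = \<one>\<^bsub>C\<^esub>" if "(i, j) \<in> ?P" for i j
      using that eval_edge_word[where S = X.labels and f = fl and i = i and j = j and m = m, OF C fl_closed]
      by (simp add: letter_in P fl \<xi>_rel q_def)
    \<comment> \<open>All letters of \<open>P\<^sub>1\<^sub>1\<close> are sent to the unit, hence so
      is every prefix of its word.\<close>
    have 2: "eval_word C fl (take c (edge_word m (1, 1))) = \<one>\<^bsub>C\<^esub>" for c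
    proof (rule eval_word_trivial[OF C])
      fix s assume "s \<in> fst ` set (take c (edge_word m (1, 1)))"
      then have "s \<in> fst ` set (edge_word m (1, 1))" by (auto dest: in_set_takeD)
      then show "fl s = \<one>\<^bsub>C\<^esub>" unfolding set_edge_word by (auto simp: fl \<xi>_1[simplified])
    qed
    consider i j where "(i, j) \<in> ?P" "r = edge_word m (i, j)" | c where "r = take c (edge_word m (1, 1))"
      using r unfolding X.relators_def by auto
    then show "r \<in> words X.labels \<and> eval_word C fl r = \<one>\<^bsub>C\<^esub>"
      using X.relators_words[OF r] 1 2 by cases simp_all
  qed
  then obtain \<beta> where \<beta>: "\<beta> \<in> hom H C"
      "\<And>b i k. i \<in> {1..q b} \<Longrightarrow> k < m \<Longrightarrow> \<beta> (gen b i k) = \<xi> b i k"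
    unfolding gen_def using letter_in fl by metis
  have \<beta>_px: "\<beta> (gen b i k) = px b i k" if "i \<in> {2..q b}" "k < n" for b i k
    using \<beta>(2)[of i b k] that n(1) by (simp add: \<xi>_def)
  have \<alpha>_px: "\<alpha> (px b i k) = gen b i k" if "i \<in> {2..q b}" "k < n" for b i k
    using \<alpha>(3)[OF that(1) fg_closed[OF that(2)]] v(2)[OF that] by (simp add: px_def)

  \<comment> \<open>The two homomorphisms are mutually inverse\<close>
  have \<alpha>\<beta>: "\<alpha> (\<beta> x) = x" if x: "x \<in> carrier H" for x
  proof (rule presented_group_hom_unique[where S = X.labels and R = X.relators
        and f = "generator X.labels X.relators", OF H])
    show "(\<lambda>x. \<alpha> (\<beta> x)) \<in> hom (presented_group X.labels X.relators) H"
      using hom_compose[OF \<beta>(1) \<alpha>(1)] by (simp add: o_def H_def)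
    show "(\<lambda>x. x) \<in> hom (presented_group X.labels X.relators) H" by (simp add: hom_def H_def)
    fix l assume "l \<in> X.labels"
    then obtain b i k where l: "l = letter b i k" "i \<in> {1..q b}" "k < m" by (auto simp: labels)
    have "\<alpha> (\<xi> b i k) = gen b i k"
    proof -
      consider "i = 1" | "i \<noteq> 1" "k < n" | "i \<noteq> 1" "k = n" using l(3) n(1) by linarith
      then show ?thesis
      proof cases
        case 1
        then show ?thesis using gen_1[OF l(3)] \<xi>_1 by simp
      next
        case 2
        then show ?thesis using \<alpha>_px[OF two[OF l(2) 2(1)] 2(2)] by (simp add: \<xi>_def)
      next
        case 3
        note i = two[OF l(2) 3(1)]
        have "\<alpha> (pprod C (px b i) n) = pprod H (\<lambda>k. \<alpha> (px b i k)) n"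
          using px[OF i] by (intro hom_pprod C H \<alpha>(1))
        also have "\<dots> = pprod H (gen b i) n" using \<alpha>_px[OF i] by (intro pprod_cong)
        finally have "\<alpha> (\<xi> b i k) = inv\<^bsub>H\<^esub> pprod H (gen b i) n"
          using px_prod[OF i] 3 by (simp add: \<xi>_def)
        moreover have "pprod H (gen b i) n \<otimes>\<^bsub>H\<^esub> gen b i n = \<one>\<^bsub>H\<^esub>"
          using gen_prod[OF l(2)] by (simp add: n(1))
        moreover have "pprod H (gen b i) n \<in> carrier H" "gen b i n \<in> carrier H"
          using gen_closed[OF l(2)] n(1) by (auto intro!: H.pprod_closed)
        ultimately show ?thesis using 3(2) H.inv_equality H.inv_inv by (metis H.inv_closed)
      qed
    qed
    then show "\<alpha> (\<beta> (generator X.labels X.relators l)) = generator X.labels X.relators l"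
      using \<beta>(2)[OF l(2,3)] by (simp add: gen_def l(1))
  qed (use x in \<open>auto simp: H_def intro: generator_closed\<close>)

  have \<beta>\<alpha>: "\<beta> (\<alpha> y) = y" if y: "y \<in> carrier C" for y
  \<comment> \<open>The canonical maps themselves form the compatible family, so the composite is
    compared with the identity on the direct limit.\<close>
  proof (rule colimit_group_universal(2)[OF D C, where f = "colimit_inl I (\<lambda>_. ?SG) J (\<lambda>_. ?F) A \<phi>"
        and g = "colimit_inr I (\<lambda>_. ?SG) J (\<lambda>_. ?F) A \<phi>"])
    show "colimit_inl I (\<lambda>_. ?SG) J (\<lambda>_. ?F) A \<phi> ij \<in> hom ?SG C" if "ij \<in> I" for ij
      unfolding C_def by (rule colimit_group_cocone(1)[OF D that])
    show "colimit_inr I (\<lambda>_. ?SG) J (\<lambda>_. ?F) A \<phi> w \<in> hom ?F C" if "w \<in> J" for w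
      unfolding C_def by (rule colimit_group_cocone(2)[OF D that])
    show "colimit_inl I (\<lambda>_. ?SG) J (\<lambda>_. ?F) A \<phi> ij (\<phi> w ij z) = colimit_inr I (\<lambda>_. ?SG) J (\<lambda>_. ?F) A \<phi> w z"
      if "(w, ij) \<in> A" "z \<in> carrier ?F" for w ij z
      by (rule colimit_group_cocone(3)[OF D that])
    show "(\<lambda>y. \<beta> (\<alpha> y)) \<in> hom (colimit_group I (\<lambda>_. ?SG) J (\<lambda>_. ?F) A \<phi>) C"
      using hom_compose[OF \<alpha>(1) \<beta>(1)] by (simp add: o_def C_def)
    show "(\<lambda>y. y) \<in> hom (colimit_group I (\<lambda>_. ?SG) J (\<lambda>_. ?F) A \<phi>) C"
      by (simp add: hom_def C_def)
    show "y \<in> carrier (colimit_group I (\<lambda>_. ?SG) J (\<lambda>_. ?F) A \<phi>)" using y by (simp add: C_def)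
    show "\<beta> (\<alpha> (colimit_inl I (\<lambda>_. ?SG) J (\<lambda>_. ?F) A \<phi> ij a)) = colimit_inl I (\<lambda>_. ?SG) J (\<lambda>_. ?F) A \<phi> ij a"
      if ij': "ij \<in> I" and a: "a \<in> carrier ?SG" for ij a
    proof -
      obtain i j where ij: "ij = edge_index i j" "i \<in> {2..q1}" "j \<in> {2..q2}"
        using ij' by (auto simp: I_def)
      have "\<beta> (u i j (h' a)) = inl i j (h (h' a))"
      proof (rule presented_group_hom_unique[OF C, where S = "xy_letters n" and R = "{xy_word n}"
            and f = "\<lambda>s. \<beta> (u i j (generator (xy_letters n) {xy_word n} s))"])
        show "(\<lambda>z. \<beta> (u i j z)) \<in> hom (presented_group (xy_letters n) {xy_word n}) C"
          using hom_compose[OF u(1)[OF ij(2,3)] \<beta>(1)] by (simp add: o_def T_def)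
        show "(\<lambda>z. inl i j (h z)) \<in> hom (presented_group (xy_letters n) {xy_word n}) C"
          using hom_compose[OF h_hom inl[OF ij(2,3)]] by (simp add: o_def T_def)
        show "h' a \<in> carrier (presented_group (xy_letters n) {xy_word n})"
          using h'_hom a by (auto simp: hom_def T_def)
        fix s assume "s \<in> xy_letters n"
        then obtain b k where s: "s = xy_letter b k" "k < n"
          unfolding xy_letter_def by (auto split: if_splits) (metis (full_types))+
        have ib: "(if b then i else j) \<in> {2..q b}" using ij by (simp add: q_def)
        have "\<beta> (u i j (xy b k)) = px b (if b then i else j) k"
          unfolding u(2)[OF ij(2,3) s(2)] by (rule \<beta>_px[OF ib s(2)])
        then show "\<beta> (u i j (generator (xy_letters n) {xy_word n} s)) = inl i j (h (generator (xy_letters n) {xy_word n} s))"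
          using inl_inr[OF ij(2,3) s(2), of b] by (simp add: s(1) xy_def px_def)
        then show "\<beta> (u i j (generator (xy_letters n) {xy_word n} s)) \<in> carrier C"
          using px[OF ib s(2)] \<open>\<beta> (u i j (xy b k)) = px b (if b then i else j) k\<close>
          by (simp add: s(1) xy_def)
      qed
      then show ?thesis using \<alpha>(2)[OF ij(2,3) a] hh'[OF a] by (simp add: ij(1) inl_def)
    qed
    show "\<beta> (\<alpha> (colimit_inr I (\<lambda>_. ?SG) J (\<lambda>_. ?F) A \<phi> w z)) = colimit_inr I (\<lambda>_. ?SG) J (\<lambda>_. ?F) A \<phi> w z"
      if w': "w \<in> J" and z: "z \<in> carrier ?F" for w z
    proof -
      obtain b i where w: "w = vertex_index b i" "i \<in> {2..q b}" using w' by (auto simp: J_def)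
      have "\<beta> (v b i z) = inr b i z"
      proof (rule F_unique[OF _ inr[OF w(2)] C _ z])
        show "(\<lambda>z. \<beta> (v b i z)) \<in> hom ?F C"
          using hom_compose[OF v(1)[OF w(2)] \<beta>(1)] by (simp add: o_def)
        show "\<beta> (v b i (fg k)) = inr b i (fg k)" if "k < n" for k
          using v(2)[OF w(2) that] \<beta>_px[OF w(2) that] by (simp add: px_def)
      qed
      then show ?thesis using \<alpha>(3)[OF w(2) z] by (simp add: w(1) inr_def)
    qed
  qed
  have "\<beta> \<in> iso H C"
    by (rule isoI_inverse[OF \<beta>(1) \<alpha>(1) \<alpha>\<beta> \<beta>\<alpha>])
  then have "fundamental_group (bipartite_complex m ?P) x0 \<cong> C"
    using iso_trans[OF iso_H] by (auto simp: is_iso_def)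
  then show ?thesis
    using \<open>finite I\<close> \<open>finite J\<close> \<open>card I = (q1 - 1) * (q2 - 1)\<close> D unfolding C_def n_def by blast
qed

end
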